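(* Within the class of pretentious functions in $\mathcal{M}$, the following relations hold between subclasses: $$\{\text{periodic}\}\subsetneq\{\text{automatic}\}\subsetneq\{\text{Toeplitz}\}\subsetneq\{\text{RAP}\}=\{\text{having a unique Furstenberg system}\}\subsetneq\{\text{pretentious}\}.$$
   Context: $\mathbb{N}=\{1,2,\ldots\}$. $\mathcal{M}$ is the class of multiplicative functions $f:\mathbb{N}\to\mathbb{C}$ ($f(mn)=f(m)f(n)$ for coprime $m,n$) with $|f|\le1$. $f\in\mathcal{M}$ is pretentious if there are a Dirichlet character $\chi$ and $t\in\mathbb{R}$ with $\sum_{p\text{ prime}}\frac1p\big(1-\mathrm{Re}(f(p)\overline{\chi(p)p^{it}})\big)<+\infty$. All classes in the claim are classes of pretentious $f\in\mathcal{M}$ with the additional property named. Automatic: $f$ is $r$-automatic ($r\ge2$) if the family of sequences $n\mapsto f(r^kn+j)$, $k\ge1$, $0\le j<r^k$, is finite; automatic means $r$-automatic for some $r\geq 2$. Toeplitz: for every $n\in\mathbb{N}$ there is $m\ge1$ such that $f(n')=f(n)$ for all $n'\in\mathbb{N}$ with $n'\equiv n\bmod m$. RAP (Besicovitch rationally almost periodic): for each $\varepsilon>0$ there is a periodic sequence $f_\varepsilon$ with $\limsup_{N\to\infty}\frac1N\sum_{n<N}|f(n)-f_\varepsilon(n)|<\varepsilon$. Unique Furstenberg system: let $\mathbb{U}$ be the closed unit disc and $S$ the left shift on $\mathbb{U}^{\mathbb{Z}}$, and view $f$ as an element of $\mathbb{U}^{\mathbb{Z}}$ (extended e.g. by $0$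 to non-positive integers); $f$ has a unique Furstenberg system if $\lim_{N\to\infty}\frac1N\sum_{n\le N}\delta_{S^nf}$ exists in the weak$^*$ topology. *)

theory Defs
  imports "HOL-Probability.Probability" "HOL-Number_Theory.Cong"
begin

text \<open>
  Arithmetic functions on \<open>{1, 2, \<dots>}\<close> are rendered as functions on \<^typ>\<open>nat\<close>. All notions below
  look at positive arguments only; members of the class \<open>\<M>\<close> take the junk value \<open>0\<close> at \<open>0\<close>, so
  that they correspond one-to-one to functions on the positive integers.
  The condition \<open>f 1 = 1\<close> is not required, so the zero function is a member of \<open>\<M>\<close>.
\<close>

definition mult_class :: "(nat \<Rightarrow> complex) set" where
  "mult_class = {f. f 0 = 0 \<and>
     (\<forall>m\<ge>1. \<forall>n\<ge>1. coprime m n \<longrightarrow> f (m * n) = f m * f n) \<and>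
     (\<forall>n\<ge>1. cmod (f n) \<le> 1)}"

definition dirichlet_char :: "nat \<Rightarrow> (nat \<Rightarrow> complex) \<Rightarrow> bool" where
  "dirichlet_char q chi \<longleftrightarrow> q \<ge> 1 \<and>
     (\<forall>m n. chi (m * n) = chi m * chi n) \<and>
     (\<forall>n. chi (n + q) = chi n) \<and>
     (\<forall>n. chi n \<noteq> 0 \<longleftrightarrow> coprime n q)"

text \<open>
  For \<open>f\<close> in \<^const>\<open>mult_class\<close> all terms of the series are nonnegative, so that
  (unconditional) summability expresses that the sum is less than \<open>+\<infinity>\<close>.
\<close>

definition pretentious :: "(nat \<Rightarrow> complex) \<Rightarrow> bool" where
  "pretentious f \<longleftrightarrow> (\<exists>q chi. \<exists>t::real. dirichlet_char q chi \<and>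
     (\<lambda>p::nat. 1 / real p * (1 - Re (f p * cnj (chi p * of_nat p powr (\<i> * of_real t)))))
       summable_on {p. prime p})"

definition periodic_seq :: "(nat \<Rightarrow> complex) \<Rightarrow> bool" where
  "periodic_seq f \<longleftrightarrow> (\<exists>q\<ge>1. \<forall>n\<ge>1. f (n + q) = f n)"

definition automatic_base :: "nat \<Rightarrow> (nat \<Rightarrow> complex) \<Rightarrow> bool" where
  "automatic_base r f \<longleftrightarrow>
     finite {restrict (\<lambda>n. f (r ^ k * n + j)) {1..} | k j. k \<ge> 1 \<and> j < r ^ k}"

definition automatic :: "(nat \<Rightarrow> complex) \<Rightarrow> bool" where
  "automatic f \<longleftrightarrow> (\<exists>r\<ge>2. automatic_base r f)"

definition toeplitz :: "(nat \<Rightarrow> complex) \<Rightarrow> bool" where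
  "toeplitz f \<longleftrightarrow> (\<forall>n\<ge>1. \<exists>m\<ge>1. \<forall>n'\<ge>1. [n' = n] (mod m) \<longrightarrow> f n' = f n)"

definition rap :: "(nat \<Rightarrow> complex) \<Rightarrow> bool" where
  "rap f \<longleftrightarrow> (\<forall>\<epsilon>>0. \<exists>g. periodic_seq g \<and>
     limsup (\<lambda>N. ereal (1 / real N * (\<Sum>n\<in>{1..<N}. cmod (f n - g n)))) < ereal \<epsilon>)"

text \<open>
  The space \<open>\<U>\<^sup>\<int>\<close>, with the subspace topology of the product topology on \<^typ>\<open>int \<Rightarrow> complex\<close>.
\<close>

definition disc_seqs :: "(int \<Rightarrow> complex) set" where
  "disc_seqs = {x. \<forall>k. x k \<in> cball 0 1}"

definition left_shift :: "(int \<Rightarrow> complex) \<Rightarrow> (int \<Rightarrow> complex)" where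
  "left_shift x = (\<lambda>k. x (k + 1))"

definition two_sided :: "(nat \<Rightarrow> complex) \<Rightarrow> (int \<Rightarrow> complex)" where
  "two_sided f = (\<lambda>k. if k \<ge> 1 then f (nat k) else 0)"

definition borel_disc_seqs :: "(int \<Rightarrow> complex) measure" where
  "borel_disc_seqs = restrict_space borel disc_seqs"

text \<open>
  The measure \<open>1/N \<Sum>\<^bsub>n\<le>N\<^esub> \<delta>\<^bsub>S\<^sup>n f\<^esub>\<close> as the image of the uniform distribution
  on \<open>{1..N}\<close>; see \<open>emeasure_empirical\<close> below.
\<close>

definition empirical :: "(nat \<Rightarrow> complex) \<Rightarrow> nat \<Rightarrow> (int \<Rightarrow> complex) measure" where
  "empirical f N =
     distr (uniform_count_measure {1..N}) borel_disc_seqs (\<lambda>n. (left_shift ^^ n) (two_sided f))"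

definition weak_star_lim ::
  "(nat \<Rightarrow> (int \<Rightarrow> complex) measure) \<Rightarrow> (int \<Rightarrow> complex) measure \<Rightarrow> bool" where
  "weak_star_lim \<mu> \<nu> \<longleftrightarrow>
     (\<forall>F :: (int \<Rightarrow> complex) \<Rightarrow> real. continuous_on disc_seqs F \<longrightarrow>
        (\<lambda>N. integral\<^sup>L (\<mu> N) F) \<longlonglongrightarrow> integral\<^sup>L \<nu> F)"

definition unique_furstenberg :: "(nat \<Rightarrow> complex) \<Rightarrow> bool" where
  "unique_furstenberg f \<longleftrightarrow>
     (\<exists>\<nu>. prob_space \<nu> \<and> sets \<nu> = sets borel_disc_seqs \<and> weak_star_lim (empirical f) \<nu>)"

definition pretentious_class :: "(nat \<Rightarrow> complex) set" where
  "pretentious_class = {f \<in> mult_class. pretentious f}"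

lemma left_shift_funpow: "(left_shift ^^ n) x = (\<lambda>k. x (k + int n))"
  by (induction n) (auto simp: left_shift_def algebra_simps)

lemma shifts_in_disc_seqs:
  assumes "f \<in> mult_class"
  shows "(left_shift ^^ n) (two_sided f) \<in> disc_seqs"
  using assms by (auto simp: disc_seqs_def left_shift_funpow two_sided_def mult_class_def)

lemma emeasure_empirical:
  assumes "f \<in> mult_class" "A \<in> sets borel_disc_seqs" "N \<ge> 1"
  shows "emeasure (empirical f N) A =
    (\<Sum>n=1..N. emeasure (return borel_disc_seqs ((left_shift ^^ n) (two_sided f))) A) / of_nat N"
proof -
  let ?g = "\<lambda>n. (left_shift ^^ n) (two_sided f)"
  have g: "?g \<in> measurable (uniform_count_measure {1..N}) borel_disc_seqs"
    using shifts_in_disc_seqs[OF assms(1)]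
    by (auto simp: measurable_def space_uniform_count_measure sets_uniform_count_measure
        borel_disc_seqs_def space_restrict_space)
  have "emeasure (empirical f N) A = emeasure (uniform_count_measure {1..N}) ({n\<in>{1..N}. ?g n \<in> A})"
    unfolding empirical_def using emeasure_distr[OF g assms(2)]
    by (simp add: space_uniform_count_measure vimage_def Int_def conj_commute)
  also have "\<dots> = ennreal (real (card {n\<in>{1..N}. ?g n \<in> A}) / real N)"
    by (subst emeasure_uniform_count_measure) auto
  also have "\<dots> = of_nat (card {n\<in>{1..N}. ?g n \<in> A}) / of_nat N"
    using assms(3) by (simp add: divide_ennreal[symmetric] ennreal_of_nat_eq_real_of_nat)
  also have "of_nat (card {n\<in>{1..N}. ?g n \<in> A}) = (\<Sum>n=1..N. indicator A (?g n) :: ennreal)"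
    by (simp add: indicator_def sum.If_cases Int_def)
  finally show ?thesis
    using assms(2) by simp
qed

end

theory Submission
  imports Defs "HOL-Number_Theory.Number_Theory" "HOL-Computational_Algebra.Squarefree" "HOL-Real_Asymp.Real_Asymp"
begin

text \<open>
  Let \<open>f\<close> be pretentious to \<open>\<chi>(n) n\<^sup>i\<^sup>t\<close>. The Turan-Kubilius inequality shows that along a progression whose
  modulus \<open>Q\<close> is divisible by all small primes, \<open>f(n)\<close> is on average close to
  \<open>\<chi>(n) n\<^sup>i\<^sup>t exp (A\<^sub>Q(N))\<close>, where \<open>A\<^sub>Q(N)\<close> sums \<open>(f(p) \<chi>(p)\<^sup>* p\<^sup>-\<^sup>i\<^sup>t - 1) / p\<close> over the primes
  \<open>p \<le> N\<^sup>1\<^sup>/\<^sup>2\<close> not dividing \<open>Q\<close> and varies slowly with \<open>N\<close>. Hence \<open>f\<close> is rationally almost periodic as soon as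
  \<open>t = 0\<close> and \<open>exp (A(N))\<close> converges. Because of the slow variation, both follow once some power of \<open>exp (A(N)) N\<^sup>i\<^sup>t\<close>
  converges, which is the case if \<open>f\<close> takes finitely many values on some progression \<open>m n + 1\<close>
  (Toeplitz and automatic functions), or if a power \<open>f\<^sup>k\<close> whose Euler product does not vanish has a mean
  value (functions with a unique Furstenberg system). For an automatic \<open>f\<close>, two equal elements
  \<open>f(r\<^sup>k n + 1) = f(r\<^sup>l n + 1)\<close> of the kernel moreover force \<open>f(p\<^sup>e) = \<chi>(p\<^sup>e)\<close> for all large primes \<open>p\<close>.
\<close>

section \<open>Divisibility counts and the Turan-Kubilius inequality in progressions\<close>

text \<open>Pretentiousness controls real parts only: the series of - Re (h p) / p and of |h p|^2 /
  p converge, where h p is the deviation at the prime p, but the imaginary parts may let A(N) drift.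
  So |exp (A(N))| stays away from 0 while the phase may rotate, though more slowly than N^(it) with
  t nonzero; comparing the scales N and l N tells the two rotations apart. The cut at N^(1/2) keeps
  the sieve elementary: at most N^(1/2) primes lie below it, which bounds the sum of all
  covariances, and at most two prime factors of a term lie above it. The power k makes chi^k trivial
  on units and keeps the local factor at 2 from degenerating; at odd primes 1 - 2/p is already
  positive. Conversely, for a rationally almost periodic function the periodic approximants are read
  at a random point of the inverse limit of the rings Z/Q(k), modelled on [0,1); they converge
  almost surely, and the law of the limit is the Furstenberg measure.\<close>

lemma card_residue_less:
  fixes a d N :: nat
  assumes "a < d"
  shows "card {n. n < N \<and> n mod d = a} = (N + d - 1 - a) div d"
proof (induction N)
  case 0
  then show ?case using assms by simp
next
  case (Suc N)
  define M where "M = N + d - 1 - a"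
  have M: "Suc M = N + (d - a)" "Suc N + d - 1 - a = Suc M"
    using assms by (auto simp: M_def)
  have "Suc M mod d = 0 \<longleftrightarrow> [N + (d - a) = a + (d - a)] (mod d)"
    using assms by (simp add: cong_def M)
  also have "\<dots> \<longleftrightarrow> N mod d = a"
    using assms cong_add_rcancel_nat[of N "d - a" a d] by (simp add: cong_def)
  finally have *: "Suc M mod d = 0 \<longleftrightarrow> N mod d = a" .
  have "{n. n < Suc N \<and> n mod d = a} =
      (if N mod d = a then insert N {n. n < N \<and> n mod d = a} else {n. n < N \<and> n mod d = a})"
    by (auto simp: less_Suc_eq)
  then show ?case
    using Suc * unfolding M(2) M_def[symmetric] by (simp add: div_Suc del: M(1))
qed

lemma card_residue_less_approx:
  fixes a d N :: nat
  assumes "a < d"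
  shows "\<bar>real (card {n. n < N \<and> n mod d = a}) - real N / real d\<bar> \<le> 1"
proof -
  define x where "x = N + d - 1 - a"
  have d: "real d > 0" using assms by simp
  have x: "real x = real N + (real d - 1 - real a)" using assms by (simp add: x_def of_nat_diff)
  have 1: "real (x div d) \<le> real x / real d" by (rule of_nat_div_le_of_nat)
  have "x < (x div d + 1) * d"
    using assms by (metis Suc_eq_plus1 dividend_less_div_times mult.commute not_less0 mult_Suc add.commute gr0I)
  then have "real x < (real (x div d) + 1) * real d"
    by (metis of_nat_less_iff of_nat_mult of_nat_add of_nat_1)
  then have 2: "real x / real d \<le> real (x div d) + 1" using d by (simp add: field_simps)
  have "real x / real d = real N / real d + (real d - 1 - real a) / real d"
    by (simp add: x add_divide_distrib)
  moreover have "0 \<le> (real d - 1 - real a) / real d" "(real d - 1 - real a) / real d \<le> 1"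
    using d assms by (auto simp: field_simps)
  ultimately show ?thesis
    using 1 2 unfolding card_residue_less[OF assms] x_def[symmetric] by linarith
qed

lemma ap_divisor_count:
  fixes d Q c N :: nat
  assumes "coprime d Q" "d > 0"
  shows "\<bar>real (card {n. n < N \<and> d dvd Q * n + c}) - real N / real d\<bar> \<le> 1"
proof -
  obtain Q' where Q': "[Q * Q' = 1] (mod d)"
    using cong_solve_coprime_nat[of Q d] assms(1) by (auto simp: coprime_commute)
  \<comment> \<open>The residue -c / Q modulo d, with (d - 1) * c standing for -c in the natural
    numbers.\<close>
  define a where "a = (Q' * ((d - 1) * c)) mod d"
  have a: "a < d" using assms(2) by (simp add: a_def)
  have "[Q * a + c = Q * (Q' * ((d - 1) * c)) + c] (mod d)"
    unfolding a_def by (intro cong_add cong_mult cong_refl) (simp add: cong_def)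
  also have "Q * (Q' * ((d - 1) * c)) = (Q * Q') * ((d - 1) * c)" by simp
  also have "[(Q * Q') * ((d - 1) * c) + c = 1 * ((d - 1) * c) + c] (mod d)"
    by (intro cong_add cong_mult cong_refl Q')
  also have "1 * ((d - 1) * c) + c = d * c"
    using assms(2) by (metis Suc_diff_1 mult_1 mult_Suc add.commute)
  also have "[d * c = 0] (mod d)" by (simp add: cong_def)
  finally have a0: "[Q * a + c = 0] (mod d)" .
  have "d dvd Q * n + c \<longleftrightarrow> n mod d = a" for n
  proof -
    have "d dvd Q * n + c \<longleftrightarrow> [Q * n + c = 0] (mod d)" by (simp add: cong_0_iff)
    also have "\<dots> \<longleftrightarrow> [Q * n + c = Q * a + c] (mod d)"
      using a0 by (meson cong_sym cong_trans)
    also have "\<dots> \<longleftrightarrow> [n = a] (mod d)"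
      using assms(1) by (simp add: cong_add_rcancel_nat cong_mult_lcancel_nat coprime_commute)
    finally show ?thesis using a by (simp add: cong_def)
  qed
  then show ?thesis using card_residue_less_approx[OF a, of N] by simp
qed

lemma sum_of_bool_less:
  fixes N :: nat
  shows "(\<Sum>n<N. of_bool (P n) :: real) = real (card {n. n < N \<and> P n})"
proof -
  have "{n. n < N \<and> P n} = {n \<in> {..<N}. P n}" by auto
  then have "real (card {n. n < N \<and> P n}) = (\<Sum>n\<in>{n \<in> {..<N}. P n}. 1)" by simp
  also have "\<dots> = (\<Sum>n<N. if P n then 1 else 0)" by (rule sum.inter_filter) simp
  finally show ?thesis by (simp only: of_bool_def)
qed

text \<open>After expansion the main terms N / (p p') cancel, and only counting errors of size at
  most 1, 1 / p' and 1 / p remain. Hence the bound does not grow with N.\<close>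

lemma centered_divisor_cov:
  fixes p p' Q c N :: nat
  defines "Y \<equiv> \<lambda>p n. of_bool (p dvd Q * n + c) - 1 / real p"
  assumes "prime p" "prime p'" "p \<noteq> p'" "coprime p Q" "coprime p' Q"
  shows "\<bar>\<Sum>n<N. Y p n * Y p' n\<bar> \<le> 2"
proof -
  have cp: "coprime p p'" using assms by (simp add: primes_coprime)
  define M where "M d = real (card {n. n < N \<and> d dvd Q * n + c})" for d
  have pp: "p \<ge> 2" "p' \<ge> 2" using assms prime_ge_2_nat by auto
  have dv: "of_bool (p dvd x) * of_bool (p' dvd x) = (of_bool (p * p' dvd x) :: real)" for x
    using cp by (auto intro: divides_mult)
  have "Y p n * Y p' n = of_bool (p * p' dvd Q * n + c) - of_bool (p dvd Q * n + c) / real p' -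
      of_bool (p' dvd Q * n + c) / real p + 1 / (real p * real p')" for n
    unfolding Y_def dv[symmetric] by (simp add: algebra_simps)
  then have "(\<Sum>n<N. Y p n * Y p' n) = M (p * p') - M p / real p' - M p' / real p + real N / (real p * real p')"
    by (simp add: sum.distrib sum_subtractf sum_divide_distrib[symmetric] sum_of_bool_less M_def)
  also have "\<dots> = (M (p * p') - real N / real (p * p')) - (M p - real N / real p) / real p' - (M p' - real N / real p') / real p"
    using pp by (simp add: field_simps)
  finally have eq: "(\<Sum>n<N. Y p n * Y p' n) = \<dots>" .
  have b: "\<bar>M d - real N / real d\<bar> \<le> 1" if "coprime d Q" "d > 0" for d
    using ap_divisor_count[OF that] by (simp add: M_def)
  have b1: "\<bar>M (p * p') - real N / real (p * p')\<bar> \<le> 1" using pp assms by (intro b) auto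
  have h: "\<bar>(M p - real N / real p) / real p'\<bar> \<le> 1/2" "\<bar>(M p' - real N / real p') / real p\<bar> \<le> 1/2"
    unfolding abs_divide using pp assms b[of p] b[of p'] by (auto intro!: frac_le)
  show ?thesis using eq b1 h by linarith
qed

text \<open>The constant 3 is 2 from the count N / p + 1, as p is at most N, plus 1 from N /
  p^2.\<close>

lemma centered_divisor_var:
  fixes p Q c N :: nat
  defines "Y \<equiv> \<lambda>p n. of_bool (p dvd Q * n + c) - 1 / real p"
  assumes "prime p" "coprime p Q" "p * p \<le> N"
  shows "(\<Sum>n<N. Y p n * Y p n) \<le> 3 * real N / real p"
proof -
  define M where "M = real (card {n. n < N \<and> p dvd Q * n + c})"
  have pp: "p \<ge> 2" using assms prime_ge_2_nat by auto
  have "p \<le> N" using assms(4) pp by (metis dual_order.trans le_square)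
  have "Y p n * Y p n = of_bool (p dvd Q * n + c) * (1 - 2 / real p) + 1 / (real p * real p)" for n
    by (simp add: Y_def algebra_simps of_bool_def)
  then have "(\<Sum>n<N. Y p n * Y p n) = M * (1 - 2 / real p) + real N / (real p * real p)"
    by (simp add: sum.distrib sum_subtractf sum_distrib_right[symmetric] sum_of_bool_less M_def)
  also have "\<dots> \<le> 3 * real N / real p"
  proof -
    have "M * (1 - 2 / real p) \<le> M * 1"
      by (intro mult_left_mono) (auto simp: M_def)
    moreover have "M \<le> real N / real p + 1"
      using ap_divisor_count[of p Q N c] assms pp by (simp add: M_def)
    moreover have "1 \<le> real N / real p" using \<open>p \<le> N\<close> pp by (simp add: field_simps)
    moreover have "real N / (real p * real p) \<le> real N / (real p * 1)"
      using pp by (intro divide_left_mono mult_left_mono) auto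
    ultimately show ?thesis by simp
  qed
  finally show ?thesis .
qed

text \<open>The diagonal contributes 3 N times the right-hand sum, by the variance bound. The
  off-diagonal covariances are O(1) each and give 2 (sum |h p|)^2; Cauchy-Schwarz with weights sqrt
  p bounds this by 2 N times the same sum, because P lies below sqrt N and therefore its elements
  add up to at most sqrt N * sqrt N. Together 5.\<close>

lemma turan_kubilius_ap:
  fixes h :: "nat \<Rightarrow> complex" and Q c N :: nat
  assumes P: "finite P" "\<And>p. p \<in> P \<Longrightarrow> prime p" "\<And>p. p \<in> P \<Longrightarrow> coprime p Q" "\<And>p. p \<in> P \<Longrightarrow> p * p \<le> N"
  shows "(\<Sum>n<N. (cmod (\<Sum>p\<in>P. h p * of_real (of_bool (p dvd Q * n + c) - 1 / real p)))\<^sup>2)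
      \<le> 5 * real N * (\<Sum>p\<in>P. (cmod (h p))\<^sup>2 / real p)"
proof -
  define Y where "Y = (\<lambda>p n. of_bool (p dvd Q * n + c) - 1 / real p)"
  define S where "S n = (\<Sum>p\<in>P. h p * of_real (Y p n))" for n
  define B where "B = (\<Sum>p\<in>P. (cmod (h p))\<^sup>2 / real p)"
  have "complex_of_real (\<Sum>n<N. (cmod (S n))\<^sup>2) = (\<Sum>n<N. S n * cnj (S n))"
    by (simp add: complex_norm_square del: of_real_power)
  also have "\<dots> = (\<Sum>n<N. \<Sum>p\<in>P. \<Sum>p'\<in>P. (h p * cnj (h p')) * of_real (Y p n * Y p' n))"
    by (simp add: S_def sum_product mult_ac)
  also have "\<dots> = (\<Sum>p\<in>P. \<Sum>p'\<in>P. (h p * cnj (h p')) * of_real (\<Sum>n<N. Y p n * Y p' n))"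
    unfolding of_real_sum sum_distrib_left
    by (rule trans[OF sum.swap]) (intro sum.cong refl sum.swap)
  finally have "complex_of_real (\<Sum>n<N. (cmod (S n))\<^sup>2) = \<dots>" .
  then have "(\<Sum>n<N. (cmod (S n))\<^sup>2) \<le> cmod (\<Sum>p\<in>P. \<Sum>p'\<in>P. (h p * cnj (h p')) * of_real (\<Sum>n<N. Y p n * Y p' n))"
    by (metis norm_of_real abs_ge_self)
  also have "\<dots> \<le> (\<Sum>p\<in>P. \<Sum>p'\<in>P. cmod (h p) * cmod (h p') * \<bar>\<Sum>n<N. Y p n * Y p' n\<bar>)"
    by (intro order.trans[OF norm_sum] sum_mono) (simp add: norm_mult del: of_real_sum)
  also have "\<dots> \<le> (\<Sum>p\<in>P. \<Sum>p'\<in>P. cmod (h p) * cmod (h p') * (2 + (if p' = p then 3 * real N / real p else 0)))"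
  proof (intro sum_mono mult_left_mono)
    fix p p' assume p: "p \<in> P" "p' \<in> P"
    show "\<bar>\<Sum>n<N. Y p n * Y p' n\<bar> \<le> 2 + (if p' = p then 3 * real N / real p else 0)"
    proof (cases "p = p'")
      case False
      then show ?thesis using centered_divisor_cov[where p = p and p' = p' and Q = Q and c = c and N = N] p P by (simp add: Y_def)
    next
      case True
      have "(\<Sum>n<N. Y p n * Y p n) \<ge> 0" by (intro sum_nonneg) auto
      with True show ?thesis using centered_divisor_var[where p = p and Q = Q and c = c and N = N] p P by (simp add: Y_def)
    qed
  qed auto
  also have "\<dots> = 2 * (\<Sum>p\<in>P. cmod (h p))\<^sup>2 + 3 * real N * B"
  proof -
    have "(\<Sum>p'\<in>P. cmod (h p) * cmod (h p') * (2 + (if p' = p then 3 * real N / real p else 0))) =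
       2 * cmod (h p) * (\<Sum>p'\<in>P. cmod (h p')) + 3 * real N * ((cmod (h p))\<^sup>2 / real p)" if "p \<in> P" for p
    proof -
      have "(\<Sum>p'\<in>P. cmod (h p) * cmod (h p') * (2 + (if p' = p then 3 * real N / real p else 0))) =
        (\<Sum>p'\<in>P. 2 * cmod (h p) * cmod (h p') + (if p' = p then cmod (h p) * cmod (h p') * (3 * real N / real p) else 0))"
        by (intro sum.cong) (auto simp: algebra_simps)
      also have "\<dots> = 2 * cmod (h p) * (\<Sum>p'\<in>P. cmod (h p')) + cmod (h p) * cmod (h p) * (3 * real N / real p)"
        using that P(1) by (simp add: sum.distrib sum_distrib_left)
      finally show ?thesis by (simp add: power2_eq_square)
    qed
    then have "(\<Sum>p\<in>P. \<Sum>p'\<in>P. cmod (h p) * cmod (h p') * (2 + (if p' = p then 3 * real N / real p else 0))) =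
      (\<Sum>p\<in>P. 2 * cmod (h p) * (\<Sum>p'\<in>P. cmod (h p')) + 3 * real N * ((cmod (h p))\<^sup>2 / real p))"
      by (rule sum.cong[OF refl])
    also have "\<dots> = 2 * (\<Sum>p\<in>P. cmod (h p))\<^sup>2 + 3 * real N * B"
      by (simp only: B_def sum.distrib power2_eq_square sum_distrib_left sum_distrib_right mult_ac)
    finally show ?thesis .
  qed
  also have "(\<Sum>p\<in>P. cmod (h p))\<^sup>2 \<le> B * real N"
  proof -
    have pos: "p > 0" if "p \<in> P" for p using P(2)[OF that] prime_gt_0_nat by auto
    have "(\<Sum>p\<in>P. cmod (h p))\<^sup>2 = (\<Sum>p\<in>P. (cmod (h p) / sqrt (real p)) * sqrt (real p))\<^sup>2"
      using pos by (intro arg_cong[of _ _ "\<lambda>x. x\<^sup>2"] sum.cong) auto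
    also have "\<dots> \<le> (\<Sum>p\<in>P. (cmod (h p) / sqrt (real p))\<^sup>2) * (\<Sum>p\<in>P. (sqrt (real p))\<^sup>2)"
      by (rule Cauchy_Schwarz_ineq_sum)
    also have "(\<Sum>p\<in>P. (cmod (h p) / sqrt (real p))\<^sup>2) = B"
      unfolding B_def by (intro sum.cong) (auto simp: power_divide)
    also have "(\<Sum>p\<in>P. (sqrt (real p))\<^sup>2) \<le> (\<Sum>p\<in>P. sqrt (real N))"
    proof (intro sum_mono)
      fix p assume "p \<in> P"
      then have "real p * real p \<le> real N" using P(4) by (metis of_nat_le_iff of_nat_mult)
      then show "(sqrt (real p))\<^sup>2 \<le> sqrt (real N)" by (simp add: real_le_rsqrt power2_eq_square)
    qed
    also have "\<dots> \<le> sqrt (real N) * sqrt (real N)"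
    proof -
      have "real (card P) \<le> sqrt (real N)"
      proof (cases "P = {}")
        case False
        have "P \<subseteq> {1..Max P}" using P(1) pos by (auto simp: Suc_le_eq)
        then have "card P \<le> Max P" using card_mono[of "{1..Max P}" P] by simp
        moreover have "Max P \<in> P" using False P(1) by simp
        then have "real (Max P) * real (Max P) \<le> real N" using P(4) by (metis of_nat_le_iff of_nat_mult)
        then have "real (Max P) \<le> sqrt (real N)" by (simp add: real_le_rsqrt power2_eq_square)
        ultimately show ?thesis by linarith
      qed auto
      then have "real (card P) * sqrt (real N) \<le> sqrt (real N) * sqrt (real N)"
        by (rule mult_right_mono) simp
      then show ?thesis by (simp only: sum_constant)
    qed
    finally show ?thesis by (simp add: B_def divide_nonneg_nonneg mult_left_mono sum_nonneg)
  qed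
  finally show ?thesis by (simp add: S_def Y_def B_def algebra_simps)
qed

text \<open>Three distinct primes above sqrt N would have a product above N^(3/2) dividing a term of
  size at most (Q + c) N. The comparison is made between squares, where it contradicts N > (Q +
  c)^2.\<close>

lemma large_prime_divisors:
  fixes Q c N n :: nat
  assumes N: "N > (Q + c)\<^sup>2" "n < N" and T: "finite T" "\<And>p. p \<in> T \<Longrightarrow> prime p" "\<And>p. p \<in> T \<Longrightarrow> p dvd Q * n + c"
    "\<And>p. p \<in> T \<Longrightarrow> p * p > N" and x: "Q * n + c > 0"
  shows "card T \<le> 2"
proof (rule ccontr)
  assume "\<not> card T \<le> 2"
  then obtain T' where T': "T' \<subseteq> T" "card T' = 3" by (metis obtain_subset_with_card_n not_less_eq_eq numeral_2_eq_2 numeral_3_eq_3)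
  then have fin: "finite T'" using T(1) finite_subset by blast
  have "[Q * n + c = 0] (mod (\<Prod>p\<in>T'. p))"
    using T T' by (intro coprime_cong_prod_nat) (auto intro!: primes_coprime simp: cong_0_iff)
  then have "\<Prod>T' dvd Q * n + c" by (simp add: cong_0_iff)
  then have le: "\<Prod>T' \<le> Q * n + c" using x by (simp add: dvd_imp_le)
  have "N ^ 3 = (\<Prod>p\<in>T'. N)" using T' by simp
  also have "\<dots> \<le> (\<Prod>p\<in>T'. p * p)"
    using T T' by (intro prod_mono) (auto simp: subset_iff intro!: less_imp_le)
  also have "\<dots> = \<Prod>T' * \<Prod>T'" by (simp add: prod.distrib)
  also have "\<dots> \<le> ((Q + c) * N) * ((Q + c) * N)"
  proof -
    have "Q * n + c \<le> Q * N + c * N" using N by (intro add_mono mult_mono) auto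
    then have "\<Prod>T' \<le> (Q + c) * N" using le by (simp add: algebra_simps)
    then show ?thesis by (intro mult_mono) auto
  qed
  also have "\<dots> = (Q + c)\<^sup>2 * N\<^sup>2" by (simp add: power2_eq_square)
  finally have "N\<^sup>2 * N \<le> N\<^sup>2 * (Q + c)\<^sup>2" by (simp add: power2_eq_square power3_eq_cube mult_ac)
  then show False using N by simp
qed

section \<open>Averages of sums over the prime factors of terms of a progression\<close>

lemma summable_tail_small:
  fixes g :: "nat \<Rightarrow> real"
  assumes "summable g" "\<And>n. g n \<ge> 0" "\<epsilon> > 0"
  shows "\<exists>M. \<forall>S. finite S \<longrightarrow> (\<forall>n\<in>S. M \<le> n) \<longrightarrow> sum g S \<le> \<epsilon>"
proof -
  obtain M where M: "\<And>m n. m \<ge> M \<Longrightarrow> norm (sum g {m..<n}) < \<epsilon>"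
    using assms(1,3) unfolding summable_Cauchy by blast
  show ?thesis
  proof (intro exI[of _ M] allI impI)
    fix S assume S: "finite S" "\<forall>n\<in>S. M \<le> n"
    have "S \<subseteq> {M..<Suc (Max S)}" using S by (auto simp: le_imp_less_Suc)
    then have "sum g S \<le> sum g {M..<Suc (Max S)}"
      using assms(2) by (intro sum_mono2) auto
    then show "sum g S \<le> \<epsilon>" using M[of M "Suc (Max S)"] by simp
  qed
qed

lemma sum_over_prime_factors:
  fixes g :: "nat \<Rightarrow> real" and x :: "nat \<Rightarrow> nat"
  assumes "finite R" "\<And>n. n < N \<Longrightarrow> x n > 0" "\<And>p. p \<in> R \<Longrightarrow> prime p"
  shows "(\<Sum>n<N. \<Sum>p\<in>prime_factors (x n) \<inter> R. g p) = (\<Sum>p\<in>R. g p * real (card {n. n < N \<and> p dvd x n}))"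
proof -
  have "(\<Sum>p\<in>prime_factors (x n) \<inter> R. g p) = (\<Sum>p\<in>R. g p * of_bool (p dvd x n))" if "n < N" for n
  proof -
    have "prime_factors (x n) \<inter> R = {p \<in> R. p dvd x n}"
      using assms that by (auto simp: prime_factors_dvd)
    then have "(\<Sum>p\<in>prime_factors (x n) \<inter> R. g p) = (\<Sum>p\<in>R. if p dvd x n then g p else 0)"
      using sum.inter_filter[OF assms(1)] by simp
    also have "\<dots> = (\<Sum>p\<in>R. g p * of_bool (p dvd x n))"
      by (intro sum.cong) auto
    finally show ?thesis .
  qed
  then have "(\<Sum>n<N. \<Sum>p\<in>prime_factors (x n) \<inter> R. g p) = (\<Sum>n<N. \<Sum>p\<in>R. g p * of_bool (p dvd x n))"
    by simp
  also have "\<dots> = (\<Sum>p\<in>R. g p * real (card {n. n < N \<and> p dvd x n}))"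
    by (subst sum.swap) (simp add: sum_distrib_left[symmetric] sum_of_bool_less del: sum_of_bool_eq)
  finally show ?thesis .
qed

lemma ap_divisor_count_le:
  fixes d Q c N :: nat
  assumes "coprime d Q" "d > 0"
  shows "real (card {n. n < N \<and> d dvd Q * n + c}) \<le> real N / real d + 1"
  using ap_divisor_count[OF assms, of N c] by linarith

text \<open>For d up to the size of the largest term the counting error 1 is itself at most (Q + c)
  N / d. The resulting constant depends on Q, which is harmless where it is multiplied by the tail
  of a convergent series.\<close>

lemma ap_divisor_count_le':
  fixes d Q c N :: nat
  assumes "coprime d Q" "d > 0" "d \<le> (Q + c) * N"
  shows "real (card {n. n < N \<and> d dvd Q * n + c}) \<le> (1 + real Q + real c) * real N / real d"
proof -
  have "real d \<le> (real Q + real c) * real N" using assms(3) by (metis of_nat_add of_nat_le_iff of_nat_mult)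
  then have "1 \<le> (real Q + real c) * real N / real d" using assms(2) by (simp add: field_simps)
  with ap_divisor_count_le[OF assms(1,2), of N c] show ?thesis
    by (simp add: algebra_simps add_divide_distrib)
qed

lemma ap_term_le:
  fixes Q n c N :: nat
  assumes "n < N"
  shows "Q * n + c \<le> (Q + c) * N"
proof -
  have "Q * n + c \<le> Q * N + c * N" using assms by (intro add_mono mult_mono) auto
  then show ?thesis by (simp add: algebra_simps)
qed

lemma prime_dvd_ap_coprime:
  fixes Q n c p :: nat
  assumes "coprime c Q" "prime p" "p dvd Q * n + c"
  shows "coprime p Q" "\<not> p dvd Q"
proof -
  show "\<not> p dvd Q"
  proof
    assume "p dvd Q"
    then have "p dvd c" using assms(3) by (metis dvd_add_right_iff dvd_mult2)
    then show False using \<open>p dvd Q\<close> assms(1,2) by (meson coprime_common_divisor not_prime_unit)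
  qed
  then show "coprime p Q" using assms(2) prime_imp_coprime by blast
qed

text \<open>Primes below sqrt N are handled by the variance inequality, which yields
  \<open>sqrt (5 * B)\<close>. Of the primes above sqrt N each term has at most two, and their
  weight is a tail of the convergent series, so they cost only \<open>\<delta>\<close>.\<close>

lemma additive_concentration:
  fixes h :: "nat \<Rightarrow> complex" and Q c :: nat
  assumes h0: "\<And>n. \<not> prime n \<Longrightarrow> h n = 0" and hQ: "\<And>p. p dvd Q \<Longrightarrow> h p = 0"
    and summ: "summable (\<lambda>n. (cmod (h n))\<^sup>2 / real n)"
    and B: "\<And>S. finite S \<Longrightarrow> (\<Sum>n\<in>S. (cmod (h n))\<^sup>2 / real n) \<le> B"
    and c: "c > 0" "coprime c Q" and \<delta>: "\<delta> > 0"
  shows "eventually (\<lambda>N. (\<Sum>n<N. cmod ((\<Sum>p\<in>prime_factors (Q * n + c). h p) - (\<Sum>p\<in>{p. p * p \<le> N}. h p / of_nat p)))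
      \<le> (sqrt (5 * B) + \<delta>) * real N) sequentially"
proof -
  define g where "g n = (cmod (h n))\<^sup>2 / real n" for n
  define C where "C = 1 + real Q + real c"
  have C: "C > 0" by (simp add: C_def)
  have g0: "g n \<ge> 0" for n by (simp add: g_def)
  \<comment> \<open>The factor 2 pays for the at most two large primes per term, C for the divisor
    count of primes up to (Q + c) N.\<close>
  obtain M where M: "\<And>S. finite S \<Longrightarrow> (\<forall>n\<in>S. M \<le> n) \<Longrightarrow> sum g S \<le> \<delta>\<^sup>2 / (2 * C)"
    using summable_tail_small[of g "\<delta>\<^sup>2 / (2 * C)"] summ g0 \<delta> C unfolding g_def[symmetric] by auto
  have B0: "B \<ge> 0" using B[of "{}"] by simp
  show ?thesis
    using eventually_gt_at_top[of "(Q + c)\<^sup>2"] eventually_ge_at_top[of "M * M"]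
  proof eventually_elim
    case (elim N)
    define P where "P = {p. prime p \<and> p * p \<le> N \<and> \<not> p dvd Q}"
    define R where "R = {p. prime p \<and> N < p * p \<and> p \<le> (Q + c) * N \<and> \<not> p dvd Q}"
    define x where "x n = Q * n + c" for n
    have xpos: "x n > 0" for n using c by (simp add: x_def)
    have finsq: "finite {p. p * p \<le> N}"
      by (rule finite_subset[of _ "{..N}"]) (auto intro: order.trans[OF le_square])
    have finP: "finite P" by (rule finite_subset[OF _ finsq]) (auto simp: P_def)
    have finR: "finite R" by (rule finite_subset[of _ "{..(Q + c) * N}"]) (auto simp: R_def)
    define S where "S n = (\<Sum>p\<in>P. h p * of_real (of_bool (p dvd Q * n + c) - 1 / real p))" for n
    define T where "T n = prime_factors (x n) \<inter> R" for n
    have A: "(\<Sum>p\<in>{p. p * p \<le> N}. h p / of_nat p) = (\<Sum>p\<in>P. h p / of_nat p)"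
      using finsq h0 hQ by (intro sum.mono_neutral_right) (auto simp: P_def)
    have decomp: "(\<Sum>p\<in>prime_factors (x n). h p) - (\<Sum>p\<in>{p. p * p \<le> N}. h p / of_nat p) = S n + (\<Sum>p\<in>T n. h p)"
      if "n < N" for n
    proof -
      have pf: "p dvd x n" "prime p" "\<not> p dvd Q" "p \<le> (Q + c) * N" if "p \<in> prime_factors (x n)" for p
      proof -
        show p: "p dvd x n" "prime p" using that xpos by (auto simp: prime_factors_dvd)
        show "\<not> p dvd Q" using prime_dvd_ap_coprime(2)[OF c(2) p(2)] p(1) by (simp add: x_def)
        have "p \<le> x n" using p(1) xpos by (simp add: dvd_imp_le)
        also have "\<dots> \<le> (Q + c) * N" using ap_term_le[OF \<open>n < N\<close>] by (simp add: x_def)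
        finally show "p \<le> (Q + c) * N" .
      qed
      have split: "prime_factors (x n) = {p \<in> P. p dvd x n} \<union> T n" 
      proof (intro equalityI subsetI)
        fix p assume p: "p \<in> prime_factors (x n)"
        show "p \<in> {p \<in> P. p dvd x n} \<union> T n"
          using pf[OF p] p by (cases "p * p \<le> N") (auto simp: P_def T_def R_def)
      next
        fix p assume "p \<in> {p \<in> P. p dvd x n} \<union> T n"
        then show "p \<in> prime_factors (x n)" using xpos[of n] by (auto simp: P_def T_def prime_factors_dvd)
      qed
      have disj: "{p \<in> P. p dvd x n} \<inter> T n = {}" by (auto simp: P_def T_def R_def)
      have "(\<Sum>p\<in>prime_factors (x n). h p) = (\<Sum>p\<in>{p \<in> P. p dvd x n}. h p) + (\<Sum>p\<in>T n. h p)"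
        unfolding split using disj finP finR by (intro sum.union_disjoint) (auto simp: T_def)
      also have "(\<Sum>p\<in>{p \<in> P. p dvd x n}. h p) = (\<Sum>p\<in>P. if p dvd x n then h p else 0)"
        using finP by (rule sum.inter_filter)
      also have "\<dots> = S n + (\<Sum>p\<in>P. h p / of_nat p)"
        unfolding S_def sum.distrib[symmetric] by (intro sum.cong) (auto simp: algebra_simps x_def)
      finally show ?thesis unfolding A by simp
    qed
    have "(\<Sum>n<N. cmod ((\<Sum>p\<in>prime_factors (x n). h p) - (\<Sum>p\<in>{p. p * p \<le> N}. h p / of_nat p)))
       \<le> (\<Sum>n<N. cmod (S n)) + (\<Sum>n<N. cmod (\<Sum>p\<in>T n. h p))"
      unfolding sum.distrib[symmetric] by (intro sum_mono) (auto simp: decomp norm_triangle_ineq)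
    also have "(\<Sum>n<N. cmod (S n)) \<le> sqrt (5 * B) * real N"
    proof -
      have CS: "(\<Sum>n<N. 1 * cmod (S n))\<^sup>2 \<le> (\<Sum>n<N. 1\<^sup>2) * (\<Sum>n<N. (cmod (S n))\<^sup>2)"
        by (rule Cauchy_Schwarz_ineq_sum)
      have "(\<Sum>n<N. (cmod (S n))\<^sup>2) \<le> 5 * real N * (\<Sum>p\<in>P. (cmod (h p))\<^sup>2 / real p)"
        unfolding S_def by (rule turan_kubilius_ap[OF finP]) (auto simp: P_def prime_imp_coprime)
      also have "\<dots> \<le> 5 * real N * B" using B[OF finP] by (intro mult_left_mono) auto
      finally have "real N * (\<Sum>n<N. (cmod (S n))\<^sup>2) \<le> real N * (5 * real N * B)"
        by (rule mult_left_mono) simp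
      with CS have "(\<Sum>n<N. cmod (S n))\<^sup>2 \<le> real N * (5 * real N * B)" by simp
      also have "\<dots> = (sqrt (5 * B) * real N)\<^sup>2"
        using B0 by (simp add: power_mult_distrib power2_eq_square)
      finally have "(\<Sum>n<N. cmod (S n))\<^sup>2 \<le> (sqrt (5 * B) * real N)\<^sup>2" .
      then show ?thesis by (rule power2_le_imp_le) (use B0 in simp)
    qed
    also have "(\<Sum>n<N. cmod (\<Sum>p\<in>T n. h p)) \<le> \<delta> * real N"
    proof -
      have sq: "(cmod (\<Sum>p\<in>T n. h p))\<^sup>2 \<le> 2 * (\<Sum>p\<in>T n. (cmod (h p))\<^sup>2)" if "n < N" for n
      proof -
        have "card (T n) \<le> 2"
        proof (rule large_prime_divisors[OF elim(1) that])
          show "Q * n + c > 0" using c by simp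
        qed (auto simp: T_def R_def x_def prime_factors_dvd finR)
        have "(cmod (\<Sum>p\<in>T n. h p))\<^sup>2 \<le> (\<Sum>p\<in>T n. 1 * cmod (h p))\<^sup>2"
          by (intro power_mono) (auto simp: norm_sum)
        also have "\<dots> \<le> (\<Sum>p\<in>T n. 1\<^sup>2) * (\<Sum>p\<in>T n. (cmod (h p))\<^sup>2)"
          by (rule Cauchy_Schwarz_ineq_sum)
        also have "\<dots> \<le> 2 * (\<Sum>p\<in>T n. (cmod (h p))\<^sup>2)"
          using \<open>card (T n) \<le> 2\<close> by (intro mult_right_mono) (auto intro: sum_nonneg)
        finally show ?thesis .
      qed
      have CS: "(\<Sum>n<N. 1 * cmod (\<Sum>p\<in>T n. h p))\<^sup>2 \<le> (\<Sum>n<N. 1\<^sup>2) * (\<Sum>n<N. (cmod (\<Sum>p\<in>T n. h p))\<^sup>2)"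
        by (rule Cauchy_Schwarz_ineq_sum)
      have "(\<Sum>n<N. (cmod (\<Sum>p\<in>T n. h p))\<^sup>2) \<le> (\<Sum>n<N. 2 * (\<Sum>p\<in>T n. (cmod (h p))\<^sup>2))"
        using sq by (intro sum_mono) auto
      also have "\<dots> = 2 * (\<Sum>n<N. (\<Sum>p\<in>T n. (cmod (h p))\<^sup>2))" by (simp add: sum_distrib_left)
      also have "(\<Sum>n<N. (\<Sum>p\<in>T n. (cmod (h p))\<^sup>2)) = (\<Sum>p\<in>R. (cmod (h p))\<^sup>2 * real (card {n. n < N \<and> p dvd x n}))"
        unfolding T_def using finR xpos by (intro sum_over_prime_factors) (auto simp: R_def)
      also have "\<dots> \<le> (\<Sum>p\<in>R. (cmod (h p))\<^sup>2 * (C * real N / real p))"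
        unfolding x_def C_def
        by (intro sum_mono mult_left_mono ap_divisor_count_le') (auto simp: R_def prime_gt_0_nat prime_imp_coprime)
      also have "\<dots> = C * real N * sum g R" by (simp add: g_def sum_distrib_left mult_ac)
      also have "\<dots> \<le> C * real N * (\<delta>\<^sup>2 / (2 * C))"
      proof (intro mult_left_mono M[OF finR] ballI)
        fix p assume "p \<in> R"
        then have "M * M < p * p" using elim(2) by (auto simp: R_def)
        then show "M \<le> p" using mult_le_mono[of p M p M] by linarith
      qed (use C in auto)
      finally have "real N * (\<Sum>n<N. (cmod (\<Sum>p\<in>T n. h p))\<^sup>2) \<le> real N * (2 * (C * real N * (\<delta>\<^sup>2 / (2 * C))))"
        by (intro mult_left_mono) auto
      with CS have "(\<Sum>n<N. cmod (\<Sum>p\<in>T n. h p))\<^sup>2 \<le> real N * (2 * (C * real N * (\<delta>\<^sup>2 / (2 * C))))"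
        by simp
      also have "\<dots> = (\<delta> * real N)\<^sup>2" using C by (simp add: power2_eq_square)
      finally show ?thesis by (rule power2_le_imp_le) (use \<delta> in simp)
    qed
    finally show ?case by (simp add: x_def algebra_simps)
  qed
qed

text \<open>For primes up to N the count N / p + 1 is at most 2 N / p, whence 2 B without any
  dependence on Q. The Q-dependent constant for larger primes meets only a tail of the
  series.\<close>

lemma prime_factor_sum_average:
  fixes H :: "nat \<Rightarrow> real" and Q c :: nat
  assumes H0: "\<And>n. H n \<ge> 0" and hQ: "\<And>p. p dvd Q \<Longrightarrow> H p = 0"
    and summ: "summable (\<lambda>n. H n / real n)"
    and B: "\<And>S. finite S \<Longrightarrow> (\<Sum>n\<in>S. H n / real n) \<le> B"
    and c: "c > 0" "coprime c Q" and \<delta>: "\<delta> > 0"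
  shows "eventually (\<lambda>N. (\<Sum>n<N. (\<Sum>p\<in>prime_factors (Q * n + c). H p)) \<le> (2 * B + \<delta>) * real N) sequentially"
proof -
  define g where "g n = H n / real n" for n
  define C where "C = 1 + real Q + real c"
  have C: "C > 0" by (simp add: C_def)
  have g0: "g n \<ge> 0" for n by (simp add: g_def H0)
  obtain M where M: "\<And>S. finite S \<Longrightarrow> (\<forall>n\<in>S. M \<le> n) \<Longrightarrow> sum g S \<le> \<delta> / C"
    using summable_tail_small[of g "\<delta> / C"] summ g0 \<delta> C unfolding g_def[symmetric] by auto
  show ?thesis
    using eventually_ge_at_top[of M]
  proof eventually_elim
    case (elim N)
    define x where "x n = Q * n + c" for n
    have xpos: "x n > 0" for n using c by (simp add: x_def)
    define R where "R = {p. prime p \<and> p \<le> (Q + c) * N \<and> \<not> p dvd Q}"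
    define R1 where "R1 = {p \<in> R. p \<le> N}"
    define R2 where "R2 = {p \<in> R. \<not> p \<le> N}"
    have finR: "finite R" by (rule finite_subset[of _ "{..(Q + c) * N}"]) (auto simp: R_def)
    have fin12: "finite R1" "finite R2" "R1 \<inter> R2 = {}" "R = R1 \<union> R2" using finR by (auto simp: R1_def R2_def)
    have "(\<Sum>p\<in>prime_factors (x n). H p) = (\<Sum>p\<in>prime_factors (x n) \<inter> R. H p)" if "n < N" for n
    proof (intro arg_cong2[of _ _ _ _ sum] refl)
      have "p \<in> R" if p: "p \<in> prime_factors (x n)" for p
      proof -
        have "p dvd x n" "prime p" using p xpos by (auto simp: prime_factors_dvd)
        moreover from this have "\<not> p dvd Q" using prime_dvd_ap_coprime(2)[OF c(2)] by (simp add: x_def)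
        moreover have "p \<le> x n" using \<open>p dvd x n\<close> xpos by (simp add: dvd_imp_le)
        then have "p \<le> (Q + c) * N" using ap_term_le[OF \<open>n < N\<close>, of Q c] by (simp add: x_def)
        ultimately show ?thesis by (simp add: R_def)
      qed
      then show "prime_factors (x n) = prime_factors (x n) \<inter> R" by blast
    qed
    then have "(\<Sum>n<N. (\<Sum>p\<in>prime_factors (x n). H p)) = (\<Sum>n<N. (\<Sum>p\<in>prime_factors (x n) \<inter> R. H p))"
      by simp
    also have "\<dots> = (\<Sum>p\<in>R. H p * real (card {n. n < N \<and> p dvd x n}))"
      using finR xpos by (intro sum_over_prime_factors) (auto simp: R_def)
    also have "\<dots> = (\<Sum>p\<in>R1. H p * real (card {n. n < N \<and> p dvd x n})) + (\<Sum>p\<in>R2. H p * real (card {n. n < N \<and> p dvd x n}))"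
      using fin12 by (simp add: sum.union_disjoint)
    also have "(\<Sum>p\<in>R1. H p * real (card {n. n < N \<and> p dvd x n})) \<le> (\<Sum>p\<in>R1. H p * (2 * real N / real p))"
    proof (intro sum_mono mult_left_mono H0)
      fix p assume p: "p \<in> R1"
      then have "p > 0" "p \<le> N" "coprime p Q" by (auto simp: R1_def R_def prime_gt_0_nat prime_imp_coprime)
      then have "1 \<le> real N / real p" by (simp add: field_simps)
      then show "real (card {n. n < N \<and> p dvd x n}) \<le> 2 * real N / real p"
        using ap_divisor_count_le[OF \<open>coprime p Q\<close> \<open>p > 0\<close>, of N c] by (simp add: x_def)
    qed
    also have "\<dots> = 2 * real N * sum g R1" by (simp add: g_def sum_distrib_left mult_ac)
    also have "\<dots> \<le> 2 * real N * B" using B[OF fin12(1)] by (intro mult_left_mono) (auto simp: g_def)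
    also have "(\<Sum>p\<in>R2. H p * real (card {n. n < N \<and> p dvd x n})) \<le> (\<Sum>p\<in>R2. H p * (C * real N / real p))"
      unfolding x_def C_def
      by (intro sum_mono mult_left_mono ap_divisor_count_le' H0) (auto simp: R2_def R_def prime_gt_0_nat prime_imp_coprime)
    also have "\<dots> = C * real N * sum g R2" by (simp add: g_def sum_distrib_left mult_ac)
    also have "\<dots> \<le> C * real N * (\<delta> / C)"
    proof (rule mult_left_mono)
      have "\<forall>p\<in>R2. M \<le> p" using elim by (auto simp: R2_def)
      then show "sum g R2 \<le> \<delta> / C" by (rule M[OF fin12(2)])
    qed (use C in auto)
    finally show ?case using C by (simp add: x_def algebra_simps)
  qed
qed

text \<open>The counting errors number at most one per prime up to sqrt ((Q + c) N), which is o(N);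
  the main terms add up to N times the sum of 1 / p^2.\<close>

lemma square_divisor_count:
  fixes Q c :: nat
  assumes B: "\<And>S. finite S \<Longrightarrow> (\<And>p. p \<in> S \<Longrightarrow> prime p \<and> \<not> p dvd Q) \<Longrightarrow> (\<Sum>p\<in>S. 1 / (real p)\<^sup>2) \<le> B"
    and c: "c > 0" "coprime c Q" and \<delta>: "\<delta> > 0"
  shows "eventually (\<lambda>N. real (card {n. n < N \<and> (\<exists>p. prime p \<and> p * p dvd Q * n + c)}) \<le> (B + \<delta>) * real N) sequentially"
proof -
  define K where "K = real Q + real c"
  have "K > 0" using c by (simp add: K_def)
  then have "eventually (\<lambda>N. sqrt (K * real N) + 1 \<le> \<delta> * real N) sequentially"
    using \<delta> by real_asymp
  then have "eventually (\<lambda>N. sqrt (real ((Q + c) * N)) + 1 \<le> \<delta> * real N) sequentially"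
    by (simp add: K_def)
  then show ?thesis
  proof eventually_elim
    case (elim N)
    define R where "R = {p. prime p \<and> p * p \<le> (Q + c) * N \<and> \<not> p dvd Q}"
    define L where "L = nat \<lfloor>sqrt (real ((Q + c) * N))\<rfloor>"
    have "R \<subseteq> {..L}"
    proof
      fix p assume "p \<in> R"
      then have "p * p \<le> (Q + c) * N" by (simp add: R_def)
      then have "real (p * p) \<le> real ((Q + c) * N)" by (simp only: of_nat_le_iff)
      then have "real p * real p \<le> real ((Q + c) * N)" by simp
      then have "real p \<le> sqrt (real ((Q + c) * N))" by (simp add: real_le_rsqrt power2_eq_square)
      then show "p \<in> {..L}" by (simp add: L_def le_nat_floor)
    qed
    then have finR: "finite R" and "card R \<le> L + 1"
      using finite_subset card_mono[of "{..L}" R] by auto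
    moreover have "real L \<le> sqrt (real ((Q + c) * N))" unfolding L_def by (rule of_nat_floor) simp
    ultimately have "real (card R) \<le> sqrt (real ((Q + c) * N)) + 1" by linarith
    then have cardR: "real (card R) \<le> \<delta> * real N" using elim by linarith
    have "{n. n < N \<and> (\<exists>p. prime p \<and> p * p dvd Q * n + c)} \<subseteq> (\<Union>p\<in>R. {n. n < N \<and> p * p dvd Q * n + c})"
    proof safe
      fix n p assume n: "n < N" "prime p" "p * p dvd Q * n + c"
      have "p dvd Q * n + c" using n(3) by (metis dvd_mult_left)
      then have "\<not> p dvd Q" using prime_dvd_ap_coprime(2)[OF c(2) n(2)] by blast
      moreover have "p * p \<le> Q * n + c" using n(3) c by (simp add: dvd_imp_le)
      then have "p * p \<le> (Q + c) * N" using ap_term_le[OF n(1), of Q c] by linarith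
      ultimately show "n \<in> (\<Union>p\<in>R. {n. n < N \<and> p * p dvd Q * n + c})" using n by (auto simp: R_def)
    qed
    then have "card {n. n < N \<and> (\<exists>p. prime p \<and> p * p dvd Q * n + c)} \<le> card (\<Union>p\<in>R. {n. n < N \<and> p * p dvd Q * n + c})"
      using finR by (intro card_mono) auto
    also have "\<dots> \<le> (\<Sum>p\<in>R. card {n. n < N \<and> p * p dvd Q * n + c})"
      using finR by (rule card_UN_le)
    finally have "real (card {n. n < N \<and> (\<exists>p. prime p \<and> p * p dvd Q * n + c)}) \<le> (\<Sum>p\<in>R. real (card {n. n < N \<and> p * p dvd Q * n + c}))"
      unfolding of_nat_sum[symmetric] of_nat_le_iff .
    also have "\<dots> \<le> (\<Sum>p\<in>R. real N * (1 / (real p)\<^sup>2) + 1)"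
    proof (intro sum_mono)
      fix p assume "p \<in> R"
      then have "coprime (p * p) Q" "p * p > 0" by (auto simp: R_def prime_gt_0_nat prime_imp_coprime)
      then show "real (card {n. n < N \<and> p * p dvd Q * n + c}) \<le> real N * (1 / (real p)\<^sup>2) + 1"
        using ap_divisor_count_le[of "p * p" Q N c] by (simp add: power2_eq_square)
    qed
    also have "\<dots> = real N * (\<Sum>p\<in>R. 1 / (real p)\<^sup>2) + real (card R)"
      by (simp add: sum.distrib sum_distrib_left)
    also have "real N * (\<Sum>p\<in>R. 1 / (real p)\<^sup>2) \<le> real N * B"
      using finR by (intro mult_left_mono B) (auto simp: R_def)
    finally show ?case using cardR by (simp add: algebra_simps)
  qed
qed

section \<open>Concentration of pretentious functions in progressions\<close>

lemma coprime_ap: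
  fixes Q n c :: nat
  assumes "coprime c Q"
  shows "coprime (Q * n + c) Q"
proof (rule coprimeI)
  fix d assume d: "d dvd Q * n + c" "d dvd Q"
  then have "d dvd c" by (metis dvd_add_right_iff dvd_mult2)
  then show "is_unit d" using assms d(2) coprime_common_divisor by blast
qed

lemma mult_class_prod_primes:
  assumes "f \<in> mult_class" "f 1 = 1" "finite P" "\<And>p. p \<in> P \<Longrightarrow> prime p"
  shows "f (\<Prod>p\<in>P. p ^ e p) = (\<Prod>p\<in>P. f (p ^ e p))"
  using assms(3,4)
proof (induction P rule: finite_induct)
  case empty
  then show ?case using assms(2) by simp
next
  case (insert p P)
  have cop: "coprime (p ^ e p) (\<Prod>p\<in>P. p ^ e p)"
    using insert by (intro prod_coprime_right) (auto intro!: primes_coprime)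
  have "p ^ e p > 0" "(\<Prod>p\<in>P. p ^ e p) > 0"
    using insert by (auto intro!: prod_pos prime_gt_0_nat)
  then have "f (p ^ e p * (\<Prod>p\<in>P. p ^ e p)) = f (p ^ e p) * f (\<Prod>p\<in>P. p ^ e p)"
    using assms(1) cop by (auto simp: mult_class_def)
  then show ?case using insert by simp
qed

lemma mult_class_prime_factors:
  assumes "f \<in> mult_class" "f 1 = 1" "x > 0"
  shows "f x = (\<Prod>p\<in>prime_factors x. f (p ^ multiplicity p x))"
proof -
  have "f x = f (\<Prod>p\<in>prime_factors x. p ^ multiplicity p x)"
    using assms(3) by (simp add: prime_factorization_nat[symmetric])
  also have "\<dots> = (\<Prod>p\<in>prime_factors x. f (p ^ multiplicity p x))"
    by (rule mult_class_prod_primes[OF assms(1,2)]) auto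
  finally show ?thesis .
qed

lemma mult_class_mult:
  assumes "f \<in> mult_class" "coprime m n" "m > 0" "n > 0"
  shows "f (m * n) = f m * f n"
  using assms by (auto simp: mult_class_def Suc_le_eq)

lemma mult_class_norm_le: "f \<in> mult_class \<Longrightarrow> cmod (f n) \<le> 1"
  by (cases "n = 0") (auto simp: mult_class_def Suc_le_eq)

text \<open>The derivative has modulus at most 1 on this convex set. All sums of \<open>h\<close>
  have nonpositive real part, so factors exp (sum h) can be compared through their
  exponents.\<close>

lemma exp_lipschitz_left_halfplane:
  assumes "Re a \<le> 0" "Re b \<le> 0"
  shows "cmod (exp a - exp b) \<le> cmod (a - b)"
proof -
  have "cmod (exp a - exp b) \<le> 1 * cmod (a - b)"
  proof (rule field_differentiable_bound[of "{z. Re z \<le> 0}"])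
    show "convex {z. Re z \<le> 0}" by (rule convex_halfspace_Re_le)
    show "(exp has_field_derivative exp z) (at z within {z. Re z \<le> 0})" for z
      by (rule DERIV_subset[OF DERIV_exp]) auto
  qed (use assms in auto)
  then show ?thesis by simp
qed

text \<open>The hypothesis f 1 = 1 excludes the zero function, which is treated separately. The
  power p^(it) is written as \<open>cis (t * ln p)\<close>, and the series runs over all naturals
  with zeros off the primes, so that the ordinary theory of series applies.\<close>

locale pretentious_to =
  fixes f chi :: "nat \<Rightarrow> complex" and q :: nat and t :: real
  assumes f: "f \<in> mult_class" and f1: "f 1 = 1" and chi: "dirichlet_char q chi"
    and summ: "summable (\<lambda>p. if prime p then (1 - Re (f p * cnj (chi p * cis (t * ln (real p))))) / real p else 0)"
begin

definition tw :: "nat \<Rightarrow> complex" where "tw n = chi n * cis (t * ln (real n))"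

text \<open>The deviation of f from its model at a prime. At primes dividing q the character
  vanishes and the value is -1; there are only finitely many of them.\<close>

definition h :: "nat \<Rightarrow> complex" where "h p = (if prime p then f p * cnj (tw p) - 1 else 0)"

lemma q_pos: "q > 0" using chi by (auto simp: dirichlet_char_def)

lemma chi_mult: "chi (m * n) = chi m * chi n" using chi by (auto simp: dirichlet_char_def)

lemma chi_1: "chi 1 = 1"
proof -
  have "chi 1 = chi 1 * chi 1" using chi_mult[of 1 1] by simp
  moreover have "chi 1 \<noteq> 0" using chi by (auto simp: dirichlet_char_def)
  ultimately show ?thesis by simp
qed

lemma chi_power: "chi (n ^ k) = chi n ^ k"
  by (induction k) (use chi_1 in \<open>auto simp: chi_mult\<close>)

lemma chi_add_mult: "chi (n + k * q) = chi n"
proof (induction k)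
  case (Suc k)
  have "chi (n + Suc k * q) = chi ((n + k * q) + q)" by (simp add: algebra_simps)
  then show ?case using Suc chi by (auto simp: dirichlet_char_def)
qed auto

lemma chi_cong: "[m = n] (mod q) \<Longrightarrow> chi m = chi n"
  by (metis chi_add_mult cong_def div_mult_mod_eq add.commute)

lemma chi_eq_0_iff: "chi n = 0 \<longleftrightarrow> \<not> coprime n q"
  using chi by (auto simp: dirichlet_char_def)

lemma chi_totient: "coprime n q \<Longrightarrow> chi n ^ totient q = 1"
  using chi_cong[OF euler_theorem[of n q]] chi_1 by (simp add: chi_power coprime_commute)

lemma norm_chi: "coprime n q \<Longrightarrow> cmod (chi n) = 1"
proof -
  assume "coprime n q"
  then have "cmod (chi n) ^ totient q = 1 ^ totient q" by (metis chi_totient norm_power norm_one power_one)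
  then show ?thesis using q_pos by (intro power_eq_imp_eq_base[of "cmod (chi n)" "totient q" 1]) auto
qed

lemma norm_chi_le: "cmod (chi n) \<le> 1"
  using norm_chi[of n] chi_eq_0_iff[of n] by (cases "coprime n q") auto

lemma norm_tw: "coprime n q \<Longrightarrow> cmod (tw n) = 1"
  by (simp add: tw_def norm_mult norm_chi)

lemma norm_tw_le: "cmod (tw n) \<le> 1"
  by (simp add: tw_def norm_mult norm_chi_le)

lemma tw_1: "tw 1 = 1"
  using chi_1 by (simp add: tw_def)

lemma tw_mult: "m > 0 \<Longrightarrow> n > 0 \<Longrightarrow> tw (m * n) = tw m * tw n"
  by (simp add: tw_def chi_mult ln_mult distrib_left cis_mult[symmetric])

lemma tw_prod: "finite P \<Longrightarrow> (\<And>p. p \<in> P \<Longrightarrow> g p > 0) \<Longrightarrow> tw (\<Prod>p\<in>P. g p) = (\<Prod>p\<in>P. tw (g p))"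
proof (induction P rule: finite_induct)
  case (insert p P)
  then have "tw (g p * prod g P) = tw (g p) * tw (prod g P)"
    by (intro tw_mult) (auto intro: prod_pos)
  then show ?case using insert by simp
qed (use tw_1 in auto)

lemma tw_prime_factors: "x > 0 \<Longrightarrow> tw x = (\<Prod>p\<in>prime_factors x. tw (p ^ multiplicity p x))"
proof -
  assume "x > 0"
  then have "tw x = tw (\<Prod>p\<in>prime_factors x. p ^ multiplicity p x)"
    by (simp add: prime_factorization_nat[symmetric])
  also have "\<dots> = (\<Prod>p\<in>prime_factors x. tw (p ^ multiplicity p x))"
    by (rule tw_prod) (auto simp: prime_factors_gt_0_nat)
  finally show ?thesis .
qed

lemma norm_f: "cmod (f n) \<le> 1" using mult_class_norm_le[OF f] .

lemma norm_F_le: "cmod (f m * cnj (tw n)) \<le> 1"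
  using norm_f[of m] norm_tw_le[of n] by (simp add: norm_mult mult_le_one)

text \<open>|z - 1|^2 = |z|^2 + 1 - 2 Re z with |z| at most 1. This turns the pretentious distance
  into the square summability that the variance inequality needs.\<close>

lemma norm_h_sq: "prime p \<Longrightarrow> (cmod (h p))\<^sup>2 \<le> 2 * (1 - Re (f p * cnj (tw p)))"
proof -
  assume "prime p"
  define z where "z = f p * cnj (tw p)"
  have "(Re z)\<^sup>2 + (Im z)\<^sup>2 \<le> 1"
    using norm_F_le[of p p] by (simp add: z_def[symmetric] cmod_def)
  then show ?thesis using \<open>prime p\<close>
    by (simp add: h_def z_def[symmetric] cmod_power2) (simp add: power2_eq_square algebra_simps)
qed

lemma norm_h_le: "cmod (h p) \<le> 2"
proof (cases "prime p")
  case True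
  then show ?thesis using norm_triangle_ineq4[of "f p * cnj (tw p)" 1] norm_F_le[of p p]
    by (simp add: h_def)
qed (auto simp: h_def)

lemma Re_h_le: "Re (h p) \<le> 0"
proof (cases "prime p")
  case True
  then show ?thesis using order.trans[OF complex_Re_le_cmod norm_F_le[of p p]] by (simp add: h_def)
qed (auto simp: h_def)

lemma summable_h: "summable (\<lambda>n. (cmod (h n))\<^sup>2 / real n)"
proof (rule summable_comparison_test')
  show "summable (\<lambda>p. 2 * (if prime p then (1 - Re (f p * cnj (chi p * cis (t * ln (real p))))) / real p else 0))"
    by (intro summable_mult summ)
  show "norm ((cmod (h n))\<^sup>2 / real n) \<le> 2 * (if prime n then (1 - Re (f n * cnj (chi n * cis (t * ln (real n))))) / real n else 0)" if "n \<ge> 0" for n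
  proof (cases "prime n")
    case True
    then show ?thesis using norm_h_sq[OF True] by (simp add: tw_def divide_right_mono)
  qed (auto simp: h_def)
qed

lemma summable_Re_h: "summable (\<lambda>n. - Re (h n) / real n)"
proof -
  have "- Re (h p) / real p = (if prime p then (1 - Re (f p * cnj (chi p * cis (t * ln (real p))))) / real p else 0)" for p
  proof (cases "prime p")
    case True
    have "- Re (h p) = 1 - Re (f p * cnj (chi p * cis (t * ln (real p))))"
      using True by (simp add: h_def tw_def)
    then show ?thesis using True by simp
  qed (simp add: h_def)
  then show ?thesis using summ by simp
qed

text \<open>The mean, predicted by the probabilities 1 / p, of the sum of h over those prime factors
  of a term that do not exceed sqrt N, along a reduced class modulo Q.\<close>

definition AQ :: "nat \<Rightarrow> nat \<Rightarrow> complex" where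
  "AQ Q N = (\<Sum>p\<in>{p. p * p \<le> N \<and> \<not> p dvd Q}. h p / of_nat p)"

lemma finite_sq_le [simp]: "finite {p::nat. p * p \<le> N}" "finite {p::nat. p * p \<le> N \<and> P p}"
  by (rule finite_subset[of _ "{..N}"], auto intro: order.trans[OF le_square])+

lemma sum_Re_nonpos: "Re (\<Sum>p\<in>S. h p) \<le> 0" "Re (\<Sum>p\<in>S. h p / of_nat p) \<le> 0"
  using Re_h_le by (auto simp: Re_divide_of_nat intro!: sum_nonpos divide_nonpos_nonneg)

text \<open>Three replacements, one for each error term: f(x) / tw(x) equals the product of 1 + h p
  over the prime factors unless a prime square divides x; 1 + h p differs from exp (h p) by a
  quadratic error; and exp of the sum of h is compared with exp A by the Lipschitz bound. All
  products have factors of modulus at most 1, so errors add up.\<close>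

lemma f_pointwise:
  assumes x: "x > 0" "coprime x q" and A: "Re A \<le> 0"
  shows "cmod (f x - tw x * exp A) \<le> 2 * of_bool (\<exists>p. prime p \<and> p * p dvd x)
      + (\<Sum>p\<in>prime_factors x. 9 * (cmod (h p))\<^sup>2) + cmod ((\<Sum>p\<in>prime_factors x. h p) - A)"
proof -
  let ?P = "prime_factors x"
  define g where "g p = f (p ^ multiplicity p x) * cnj (tw (p ^ multiplicity p x))" for p
  have g_le: "cmod (g p) \<le> 1" for p unfolding g_def by (rule norm_F_le)
  have h_le: "cmod (1 + h p) \<le> 1" if "p \<in> ?P" for p
    using that norm_F_le[of p p] by (auto simp: h_def)
  have fx: "f x * cnj (tw x) = prod g ?P"
    unfolding g_def prod.distrib cnj_prod[symmetric]
    using mult_class_prime_factors[OF f f1 x(1)] tw_prime_factors[OF x(1)] by simp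
  have "tw x * cnj (tw x) = 1" using norm_tw[OF x(2)] by (simp add: complex_norm_square[symmetric])
  then have "cmod (f x - tw x * exp A) = cmod (f x * (tw x * cnj (tw x)) - tw x * exp A)" by simp
  also have "\<dots> = cmod (tw x) * cmod (f x * cnj (tw x) - exp A)"
    by (simp add: norm_mult[symmetric] algebra_simps)
  also have "\<dots> = cmod (prod g ?P - exp A)" using norm_tw[OF x(2)] fx by simp
  also have "\<dots> \<le> cmod (prod g ?P - (\<Prod>p\<in>?P. 1 + h p)) + cmod ((\<Prod>p\<in>?P. 1 + h p) - (\<Prod>p\<in>?P. exp (h p)))
      + cmod ((\<Prod>p\<in>?P. exp (h p)) - exp A)"
    by (smt (verit) norm_triangle_ineq diff_add_cancel add_diff_eq diff_diff_eq2 norm_diff_triangle_ineq norm_diff_triangle_le)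
  also have "cmod (prod g ?P - (\<Prod>p\<in>?P. 1 + h p)) \<le> 2 * of_bool (\<exists>p. prime p \<and> p * p dvd x)"
  proof (cases "\<exists>p. prime p \<and> p * p dvd x")
    case True
    have "cmod (prod g ?P) \<le> 1" using g_le by (intro order.trans[OF norm_prod_le] prod_le_1) auto
    moreover have "cmod (\<Prod>p\<in>?P. 1 + h p) \<le> 1" using h_le by (intro order.trans[OF norm_prod_le] prod_le_1) auto
    ultimately show ?thesis using True norm_triangle_ineq4[of "prod g ?P" "\<Prod>p\<in>?P. 1 + h p"] by simp
  next
    case False
    have "g p = 1 + h p" if "p \<in> ?P" for p
    proof -
      have p: "prime p" "p dvd x" using that x by (auto simp: prime_factors_dvd)
      have "multiplicity p x = 1"
      proof -
        have "multiplicity p x \<ge> 1" using p x by (simp add: multiplicity_geI Suc_le_eq prime_multiplicity_gt_zero_iff)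
        moreover have "\<not> multiplicity p x \<ge> 2" using False p multiplicity_dvd'[of 2 p x] by (auto simp: power2_eq_square)
        ultimately show ?thesis by simp
      qed
      then show ?thesis using p by (simp add: g_def h_def)
    qed
    then have "prod g ?P = (\<Prod>p\<in>?P. 1 + h p)" by (rule prod.cong[OF refl])
    then show ?thesis by simp
  qed
  also have "cmod ((\<Prod>p\<in>?P. 1 + h p) - (\<Prod>p\<in>?P. exp (h p))) \<le> (\<Sum>p\<in>?P. cmod ((1 + h p) - exp (h p)))"
    using h_le Re_h_le by (intro norm_prod_diff) auto
  also have "\<dots> \<le> (\<Sum>p\<in>?P. 9 * (cmod (h p))\<^sup>2)"
  proof (intro sum_mono)
    fix p
    \<comment> \<open>Second-order Taylor remainder; |h p| is at most 2, so the factor is at most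
      e^2, bounded by 3 * 3.\<close>
    have "cmod ((1 + h p) - exp (h p)) \<le> exp \<bar>Re (h p)\<bar> * (cmod (h p))\<^sup>2"
      using Taylor_exp[of "h p" 1] by (simp add: norm_minus_commute power2_eq_square)
    also have "exp \<bar>Re (h p)\<bar> \<le> exp (1 + 1 :: real)"
      using norm_h_le[of p] abs_Re_le_cmod[of "h p"] by simp
    also have "exp (1 + 1 :: real) = exp 1 * exp 1" by (simp only: exp_add)
    also have "\<dots> \<le> 3 * 3" using exp_le by (intro mult_mono) auto
    finally show "cmod ((1 + h p) - exp (h p)) \<le> 9 * (cmod (h p))\<^sup>2" by (simp add: mult_right_mono)
  qed
  also have "cmod ((\<Prod>p\<in>?P. exp (h p)) - exp A) \<le> cmod ((\<Sum>p\<in>?P. h p) - A)"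
    unfolding exp_sum[OF finite_set_mset, symmetric] using A sum_Re_nonpos(1)[of ?P]
    by (intro exp_lipschitz_left_halfplane) auto
  finally show ?thesis by simp
qed

text \<open>The pointwise estimate averaged over n < N: its three error terms give 2 B2, 2 * 9 B and
  sqrt (5 B). Each average is used with slack \<open>\<delta> / 4\<close>, the one for square
  divisors twice.\<close>

lemma concentration:
  assumes c: "c > 0" "coprime c Q" and Q: "q dvd Q" and \<delta>: "\<delta> > 0"
    and B: "\<And>S. finite S \<Longrightarrow> (\<And>p. p \<in> S \<Longrightarrow> \<not> p dvd Q) \<Longrightarrow> (\<Sum>p\<in>S. (cmod (h p))\<^sup>2 / real p) \<le> B"
    and B2: "\<And>S. finite S \<Longrightarrow> (\<And>p. p \<in> S \<Longrightarrow> prime p \<and> \<not> p dvd Q) \<Longrightarrow> (\<Sum>p\<in>S. 1 / (real p)\<^sup>2) \<le> B2"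
  shows "eventually (\<lambda>N. (\<Sum>n<N. cmod (f (Q * n + c) - tw (Q * n + c) * exp (AQ Q N)))
      \<le> (2 * B2 + 18 * B + sqrt (5 * B) + \<delta>) * real N) sequentially"
proof -
  \<comment> \<open>No prime factor of Q n + c divides Q, so h' agrees with h wherever it is
    evaluated on a term, and it vanishes at divisors of Q as the averaging lemmas demand.\<close>
  define h' where "h' p = (if p dvd Q then 0 else h p)" for p
  have bd: "(\<Sum>p\<in>S. (cmod (h' p))\<^sup>2 / real p) \<le> B" if "finite S" for S
  proof -
    have "(\<Sum>p\<in>S. (cmod (h' p))\<^sup>2 / real p) = (\<Sum>p\<in>{p\<in>S. \<not> p dvd Q}. (cmod (h p))\<^sup>2 / real p)"
      using that by (subst sum.inter_filter) (auto simp: h'_def intro!: sum.cong)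
    also have "\<dots> \<le> B" using that by (intro B) auto
    finally show ?thesis .
  qed
  have sm: "summable (\<lambda>n. (cmod (h' n))\<^sup>2 / real n)"
    by (rule summable_comparison_test'[OF summable_h]) (auto simp: h'_def)
  have sm': "summable (\<lambda>n. 9 * (cmod (h' n))\<^sup>2 / real n)"
    using summable_mult[OF sm, of 9] by simp
  have bd': "(\<Sum>p\<in>S. 9 * (cmod (h' p))\<^sup>2 / real p) \<le> 9 * B" if "finite S" for S
    using mult_left_mono[OF bd[OF that], of 9] by (simp add: sum_distrib_left)
  have "eventually (\<lambda>N. (\<Sum>n<N. cmod ((\<Sum>p\<in>prime_factors (Q * n + c). h' p) - (\<Sum>p\<in>{p. p * p \<le> N}. h' p / of_nat p)))
      \<le> (sqrt (5 * B) + \<delta> / 4) * real N) sequentially"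
    by (rule additive_concentration[OF _ _ sm bd c]) (use \<delta> in \<open>auto simp: h'_def h_def\<close>)
  moreover have "eventually (\<lambda>N. (\<Sum>n<N. (\<Sum>p\<in>prime_factors (Q * n + c). 9 * (cmod (h' p))\<^sup>2)) \<le> (2 * (9 * B) + \<delta> / 4) * real N) sequentially"
    by (rule prime_factor_sum_average[OF _ _ sm' bd' c]) (use \<delta> in \<open>auto simp: h'_def\<close>)
  moreover have "eventually (\<lambda>N. real (card {n. n < N \<and> (\<exists>p. prime p \<and> p * p dvd Q * n + c)}) \<le> (B2 + \<delta> / 4) * real N) sequentially"
    by (rule square_divisor_count[OF B2 c]) (use \<delta> in auto)
  ultimately show ?thesis
  proof eventually_elim
    case (elim N)
    have A: "AQ Q N = (\<Sum>p\<in>{p. p * p \<le> N}. h' p / of_nat p)"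
      unfolding AQ_def by (rule sum.mono_neutral_cong_left) (auto simp: h'_def)
    have "cmod (f (Q * n + c) - tw (Q * n + c) * exp (AQ Q N)) \<le>
      2 * of_bool (\<exists>p. prime p \<and> p * p dvd Q * n + c) + (\<Sum>p\<in>prime_factors (Q * n + c). 9 * (cmod (h' p))\<^sup>2)
       + cmod ((\<Sum>p\<in>prime_factors (Q * n + c). h' p) - (\<Sum>p\<in>{p. p * p \<le> N}. h' p / of_nat p))" for n
    proof -
      have "coprime (Q * n + c) Q" using c(2) by (rule coprime_ap)
      then have co: "coprime (Q * n + c) q" using Q by (metis coprime_divisors dvd_refl)
      have hh: "h' p = h p" if "p \<in> prime_factors (Q * n + c)" for p
        using that prime_dvd_ap_coprime(2)[OF c(2), of p n] by (auto simp: h'_def prime_factors_dvd)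
      have "Re (AQ Q N) \<le> 0" unfolding AQ_def by (rule sum_Re_nonpos)
      from f_pointwise[OF _ co this] show ?thesis using c hh by (simp add: A cong: sum.cong)
    qed
    then have "(\<Sum>n<N. cmod (f (Q * n + c) - tw (Q * n + c) * exp (AQ Q N))) \<le>
       (\<Sum>n<N. 2 * of_bool (\<exists>p. prime p \<and> p * p dvd Q * n + c) + (\<Sum>p\<in>prime_factors (Q * n + c). 9 * (cmod (h' p))\<^sup>2)
       + cmod ((\<Sum>p\<in>prime_factors (Q * n + c). h' p) - (\<Sum>p\<in>{p. p * p \<le> N}. h' p / of_nat p)))"
      by (intro sum_mono)
    also have "\<dots> = 2 * real (card {n. n < N \<and> (\<exists>p. prime p \<and> p * p dvd Q * n + c)})
       + (\<Sum>n<N. \<Sum>p\<in>prime_factors (Q * n + c). 9 * (cmod (h' p))\<^sup>2)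
       + (\<Sum>n<N. cmod ((\<Sum>p\<in>prime_factors (Q * n + c). h' p) - (\<Sum>p\<in>{p. p * p \<le> N}. h' p / of_nat p)))"
      by (simp only: sum.distrib sum_distrib_left[symmetric] sum_of_bool_less)
    finally show ?case using elim by (simp add: algebra_simps)
  qed
qed

end

section \<open>Slow variation of the normalizing factor\<close>

lemma norm_cis_diff_le: "cmod (cis a - cis b) \<le> \<bar>a - b\<bar>"
proof -
  have "cmod (exp (\<i> * of_real a) - exp (\<i> * of_real b)) \<le> cmod (\<i> * of_real a - \<i> * of_real b)"
    by (rule exp_lipschitz_left_halfplane) auto
  also have "\<i> * of_real a - \<i> * of_real b = \<i> * complex_of_real (a - b)" by (simp add: algebra_simps)
  finally show ?thesis by (simp add: cis_conv_exp norm_mult del: of_real_diff)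
qed

text \<open>Once the steps are shorter than \<open>\<delta>\<close>, the sequence cannot jump from
  one ball to another: two radii and one step do not bridge a distance above 3
  \<open>\<delta>\<close>.\<close>

lemma slow_finite_cluster:
  fixes y :: "nat \<Rightarrow> complex"
  assumes steps: "(\<lambda>N. y (Suc N) - y N) \<longlonglongrightarrow> 0" and \<delta>: "\<delta> > 0"
    and sep: "\<And>u v. u \<in> V \<Longrightarrow> v \<in> V \<Longrightarrow> u \<noteq> v \<Longrightarrow> cmod (u - v) > 3 * \<delta>"
    and ev: "eventually (\<lambda>N. \<exists>v\<in>V. cmod (y N - v) \<le> \<delta>) sequentially"
  shows "\<exists>v\<in>V. eventually (\<lambda>N. cmod (y N - v) \<le> \<delta>) sequentially"
proof -
  have "eventually (\<lambda>N. cmod (y (Suc N) - y N) < \<delta>) sequentially"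
    using tendstoD[OF steps \<delta>] by (simp add: dist_norm)
  with ev have "eventually (\<lambda>N. (\<exists>v\<in>V. cmod (y N - v) \<le> \<delta>) \<and> cmod (y (Suc N) - y N) < \<delta>) sequentially"
    by eventually_elim auto
  then obtain N0 where N0: "\<And>N. N \<ge> N0 \<Longrightarrow> (\<exists>v\<in>V. cmod (y N - v) \<le> \<delta>) \<and> cmod (y (Suc N) - y N) < \<delta>"
    by (auto simp: eventually_sequentially)
  obtain v where v: "v \<in> V" "cmod (y N0 - v) \<le> \<delta>" using N0[of N0] by auto
  have "cmod (y N - v) \<le> \<delta>" if "N \<ge> N0" for N
    using that
  proof (induction N rule: dec_induct)
    case (step N)
    obtain u where u: "u \<in> V" "cmod (y (Suc N) - u) \<le> \<delta>" using N0[of "Suc N"] step.hyps by auto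
    have "cmod (u - v) \<le> cmod (y (Suc N) - u) + cmod (y (Suc N) - y N) + cmod (y N - v)"
      using norm_triangle_ineq[of "u - y (Suc N)" "y (Suc N) - v"] norm_triangle_ineq[of "y (Suc N) - y N" "y N - v"]
      by (simp add: norm_minus_commute)
    also have "\<dots> \<le> 3 * \<delta>" using u step.IH N0[of N] step.hyps by auto
    finally have "u = v" using sep[OF u(1) v(1)] by force
    with u show ?case by simp
  qed (use v in auto)
  then show ?thesis using v by (auto simp: eventually_sequentially)
qed

lemma finite_separation:
  fixes V :: "complex set"
  assumes "finite V"
  obtains s where "s > 0" "\<And>u v. u \<in> V \<Longrightarrow> v \<in> V \<Longrightarrow> u \<noteq> v \<Longrightarrow> cmod (u - v) \<ge> s"
proof -
  \<comment> \<open>The element 1 keeps the minimum defined when V has at most one point.\<close>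
  define D where "D = insert 1 ((\<lambda>(u, v). cmod (u - v)) ` {(u, v) \<in> V \<times> V. u \<noteq> v})"
  have "finite {(u, v) \<in> V \<times> V. u \<noteq> v}" by (rule finite_subset[of _ "V \<times> V"]) (use assms in auto)
  then have fin: "finite D" unfolding D_def by (intro finite.insertI finite_imageI)
  show ?thesis
  proof (rule that[of "Min D"])
    show "Min D > 0" using fin by (subst Min_gr_iff) (auto simp: D_def)
    show "cmod (u - v) \<ge> Min D" if "u \<in> V" "v \<in> V" "u \<noteq> v" for u v
      using that fin by (intro Min_le) (auto simp: D_def)
  qed
qed

text \<open>Every limit point is one of the finitely many k-th roots of L, and a slowly moving
  sequence must settle at a single one of them.\<close>

lemma slow_power_convergent:
  fixes y :: "nat \<Rightarrow> complex"
  assumes steps: "(\<lambda>N. y (Suc N) - y N) \<longlonglongrightarrow> 0" and bd: "\<And>N. cmod (y N) \<le> 1"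
    and k: "k > 0" and lim: "(\<lambda>N. y N ^ k) \<longlonglongrightarrow> L"
  shows "convergent y"
proof -
  define V where "V = {z. z ^ k = L}"
  have finV: "finite V" unfolding V_def by (rule finite_nth_roots[OF k])
  have near: "eventually (\<lambda>N. \<exists>v\<in>V. cmod (y N - v) \<le> \<delta>) sequentially" if "\<delta> > 0" for \<delta>
  proof -
    \<comment> \<open>The part of the unit disc at distance at least \<open>\<delta>\<close> from
      all roots; by compactness z^k stays away from L on it, so y N eventually avoids it.\<close>
    define K where "K = cball 0 1 \<inter> (\<Inter>v\<in>V. - ball v \<delta>)"
    have "compact K" unfolding K_def by (intro compact_Int_closed compact_cball closed_INT) auto
    have "\<exists>m>0. \<forall>z\<in>K. cmod (z ^ k - L) \<ge> m"
    proof (cases "K = {}")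
      case False
      have "continuous_on K (\<lambda>z. cmod (z ^ k - L))" by (intro continuous_intros)
      then obtain z0 where z0: "z0 \<in> K" "\<And>z. z \<in> K \<Longrightarrow> cmod (z0 ^ k - L) \<le> cmod (z ^ k - L)"
        using continuous_attains_inf[OF \<open>compact K\<close> False] by blast
      have "z0 \<notin> V" using z0(1) that by (auto simp: K_def)
      then have "cmod (z0 ^ k - L) > 0" by (simp add: V_def)
      with z0 show ?thesis by blast
    qed (auto intro: exI[of _ 1])
    then obtain m where m: "m > 0" "\<And>z. z \<in> K \<Longrightarrow> cmod (z ^ k - L) \<ge> m" by blast
    have "eventually (\<lambda>N. cmod (y N ^ k - L) < m) sequentially"
      using tendstoD[OF lim m(1)] by (simp add: dist_norm)
    then show ?thesis
    proof eventually_elim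
      case (elim N)
      then have "y N \<notin> K" using m(2)[of "y N"] by auto
      then show ?case using bd[of N] by (auto simp: K_def dist_norm norm_minus_commute intro: less_imp_le)
    qed
  qed
  obtain s where s: "s > 0" "\<And>u v. u \<in> V \<Longrightarrow> v \<in> V \<Longrightarrow> u \<noteq> v \<Longrightarrow> cmod (u - v) \<ge> s"
    using finite_separation[OF finV] by blast
  have "\<exists>v\<in>V. eventually (\<lambda>N. cmod (y N - v) \<le> s / 4) sequentially"
    by (rule slow_finite_cluster[OF steps _ _ near]) (use s in force)+
  then obtain v where v: "v \<in> V" "eventually (\<lambda>N. cmod (y N - v) \<le> s / 4) sequentially" by blast
  have "y \<longlonglongrightarrow> v"
  proof (rule tendstoI)
    fix e :: real assume "e > 0"
    define \<delta> where "\<delta> = min (e / 2) (s / 4)"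
    have \<delta>: "\<delta> > 0" "\<delta> < e" "\<delta> \<le> s / 4" using \<open>e > 0\<close> s(1) by (auto simp: \<delta>_def)
    show "eventually (\<lambda>N. dist (y N) v < e) sequentially"
      using near[OF \<delta>(1)] v(2)
    proof eventually_elim
      case (elim N)
      then obtain u where u: "u \<in> V" "cmod (y N - u) \<le> \<delta>" by blast
      have "cmod (u - v) \<le> cmod (y N - u) + cmod (y N - v)"
        using norm_triangle_ineq[of "u - y N" "y N - v"] by (simp add: norm_minus_commute)
      then have "cmod (u - v) < s" using u elim \<delta> s(1) by linarith
      then have "u = v" using s(2)[OF u(1) v(1)] by force
      then show ?case using u \<delta> by (simp add: dist_norm)
    qed
  qed
  then show ?thesis by (auto simp: convergent_def)
qed

lemma cis_small_eq_1:
  assumes "cis x = 1" "\<bar>x\<bar> < 1"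
  shows "x = 0"
proof (rule ccontr)
  assume "x \<noteq> 0"
  have "sin x = 0" using assms(1) by (simp add: complex_eq_iff)
  moreover have "sin \<bar>x\<bar> > 0" using \<open>x \<noteq> 0\<close> assms(2) pi_gt3 by (intro sin_gt_zero) auto
  ultimately show False by (auto simp: abs_if split: if_splits)
qed

context pretentious_to
begin

definition A :: "nat \<Rightarrow> complex" where "A N = (\<Sum>p\<in>{p. p * p \<le> N}. h p / of_nat p)"

definition \<kappa> :: "nat \<Rightarrow> complex" where "\<kappa> Q = (\<Sum>p\<in>prime_factors Q. h p / of_nat p)"

text \<open>Up to a constant depending on Q, this is the typical value of f at terms Q n + 1 with n
  close to N.\<close>

definition Z :: "nat \<Rightarrow> complex" where "Z N = exp (A N) * cis (t * ln (real N))"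

lemma Re_A_le: "Re (A N) \<le> 0" unfolding A_def by (rule sum_Re_nonpos)

lemma Re_AQ_le: "Re (AQ Q N) \<le> 0" unfolding AQ_def by (rule sum_Re_nonpos)

lemma norm_exp_A_le: "cmod (exp (A N)) \<le> 1" using Re_A_le by simp

lemma norm_exp_AQ_le: "cmod (exp (AQ Q N)) \<le> 1" using Re_AQ_le by simp

lemma norm_exp_\<kappa>: "cmod (exp (- \<kappa> Q)) \<ge> 1"
  using sum_Re_nonpos(2)[of "prime_factors Q"] by (simp add: \<kappa>_def)

text \<open>The modulus involves only the real parts of h p / p, whose series converges; the
  imaginary parts, which may diverge, affect the phase alone.\<close>

lemma exp_A_lower: obtains \<rho> where "\<rho> > 0" "\<And>N. cmod (exp (A N)) \<ge> \<rho>"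
proof
  show "exp (- (\<Sum>n. - Re (h n) / real n)) > 0" by simp
  fix N
  have "(\<Sum>p\<in>{p. p * p \<le> N}. - Re (h p) / real p) \<le> (\<Sum>n. - Re (h n) / real n)"
    using summable_Re_h Re_h_le by (intro sum_le_suminf) (auto simp: divide_nonpos_nonneg)
  then have "- Re (A N) \<le> (\<Sum>n. - Re (h n) / real n)"
    by (simp add: A_def Re_divide_of_nat sum_negf)
  then show "cmod (exp (A N)) \<ge> exp (- (\<Sum>n. - Re (h n) / real n))" by simp
qed

lemma AQ_eq:
  assumes "Q > 0" "N \<ge> Q * Q"
  shows "AQ Q N = A N - \<kappa> Q"
proof -
  have "A N = (\<Sum>p\<in>{p. p * p \<le> N \<and> \<not> p dvd Q}. h p / of_nat p) + (\<Sum>p\<in>{p. p * p \<le> N \<and> p dvd Q}. h p / of_nat p)"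
    unfolding A_def by (subst sum.union_disjoint[symmetric]) (auto intro!: sum.cong)
  also have "(\<Sum>p\<in>{p. p * p \<le> N \<and> p dvd Q}. h p / of_nat p) = \<kappa> Q"
    unfolding \<kappa>_def
  proof (rule sum.mono_neutral_right)
    show "prime_factors Q \<subseteq> {p. p * p \<le> N \<and> p dvd Q}"
    proof
      fix p assume "p \<in> prime_factors Q"
      then have "p dvd Q" by auto
      then have "p \<le> Q" using assms(1) by (simp add: dvd_imp_le)
      then have "p * p \<le> N" using assms(2) mult_le_mono[of p Q p Q] by linarith
      with \<open>p dvd Q\<close> show "p \<in> {p. p * p \<le> N \<and> p dvd Q}" by simp
    qed
    show "\<forall>p\<in>{p. p * p \<le> N \<and> p dvd Q} - prime_factors Q. h p / of_nat p = 0"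
      using assms(1) by (auto simp: h_def prime_factors_dvd)
  qed auto
  finally show ?thesis by (simp add: AQ_def)
qed

text \<open>The difference is a sum of h p / p over sqrt N < p <= sqrt M. Cauchy-Schwarz bounds it
  by a tail of the series of |h p|^2 / p times the sum of 1 / p over the range; even over all
  integers the latter is at most (sqrt (K N) + 1) / sqrt N, hence at most C = sqrt K + 1.\<close>

lemma A_slow:
  assumes "\<delta> > 0" "K \<ge> 1"
  shows "\<exists>N0. \<forall>N\<ge>N0. \<forall>M. N \<le> M \<longrightarrow> real M \<le> K * real N \<longrightarrow> cmod (A M - A N) \<le> \<delta>"
proof -
  define C where "C = sqrt K + 1"
  have C: "C > 0" using assms(2) by (simp add: C_def add_pos_pos)
  obtain P where P: "\<And>S. finite S \<Longrightarrow> (\<forall>n\<in>S. P \<le> n) \<Longrightarrow> (\<Sum>n\<in>S. (cmod (h n))\<^sup>2 / real n) \<le> \<delta>\<^sup>2 / C"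
    using summable_tail_small[OF summable_h, of "\<delta>\<^sup>2 / C"] assms C by auto
  show ?thesis
  proof (intro exI[of _ "P * P + 1"] allI impI)
    fix N M assume N: "P * P + 1 \<le> N" and M: "N \<le> M" "real M \<le> K * real N"
    define S where "S = {p. p * p \<le> M \<and> N < p * p}"
    have finS: "finite S" by (simp add: S_def)
    have gt: "P \<le> p" if "p \<in> S" for p
      using that N mult_le_mono[of p P p P] by (force simp: S_def)
    have sqp: "sqrt (real N) \<le> real p" if "p \<in> S" for p
    proof -
      have "N \<le> p * p" using that by (simp add: S_def)
      then have "real N \<le> real (p * p)" by (simp only: of_nat_le_iff)
      then show ?thesis by (intro real_le_lsqrt) (auto simp: power2_eq_square)
    qed
    have N0: "sqrt (real N) > 0" "real N \<ge> 1" using N by auto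
    have "A M - A N = (\<Sum>p\<in>S. h p / of_nat p)"
    proof -
      have "{p. p * p \<le> M} = {p. p * p \<le> N} \<union> S" "{p. p * p \<le> N} \<inter> S = {}" using M by (auto simp: S_def)
      then have "A M = A N + (\<Sum>p\<in>S. h p / of_nat p)"
        unfolding A_def using finS by (simp add: sum.union_disjoint)
      then show ?thesis by simp
    qed
    then have "cmod (A M - A N) \<le> (\<Sum>p\<in>S. cmod (h p) / real p)"
      using norm_sum[of "\<lambda>p. h p / of_nat p" S] by (simp add: norm_divide)
    also have "\<dots> = (\<Sum>p\<in>S. (cmod (h p) / sqrt (real p)) * (1 / sqrt (real p)))"
      using real_sqrt_mult_self by (intro sum.cong) (auto simp: field_simps)
    finally have 1: "cmod (A M - A N) \<le> \<dots>" .
    have "card S \<le> nat \<lfloor>sqrt (real M)\<rfloor> + 1"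
    proof -
      have "S \<subseteq> {..nat \<lfloor>sqrt (real M)\<rfloor>}"
      proof
        fix p assume "p \<in> S"
        then have "p * p \<le> M" by (simp add: S_def)
        then have "real (p * p) \<le> real M" by (simp only: of_nat_le_iff)
        then have "real p \<le> sqrt (real M)" by (intro real_le_rsqrt) (simp add: power2_eq_square)
        then show "p \<in> {..nat \<lfloor>sqrt (real M)\<rfloor>}" by (simp add: le_nat_floor)
      qed
      then show ?thesis using card_mono[of "{..nat \<lfloor>sqrt (real M)\<rfloor>}" S] by simp
    qed
    moreover have "real (nat \<lfloor>sqrt (real M)\<rfloor>) \<le> sqrt (real M)" by (rule of_nat_floor) simp
    ultimately have "real (card S) \<le> sqrt (real M) + 1" by linarith
    also have "sqrt (real M) \<le> sqrt K * sqrt (real N)"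
      using M(2) by (metis real_sqrt_le_mono real_sqrt_mult)
    also have "\<dots> + 1 \<le> C * sqrt (real N)"
      using real_sqrt_ge_one[OF N0(2)] by (simp add: C_def algebra_simps)
    finally have "real (card S) \<le> C * sqrt (real N)" by simp
    then have cs: "real (card S) * (1 / sqrt (real N)) \<le> C" using N0 by (simp add: field_simps)
    have "(\<Sum>p\<in>S. (cmod (h p) / sqrt (real p)) * (1 / sqrt (real p)))\<^sup>2 \<le>
      (\<Sum>p\<in>S. (cmod (h p) / sqrt (real p))\<^sup>2) * (\<Sum>p\<in>S. (1 / sqrt (real p))\<^sup>2)"
      by (rule Cauchy_Schwarz_ineq_sum)
    also have "\<dots> \<le> (\<delta>\<^sup>2 / C) * C"
    proof (rule mult_mono)
      show "(\<Sum>p\<in>S. (cmod (h p) / sqrt (real p))\<^sup>2) \<le> \<delta>\<^sup>2 / C"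
        using P[OF finS] gt by (simp add: power_divide)
      have "(\<Sum>p\<in>S. (1 / sqrt (real p))\<^sup>2) \<le> (\<Sum>p\<in>S. 1 / sqrt (real N))"
        using sqp N0 by (intro sum_mono) (auto simp: power_divide intro!: frac_le)
      also have "\<dots> \<le> C" using cs by simp
      finally show "(\<Sum>p\<in>S. (1 / sqrt (real p))\<^sup>2) \<le> C" .
    qed (use C in \<open>auto intro: sum_nonneg\<close>)
    also have "\<dots> = \<delta>\<^sup>2" using C by simp
    finally have "(\<Sum>p\<in>S. (cmod (h p) / sqrt (real p)) * (1 / sqrt (real p))) \<le> \<delta>"
      by (rule power2_le_imp_le) (use assms in simp)
    with 1 show "cmod (A M - A N) \<le> \<delta>" by linarith
  qed
qed

lemma A_mult_slow:
  assumes "l > 0"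
  shows "(\<lambda>N. A (l * N) - A N) \<longlonglongrightarrow> 0"
proof (rule tendstoI)
  fix e :: real assume e: "e > 0"
  obtain N0 where N0: "\<forall>N\<ge>N0. \<forall>M. N \<le> M \<longrightarrow> real M \<le> real l * real N \<longrightarrow> cmod (A M - A N) \<le> e / 2"
    using A_slow[of "e / 2" "real l"] e assms by auto
  have "dist (A (l * N) - A N) 0 < e" if "N \<ge> N0" for N
    using N0[rule_format, OF that, of "l * N"] assms e by (simp add: dist_norm)
  then show "eventually (\<lambda>N. dist (A (l * N) - A N) 0 < e) sequentially"
    by (auto simp: eventually_sequentially)
qed

lemma A_step: "(\<lambda>N. A (Suc N) - A N) \<longlonglongrightarrow> 0"
proof (rule tendstoI)
  fix e :: real assume e: "e > 0"
  obtain N0 where N0: "\<forall>N\<ge>N0. \<forall>M. N \<le> M \<longrightarrow> real M \<le> 2 * real N \<longrightarrow> cmod (A M - A N) \<le> e / 2"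
    using A_slow[of "e / 2" 2] e by auto
  have "dist (A (Suc N) - A N) 0 < e" if "N \<ge> max N0 1" for N
    using N0[rule_format, of N "Suc N"] that e by (simp add: dist_norm)
  then show "eventually (\<lambda>N. dist (A (Suc N) - A N) 0 < e) sequentially"
    unfolding eventually_sequentially by blast
qed

lemma exp_A_step: "(\<lambda>N. exp (A (Suc N)) - exp (A N)) \<longlonglongrightarrow> 0"
  by (rule Lim_null_comparison[OF _ tendsto_norm_zero[OF A_step]])
     (auto intro!: always_eventually exp_lipschitz_left_halfplane Re_A_le)

lemma Z_step: "(\<lambda>N. Z (Suc N) - Z N) \<longlonglongrightarrow> 0"
proof -
  have "(\<lambda>N. ln (real (Suc N)) - ln (real N)) \<longlonglongrightarrow> 0" by real_asymp
  from tendsto_rabs_zero[OF tendsto_mult_right_zero[OF this, of t]]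
  have "(\<lambda>N. \<bar>t * ln (real (Suc N)) - t * ln (real N)\<bar>) \<longlonglongrightarrow> 0" by (simp add: right_diff_distrib)
  then have c: "(\<lambda>N. cis (t * ln (real (Suc N))) - cis (t * ln (real N))) \<longlonglongrightarrow> 0"
    by (rule Lim_null_comparison[rotated]) (auto intro!: always_eventually norm_cis_diff_le)
  have "(\<lambda>N. cmod (exp (A (Suc N)) - exp (A N)) + cmod (cis (t * ln (real (Suc N))) - cis (t * ln (real N)))) \<longlonglongrightarrow> 0 + 0"
    by (intro tendsto_add tendsto_norm_zero exp_A_step c)
  then have *: "(\<lambda>N. cmod (exp (A (Suc N)) - exp (A N)) + cmod (cis (t * ln (real (Suc N))) - cis (t * ln (real N)))) \<longlonglongrightarrow> 0" by simp
  show ?thesis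
  proof (rule Lim_null_comparison[OF always_eventually *], intro allI)
    fix N
    have "Z (Suc N) - Z N = (exp (A (Suc N)) - exp (A N)) * cis (t * ln (real (Suc N)))
        + exp (A N) * (cis (t * ln (real (Suc N))) - cis (t * ln (real N)))"
      by (simp add: Z_def algebra_simps)
    also have "cmod \<dots> \<le> cmod ((exp (A (Suc N)) - exp (A N)) * cis (t * ln (real (Suc N))))
       + cmod (exp (A N) * (cis (t * ln (real (Suc N))) - cis (t * ln (real N))))" by (rule norm_triangle_ineq)
    also have "cmod (exp (A N) * (cis (t * ln (real (Suc N))) - cis (t * ln (real N)))) \<le> 1 * cmod (cis (t * ln (real (Suc N))) - cis (t * ln (real N)))"
      unfolding norm_mult by (intro mult_right_mono norm_exp_A_le) auto
    finally show "cmod (Z (Suc N) - Z N) \<le> cmod (exp (A (Suc N)) - exp (A N)) + cmod (cis (t * ln (real (Suc N))) - cis (t * ln (real N)))"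
      by (simp add: norm_mult)
  qed
qed

text \<open>A(l N) - A(N) tends to 0, so Z(l N)^k / Z(N)^k tends to l^(ikt). The limit of Z(N)^k is
  nonzero, so l^(ikt) = 1 for every l > 0, and this forces t = 0. What remains is the convergence of
  exp (A(N))^k, and slow variation removes the power.\<close>

lemma Z_power_convergent:
  assumes k: "k > 0" and "convergent (\<lambda>N. Z N ^ k)"
  shows "t = 0" "convergent (\<lambda>N. exp (A N))"
proof -
  obtain L where L: "(\<lambda>N. Z N ^ k) \<longlonglongrightarrow> L" using assms(2) by (auto simp: convergent_def)
  obtain \<rho> where \<rho>: "\<rho> > 0" "\<And>N. cmod (exp (A N)) \<ge> \<rho>" using exp_A_lower by blast
  have "cmod L \<ge> \<rho> ^ k"
  proof (rule tendsto_lowerbound[OF tendsto_norm[OF L]])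
    show "eventually (\<lambda>N. \<rho> ^ k \<le> cmod (Z N ^ k)) sequentially"
      using \<rho> by (auto intro!: always_eventually power_mono simp: Z_def norm_mult norm_power simp del: norm_exp_eq_Re)
  qed auto
  then have L0: "L \<noteq> 0" using zero_less_power[OF \<rho>(1), of k] by auto
  have cis1: "cis (real k * t * ln (real l)) = 1" if l: "l > 0" for l
  proof -
    have "filterlim (\<lambda>N. l * N) at_top sequentially"
      using l by (intro filterlim_subseq) (auto simp: strict_mono_def)
    then have "(\<lambda>N. Z (l * N) ^ k) \<longlonglongrightarrow> L" by (rule filterlim_compose[OF L])
    then have "(\<lambda>N. Z (l * N) ^ k / Z N ^ k) \<longlonglongrightarrow> L / L" by (intro tendsto_divide L L0)
    then have 1: "(\<lambda>N. Z (l * N) ^ k / Z N ^ k) \<longlonglongrightarrow> 1" using L0 by simp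
    have "(\<lambda>N. exp (A (l * N) - A N) ^ k * cis (real k * t * ln (real l))) \<longlonglongrightarrow> exp 0 ^ k * cis (real k * t * ln (real l))"
      by (intro tendsto_mult tendsto_power tendsto_exp A_mult_slow l tendsto_const)
    moreover have "eventually (\<lambda>N. exp (A (l * N) - A N) ^ k * cis (real k * t * ln (real l)) = Z (l * N) ^ k / Z N ^ k) sequentially"
      using eventually_gt_at_top[of 0]
    proof eventually_elim
      case (elim N)
      have "Z (l * N) = exp (A (l * N) - A N) * cis (t * ln (real l)) * Z N"
        using elim l by (simp add: Z_def ln_mult distrib_left cis_mult[symmetric] exp_diff)
      moreover have "Z N \<noteq> 0" by (simp add: Z_def)
      ultimately have "Z (l * N) / Z N = exp (A (l * N) - A N) * cis (t * ln (real l))" by simp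
      then have "(Z (l * N) / Z N) ^ k = (exp (A (l * N) - A N) * cis (t * ln (real l))) ^ k" by simp
      then show ?case by (simp add: power_divide power_mult_distrib Complex.DeMoivre mult.assoc)
    qed
    ultimately have "(\<lambda>N. Z (l * N) ^ k / Z N ^ k) \<longlonglongrightarrow> exp 0 ^ k * cis (real k * t * ln (real l))"
      by (rule Lim_transform_eventually)
    from LIMSEQ_unique[OF 1 this] show ?thesis by simp
  qed
  show t0: "t = 0"
  proof -
    \<comment> \<open>With l this large the phase k t ln (1 + 1 / l) between l and l + 1 is below 1
      in absolute value, where \<open>cis\<close> equals 1 only at 0.\<close>
    obtain l :: nat where l: "real l > \<bar>real k * t\<bar>" using reals_Archimedean2 by blast
    then have lpos: "l > 0" by (cases l) auto
    define x where "x = real k * t * (ln (real (Suc l)) - ln (real l))"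
    have "cis x = cis (real k * t * ln (real (Suc l))) / cis (real k * t * ln (real l))"
      by (simp add: x_def right_diff_distrib cis_divide)
    then have "cis x = 1" using cis1[of "Suc l"] cis1[of l] lpos by simp
    have "1 + 1 / real l = real (Suc l) / real l" using lpos by (simp add: field_simps)
    then have "ln (real (Suc l)) - ln (real l) = ln (1 + 1 / real l)"
      using lpos by (simp add: ln_div)
    then have lnb: "0 < ln (real (Suc l)) - ln (real l)" "ln (real (Suc l)) - ln (real l) \<le> 1 / real l"
      using lpos ln_add_one_self_le_self[of "1 / real l"] by (auto intro: ln_gt_zero)
    have "\<bar>x\<bar> \<le> \<bar>real k * t\<bar> * (1 / real l)"
      using lnb unfolding x_def abs_mult[of "real k * t"] by (intro mult_left_mono) auto
    also have "\<dots> < 1" using l lpos by (simp add: field_simps)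
    finally have "x = 0" using cis_small_eq_1 \<open>cis x = 1\<close> by blast
    then show ?thesis using lnb(1) k by (simp add: x_def)
  qed
  have "cis (t * x) = 1" for x using t0 by simp
  then have "(\<lambda>N. exp (A N) ^ k) \<longlonglongrightarrow> L" using L by (simp only: Z_def mult_1_right)
  then show "convergent (\<lambda>N. exp (A N))"
    by (rule slow_power_convergent[OF exp_A_step norm_exp_A_le k])
qed

text \<open>The threshold w depends on \<open>\<epsilon>\<close> alone: the error constants are sums
  over primes not dividing Q, hence over primes above w, and are tails of convergent series
  uniformly in Q.\<close>

lemma concentration_eventually:
  assumes "\<epsilon> > 0"
  obtains w where "\<And>Q c. q dvd Q \<Longrightarrow> (\<And>p. prime p \<Longrightarrow> p \<le> w \<Longrightarrow> p dvd Q) \<Longrightarrow> c > 0 \<Longrightarrow> coprime c Q \<Longrightarrow>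
    eventually (\<lambda>N. (\<Sum>n<N. cmod (f (Q * n + c) - tw (Q * n + c) * exp (AQ Q N))) \<le> \<epsilon> * real N) sequentially"
proof -
  \<comment> \<open>Chosen so that 2 \<open>\<eta>\<close> + 18 \<open>\<eta>\<close> and sqrt (5
    \<open>\<eta>\<close>) are each at most \<open>\<epsilon> / 4\<close>; the remaining
    \<open>\<epsilon> / 2\<close> is the slack parameter.\<close>
  define \<eta> where "\<eta> = min (\<epsilon> / 80) (\<epsilon>\<^sup>2 / 80)"
  have \<eta>: "\<eta> > 0" "20 * \<eta> \<le> \<epsilon> / 4" "5 * \<eta> \<le> (\<epsilon> / 4)\<^sup>2"
    using assms by (auto simp: \<eta>_def power_divide)
  have "sqrt (5 * \<eta>) \<le> \<epsilon> / 4" using \<eta>(3) assms by (intro real_le_lsqrt) auto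
  obtain M1 where M1: "\<And>S. finite S \<Longrightarrow> (\<forall>n\<in>S. M1 \<le> n) \<Longrightarrow> (\<Sum>n\<in>S. (cmod (h n))\<^sup>2 / real n) \<le> \<eta>"
    using summable_tail_small[OF summable_h _ \<eta>(1)] by auto
  have s2: "summable (\<lambda>n. 1 / (real n)\<^sup>2)" using inverse_power_summable[of 2, where 'a = real] by (simp add: inverse_eq_divide)
  obtain M2 where M2: "\<And>S. finite S \<Longrightarrow> (\<forall>n\<in>S. M2 \<le> n) \<Longrightarrow> (\<Sum>n\<in>S. 1 / (real n)\<^sup>2) \<le> \<eta>"
    using summable_tail_small[OF s2 _ \<eta>(1)] by auto
  show ?thesis
  proof (rule that[of "max M1 M2"])
    fix Q c assume Q: "q dvd Q" "\<And>p. prime p \<Longrightarrow> p \<le> max M1 M2 \<Longrightarrow> p dvd Q" and c: "c > 0" "coprime c Q"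
    have "eventually (\<lambda>N. (\<Sum>n<N. cmod (f (Q * n + c) - tw (Q * n + c) * exp (AQ Q N)))
      \<le> (2 * \<eta> + 18 * \<eta> + sqrt (5 * \<eta>) + \<epsilon> / 2) * real N) sequentially"
    proof (rule concentration[OF c Q(1)])
      fix S assume S: "finite S" "\<And>p. p \<in> S \<Longrightarrow> \<not> p dvd Q"
      have "(\<Sum>p\<in>S. (cmod (h p))\<^sup>2 / real p) = (\<Sum>p\<in>{p \<in> S. prime p}. (cmod (h p))\<^sup>2 / real p)"
        using S(1) by (intro sum.mono_neutral_right) (auto simp: h_def)
      also have "\<dots> \<le> \<eta>"
      proof (intro M1 ballI)
        fix n assume "n \<in> {p \<in> S. prime p}"
        then show "M1 \<le> n" using S(2)[of n] Q(2)[of n] by (cases "n \<le> max M1 M2") auto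
      qed (use S in auto)
      finally show "(\<Sum>p\<in>S. (cmod (h p))\<^sup>2 / real p) \<le> \<eta>" .
    next
      fix S assume S: "finite S" "\<And>p. p \<in> S \<Longrightarrow> prime p \<and> \<not> p dvd Q"
      show "(\<Sum>p\<in>S. 1 / (real p)\<^sup>2) \<le> \<eta>"
      proof (intro M2 ballI)
        fix n assume "n \<in> S"
        then show "M2 \<le> n" using S(2)[of n] Q(2)[of n] by (cases "n \<le> max M1 M2") auto
      qed (use S in auto)
    qed (use assms in auto)
    then show "eventually (\<lambda>N. (\<Sum>n<N. cmod (f (Q * n + c) - tw (Q * n + c) * exp (AQ Q N))) \<le> \<epsilon> * real N) sequentially"
    proof eventually_elim
      case (elim N)
      have "2 * \<eta> + 18 * \<eta> + sqrt (5 * \<eta>) + \<epsilon> / 2 \<le> \<epsilon>" using \<eta> \<open>sqrt (5 * \<eta>) \<le> \<epsilon> / 4\<close> by linarith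
      then have "(2 * \<eta> + 18 * \<eta> + sqrt (5 * \<eta>) + \<epsilon> / 2) * real N \<le> \<epsilon> * real N" by (rule mult_right_mono) simp
      then show ?case using elim by linarith
    qed
  qed
qed

end

section \<open>Values in progressions and smooth parts\<close>

lemma not_coprime_prime:
  fixes a b :: nat
  assumes "\<not> coprime a b"
  shows "\<exists>p. prime p \<and> p dvd a \<and> p dvd b"
proof -
  have "gcd a b \<noteq> 1" using assms unfolding coprime_iff_gcd_eq_1 .
  then obtain p where "prime p" "p dvd gcd a b" using prime_factor_nat by blast
  then show ?thesis by auto
qed

context pretentious_to
begin

text \<open>Concentration holds on average over n < N, so some n in the top window of length N / j
  satisfies it. For such n the factor (Q n + 1)^(it) is close to (Q N)^(it), and f(Q n + 1) is close
  to a constant times Z(N).\<close>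

lemma value_near_Z:
  assumes m: "m > 0" and \<delta>: "\<delta> > 0"
  obtains Q C where "Q > 0" "m dvd Q" "cmod C \<ge> 1"
    "eventually (\<lambda>N. \<exists>n\<ge>1. cmod (f (Q * n + 1) - C * Z N) \<le> \<delta>) sequentially"
proof -
  \<comment> \<open>On the top window the logarithm varies by at most 1 / (j - 1); this j makes the
    variation of the phase at most \<open>\<delta> / 2\<close>.\<close>
  obtain j :: nat where j: "real j > 2 * \<bar>t\<bar> / \<delta> + 2" using reals_Archimedean2 by blast
  have "2 * \<bar>t\<bar> / \<delta> \<ge> 0" using \<delta> by simp
  then have j2: "j > 2" "real j > 2" using j by linarith+
  have tj: "\<bar>t\<bar> / (real j - 1) \<le> \<delta> / 2"
  proof -
    have "2 * \<bar>t\<bar> / \<delta> \<le> real j - 1" using j by linarith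
    then have "2 * \<bar>t\<bar> \<le> (real j - 1) * \<delta>" using \<delta> by (simp add: field_simps)
    then show ?thesis using j2 by (simp add: field_simps)
  qed
  \<comment> \<open>The window contains more than N / (2 j) indices, so errors of at least
    \<open>\<delta> / 4\<close> at all of them would sum to more than
    \<open>\<delta> / (8 j)\<close> times N.\<close>
  define \<epsilon> where "\<epsilon> = \<delta> / (8 * real j)"
  have "\<epsilon> > 0" using \<delta> j2 by (simp add: \<epsilon>_def)
  then obtain w where w: "\<And>Q c. q dvd Q \<Longrightarrow> (\<And>p. prime p \<Longrightarrow> p \<le> w \<Longrightarrow> p dvd Q) \<Longrightarrow> c > 0 \<Longrightarrow> coprime c Q \<Longrightarrow>
    eventually (\<lambda>N. (\<Sum>n<N. cmod (f (Q * n + c) - tw (Q * n + c) * exp (AQ Q N))) \<le> \<epsilon> * real N) sequentially"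
    using concentration_eventually by blast
  define Q where "Q = m * q * fact w"
  have Q: "Q > 0" "m dvd Q" "q dvd Q" using m q_pos by (auto simp: Q_def)
  have "p dvd Q" if "prime p" "p \<le> w" for p
    using dvd_fact[of p w] that prime_ge_1_nat by (auto simp: Q_def)
  then have ev: "eventually (\<lambda>N. (\<Sum>n<N. cmod (f (Q * n + 1) - tw (Q * n + 1) * exp (AQ Q N))) \<le> \<epsilon> * real N) sequentially"
    using Q by (intro w) auto
  \<comment> \<open>Converts Z(N) into (Q N)^(it) exp (AQ Q N): the first factor removes the primes
    dividing Q, the second rescales N to Q N.\<close>
  define C where "C = exp (- \<kappa> Q) * cis (t * ln (real Q))"
  show ?thesis
  proof (rule that[of Q C])
    show "cmod C \<ge> 1" using norm_exp_\<kappa>[of Q] by (simp add: C_def norm_mult del: norm_exp_eq_Re)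
    show "eventually (\<lambda>N. \<exists>n\<ge>1. cmod (f (Q * n + 1) - C * Z N) \<le> \<delta>) sequentially"
      using ev eventually_ge_at_top[of "Q * Q"] eventually_ge_at_top[of "2 * j"]
    proof eventually_elim
      case (elim N)
      define S where "S = {N - N div j..<N}"
      have Npos: "N > 0" using elim j2 by simp
      have "\<exists>n\<in>S. cmod (f (Q * n + 1) - tw (Q * n + 1) * exp (AQ Q N)) \<le> \<delta> / 4"
      proof (rule ccontr)
        assume "\<not> ?thesis"
        then have big: "\<delta> / 4 \<le> cmod (f (Q * n + 1) - tw (Q * n + 1) * exp (AQ Q N))" if "n \<in> S" for n
          using that by force
        have card: "card S = N div j" using div_le_dividend[of N j] by (simp add: S_def)
        have "real N < real j * (real (N div j) + 1)"
        proof -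
          have "N < (N div j + 1) * j" using j2 by (metis Suc_eq_plus1 dividend_less_div_times mult.commute mult_Suc add.commute less_trans zero_less_numeral)
          then have "real N < real ((N div j + 1) * j)" by (simp only: of_nat_less_iff)
          then show ?thesis by (simp add: algebra_simps)
        qed
        moreover have "real (2 * j) \<le> real N" using elim(3) by (simp only: of_nat_le_iff)
        ultimately have "real N < 2 * real j * real (N div j)" by (simp add: algebra_simps)
        then have "\<epsilon> * real N < \<epsilon> * (2 * real j * real (N div j))" using \<open>\<epsilon> > 0\<close> by (rule mult_strict_left_mono)
        also have "\<dots> = (\<Sum>n\<in>S. \<delta> / 4)" using j2 card by (simp add: \<epsilon>_def)
        also have "\<dots> \<le> (\<Sum>n\<in>S. cmod (f (Q * n + 1) - tw (Q * n + 1) * exp (AQ Q N)))"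
          by (intro sum_mono big)
        also have "\<dots> \<le> (\<Sum>n<N. cmod (f (Q * n + 1) - tw (Q * n + 1) * exp (AQ Q N)))"
          by (intro sum_mono2) (auto simp: S_def)
        finally show False using elim(1) by simp
      qed
      then obtain n where n: "n \<in> S" "cmod (f (Q * n + 1) - tw (Q * n + 1) * exp (AQ Q N)) \<le> \<delta> / 4" by blast
      have nN: "n < N" "N - N div j \<le> n" using n(1) by (auto simp: S_def)
      have "real N - real N / real j \<le> real n"
      proof -
        have "real N - real (N div j) \<le> real n" using nN div_le_dividend[of N j] by linarith
        moreover have "real (N div j) \<le> real N / real j" by (rule of_nat_div_le_of_nat)
        ultimately show ?thesis by linarith
      qed
      then have nlow: "real N * (real j - 1) \<le> real n * real j" using j2 by (simp add: field_simps)
      moreover have "real N * (real j - 1) > 0" using Npos j2 by simp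
      ultimately have "real n * real j > 0" by linarith
      then have npos: "n > 0" by (cases n) auto
      have x: "Q * n + 1 \<le> Q * N"
      proof -
        have "Q * (n + 1) \<le> Q * N" using nN by (intro mult_left_mono) auto
        then show ?thesis using Q(1) by (simp add: algebra_simps)
      qed
      have xr: "real (Q * n + 1) \<le> real (Q * N)" using x by (simp only: of_nat_le_iff)
      have lnle: "ln (real (Q * n + 1)) \<le> ln (real (Q * N))" by (rule ln_mono[OF xr], rule of_nat_0_less_iff[THEN iffD2]) simp
      have "ln (real (Q * N)) - ln (real (Q * n + 1)) \<le> ln (real (Q * N)) - ln (real (Q * n))"
        using ln_mono[of "real (Q * n)" "real (Q * n + 1)"] npos Q(1) by simp
      also have "\<dots> = ln (real N / real n)" using Npos npos Q by (simp add: ln_mult ln_div)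
      also have "\<dots> \<le> real N / real n - 1" using Npos npos by (intro ln_le_minus_one) auto
      also have "\<dots> \<le> 1 / (real j - 1)"
      proof -
        have "real N * (real j - 1) \<le> real n * (real j - 1) + real n" using nlow by (simp add: algebra_simps)
        then show ?thesis using npos j2 by (simp add: field_simps)
      qed
      finally have lnd: "ln (real (Q * N)) - ln (real (Q * n + 1)) \<le> 1 / (real j - 1)" .
      have "cmod (cis (t * ln (real (Q * n + 1))) - cis (t * ln (real (Q * N)))) \<le> \<bar>t * ln (real (Q * n + 1)) - t * ln (real (Q * N))\<bar>"
        by (rule norm_cis_diff_le)
      also have "\<dots> = \<bar>t\<bar> * \<bar>ln (real (Q * n + 1)) - ln (real (Q * N))\<bar>"
        by (simp only: abs_mult[symmetric] right_diff_distrib)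
      also have "\<dots> = \<bar>t\<bar> * (ln (real (Q * N)) - ln (real (Q * n + 1)))" using lnle by simp
      also have "\<dots> \<le> \<bar>t\<bar> * (1 / (real j - 1))" using lnd by (intro mult_left_mono) auto
      also have "\<dots> \<le> \<delta> / 2" using tj by simp
      finally have cisd: "cmod (cis (t * ln (real (Q * n + 1))) - cis (t * ln (real (Q * N)))) \<le> \<delta> / 2" .
      have "[Q * n + 1 = 0 + 1] (mod q)"
        using Q(3) by (intro cong_add cong_refl) (auto simp: cong_0_iff)
      then have "chi (Q * n + 1) = 1" using chi_cong chi_1 by fastforce
      then have tw: "tw (Q * n + 1) = cis (t * ln (real (Q * n + 1)))" by (simp add: tw_def)
      have CZ: "C * Z N = cis (t * ln (real (Q * N))) * exp (AQ Q N)"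
      proof -
        have "exp (AQ Q N) = exp (- \<kappa> Q) * exp (A N)"
          unfolding AQ_eq[OF Q(1) elim(2)] by (simp add: exp_add[symmetric])
        then show ?thesis
          using Npos Q by (simp add: C_def Z_def ln_mult distrib_left cis_mult[symmetric])
      qed
      have "cmod (f (Q * n + 1) - C * Z N) \<le> cmod (f (Q * n + 1) - tw (Q * n + 1) * exp (AQ Q N))
         + cmod (tw (Q * n + 1) * exp (AQ Q N) - C * Z N)"
        using norm_triangle_ineq[of "f (Q * n + 1) - tw (Q * n + 1) * exp (AQ Q N)" "tw (Q * n + 1) * exp (AQ Q N) - C * Z N"] by simp
      also have "tw (Q * n + 1) * exp (AQ Q N) - C * Z N = (cis (t * ln (real (Q * n + 1))) - cis (t * ln (real (Q * N)))) * exp (AQ Q N)"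
        unfolding CZ tw by (simp add: algebra_simps)
      also have "cmod \<dots> \<le> (\<delta> / 2) * 1"
        unfolding norm_mult by (intro mult_mono cisd norm_exp_AQ_le) (use \<delta> in auto)
      finally have "cmod (f (Q * n + 1) - C * Z N) \<le> \<delta>" using n(2) \<delta> by linarith
      then show ?case using npos by (intro exI[of _ n]) auto
    qed
  qed (use Q in auto)
qed

text \<open>C Z(N) is eventually always near some point of the finite set V, and by slow variation
  near a fixed one. As |C| is at least 1, dividing by C does not enlarge the error.\<close>

lemma finite_values_Z_convergent:
  assumes m: "m > 0" and V: "finite V" "\<And>n. n \<ge> 1 \<Longrightarrow> f (m * n + 1) \<in> V"
  shows "convergent Z"
proof -
  obtain s where s: "s > 0" "\<And>u v. u \<in> V \<Longrightarrow> v \<in> V \<Longrightarrow> u \<noteq> v \<Longrightarrow> cmod (u - v) \<ge> s"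
    using finite_separation[OF V(1)] by blast
  \<comment> \<open>The centre z depends on \<open>\<delta>\<close> through Q and C, so these
    estimates are used to show that Z is a Cauchy sequence.\<close>
  have near: "\<exists>z. eventually (\<lambda>N. cmod (Z N - z) \<le> \<delta>) sequentially" if \<delta>: "\<delta> > 0" "\<delta> < s / 3" for \<delta>
  proof -
    obtain Q C where Q: "Q > 0" "m dvd Q" "cmod C \<ge> 1"
      and ev: "eventually (\<lambda>N. \<exists>n\<ge>1. cmod (f (Q * n + 1) - C * Z N) \<le> \<delta>) sequentially"
      using value_near_Z[OF m \<delta>(1)] by blast
    obtain r where r: "Q = m * r" using Q(2) by (elim dvdE)
    have "\<exists>v\<in>V. eventually (\<lambda>N. cmod (C * Z N - v) \<le> \<delta>) sequentially"
    proof (rule slow_finite_cluster[OF _ \<delta>(1)])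
      show "(\<lambda>N. C * Z (Suc N) - C * Z N) \<longlonglongrightarrow> 0"
        using tendsto_mult_right_zero[OF Z_step, of C] by (simp add: right_diff_distrib)
      show "cmod (u - v) > 3 * \<delta>" if "u \<in> V" "v \<in> V" "u \<noteq> v" for u v
        using s(2)[OF that] \<delta>(2) by linarith
      show "eventually (\<lambda>N. \<exists>v\<in>V. cmod (C * Z N - v) \<le> \<delta>) sequentially"
        using ev
      proof eventually_elim
        case (elim N)
        then obtain n where n: "n \<ge> 1" "cmod (f (Q * n + 1) - C * Z N) \<le> \<delta>" by blast
        have "f (m * (r * n) + 1) \<in> V" using n(1) Q(1) r by (intro V(2)) (auto simp: Suc_le_eq)
        then have "f (Q * n + 1) \<in> V" by (simp add: r mult.assoc)
        then show ?case using n(2) by (auto simp: norm_minus_commute)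
      qed
    qed
    then obtain v where "eventually (\<lambda>N. cmod (C * Z N - v) \<le> \<delta>) sequentially" by blast
    then have "eventually (\<lambda>N. cmod (Z N - v / C) \<le> \<delta>) sequentially"
    proof eventually_elim
      case (elim N)
      have "C \<noteq> 0" using Q(3) by auto
      then have "Z N - v / C = (C * Z N - v) / C" by (simp add: field_simps)
      then have "cmod (Z N - v / C) = cmod (C * Z N - v) / cmod C" by (simp add: norm_divide)
      also have "\<dots> \<le> cmod (C * Z N - v) / 1" using Q(3) by (intro divide_left_mono) auto
      finally show ?case using elim by simp
    qed
    then show ?thesis by blast
  qed
  have "Cauchy Z"
  proof (rule metric_CauchyI)
    fix e :: real assume "e > 0"
    define \<delta> where "\<delta> = min (e / 3) (s / 4)"
    have \<delta>: "\<delta> > 0" "\<delta> < s / 3" "2 * \<delta> < e" using \<open>e > 0\<close> s(1) by (auto simp: \<delta>_def)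
    obtain z N0 where z: "\<And>N. N \<ge> N0 \<Longrightarrow> cmod (Z N - z) \<le> \<delta>"
      using near[OF \<delta>(1,2)] by (auto simp: eventually_sequentially)
    show "\<exists>M. \<forall>m\<ge>M. \<forall>n\<ge>M. dist (Z m) (Z n) < e"
    proof (intro exI[of _ N0] allI impI)
      fix m n assume "N0 \<le> m" "N0 \<le> n"
      then have "cmod (Z m - Z n) \<le> 2 * \<delta>"
        using z[of m] z[of n] norm_triangle_ineq4[of "Z m - z" "Z n - z"] by simp
      then show "dist (Z m) (Z n) < e" using \<delta>(3) by (simp add: dist_norm)
    qed
  qed
  then show ?thesis by (simp add: Cauchy_convergent_iff)
qed

section \<open>The periodic model built from smooth parts\<close>

definition small_primes :: "nat \<Rightarrow> nat set" where "small_primes w = {p. prime p \<and> p \<le> w}"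

definition smooth_part :: "nat \<Rightarrow> nat \<Rightarrow> nat" where
  "smooth_part w n = (\<Prod>p\<in>small_primes w. p ^ multiplicity p n)"

text \<open>The periodic model: G(n) n^(it) exp (A N) approximates f(n) for most n < N. Only the
  w-smooth part of n is evaluated by f; the cofactor is replaced by its character value, its primes
  above w being accounted for by exp (A N) together with the factor that removes the small primes.
  The value 0 at multiples of high powers of small primes makes G periodic.\<close>

definition G :: "nat \<Rightarrow> nat \<Rightarrow> nat \<Rightarrow> complex" where
  "G w K n = (if \<exists>p\<in>small_primes w. p ^ K dvd n then 0
     else f (smooth_part w n) * cis (- (t * ln (real (smooth_part w n)))) * chi (n div smooth_part w n)
       * exp (- \<kappa> (\<Prod>(small_primes w))))"

text \<open>Dividing by a smooth part with exponents below K leaves a modulus that still contains q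
  and every small prime.\<close>

definition period :: "nat \<Rightarrow> nat \<Rightarrow> nat" where
  "period w K = q * (\<Prod>p\<in>small_primes w. p ^ (K + 1))"

lemma finite_small_primes [simp]: "finite (small_primes w)"
  by (rule finite_subset[of _ "{..w}"]) (auto simp: small_primes_def)

lemma small_primes_prime: "p \<in> small_primes w \<Longrightarrow> prime p"
  by (simp add: small_primes_def)

lemma small_primes_gt_0: "p \<in> small_primes w \<Longrightarrow> p > 0"
  by (simp add: small_primes_def prime_gt_0_nat)

lemma period_pos: "period w K > 0"
  using q_pos by (auto simp: period_def intro!: prod_pos small_primes_gt_0)

lemma smooth_part_pos: "smooth_part w n > 0"
  by (auto simp: smooth_part_def intro!: prod_pos small_primes_gt_0)

lemma power_dvd_period: "p \<in> small_primes w \<Longrightarrow> p ^ (K + 1) dvd period w K"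
  unfolding period_def by (intro dvd_mult dvd_prodI) auto

lemma prime_factors_prod_primes:
  assumes "finite P" "\<And>p. p \<in> P \<Longrightarrow> prime (p :: nat)"
  shows "prime_factors (\<Prod>P) = P"
proof -
  have "\<Prod>P > 0" using assms by (auto intro!: prod_pos prime_gt_0_nat)
  then have "prime_factors (\<Prod>P) = {p. prime p \<and> p dvd \<Prod>P}" by (intro prime_factors_dvd) simp
  also have "\<dots> = P"
    using assms primes_dvd_imp_eq by (auto simp: prime_dvd_prod_iff) blast
  finally show ?thesis .
qed

lemma smooth_part_dvd:
  assumes "n > 0"
  shows "smooth_part w n dvd n"
proof -
  have "[n = 0] (mod (\<Prod>p\<in>small_primes w. p ^ multiplicity p n))"
    by (rule coprime_cong_prod_nat) (auto simp: cong_0_iff multiplicity_dvd small_primes_def intro!: primes_coprime)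
  then show ?thesis by (simp add: smooth_part_def cong_0_iff)
qed

context
  fixes w K c :: nat
  assumes wq: "q \<le> w" and c: "c > 0" and nd: "\<And>p. p \<in> small_primes w \<Longrightarrow> \<not> p ^ K dvd c"
begin

lemma mult_less: "p \<in> small_primes w \<Longrightarrow> multiplicity p c < K"
  using nd multiplicity_dvd' by (metis not_le)

lemma multiplicity_ap:
  assumes "p \<in> small_primes w"
  shows "multiplicity p (period w K * m + c) = multiplicity p c"
proof (rule multiplicity_eqI)
  have le: "Suc (multiplicity p c) \<le> K + 1" using mult_less[OF assms] by simp
  have d: "p ^ Suc (multiplicity p c) dvd period w K * m"
    using power_dvd_period[OF assms] le_imp_power_dvd[OF le] dvd_trans dvd_mult2 by blast
  then have d': "p ^ multiplicity p c dvd period w K * m"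
    by (metis dvd_trans le_imp_power_dvd le_SucI order_refl)
  show "p ^ multiplicity p c dvd period w K * m + c"
    using d' by (intro dvd_add) (auto simp: multiplicity_dvd)
  have "\<not> p ^ Suc (multiplicity p c) dvd c"
    using c assms by (subst power_dvd_iff_le_multiplicity) (auto dest: small_primes_prime)
  then show "\<not> p ^ Suc (multiplicity p c) dvd period w K * m + c"
    using d dvd_add_right_iff by blast
qed

lemma smooth_part_ap: "smooth_part w (period w K * m + c) = smooth_part w c"
  unfolding smooth_part_def by (intro prod.cong refl) (simp add: multiplicity_ap)

lemma period_factor:
  obtains r where "period w K = smooth_part w c * (q * \<Prod>(small_primes w) * r)"
proof -
  have "smooth_part w c * \<Prod>(small_primes w) dvd (\<Prod>p\<in>small_primes w. p ^ (K + 1))"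
    unfolding smooth_part_def prod.distrib[symmetric]
  proof (rule prod_dvd_prod)
    fix p assume "p \<in> small_primes w"
    then have "Suc (multiplicity p c) \<le> K + 1" using mult_less[of p] by simp
    then have "p ^ Suc (multiplicity p c) dvd p ^ (K + 1)" by (rule le_imp_power_dvd)
    then show "p ^ multiplicity p c * p dvd p ^ (K + 1)" by (simp add: mult.commute)
  qed
  then obtain r where "(\<Prod>p\<in>small_primes w. p ^ (K + 1)) = smooth_part w c * \<Prod>(small_primes w) * r"
    by (elim dvdE)
  then have "period w K = smooth_part w c * (q * \<Prod>(small_primes w) * r)"
    by (simp add: period_def mult_ac)
  then show ?thesis by (rule that)
qed

text \<open>Dividing the class of c by its smooth part a turns it into a reduced class, and the
  prime factors of the new modulus are exactly the primes up to w. This is the kind of progression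
  in which concentration is available. The assumption q <= w puts the primes of q among the small
  ones.\<close>

lemma reduced_residue:
  defines "a \<equiv> smooth_part w c"
  shows "a dvd period w K" "q dvd period w K div a" "prime_factors (period w K div a) = small_primes w"
    "coprime (c div a) (period w K div a)" "c div a > 0"
proof -
  obtain r where r: "period w K = a * (q * \<Prod>(small_primes w) * r)"
    using period_factor unfolding a_def by blast
  have a0: "a > 0" by (simp add: a_def smooth_part_pos)
  have ac: "a dvd c" unfolding a_def by (rule smooth_part_dvd[OF c])
  show "a dvd period w K" using r by simp
  have Q': "period w K div a = q * \<Prod>(small_primes w) * r" using r a0 by simp
  then show "q dvd period w K div a" by simp
  have Q'0: "period w K div a > 0" using period_pos[of w K] r a0 by (intro Nat.gr0I) auto
  have sub: "p \<in> small_primes w" if pp: "prime p" "p dvd period w K div a" for p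
  proof -
    have "p dvd period w K" using that(2) \<open>a dvd period w K\<close> by (metis dvd_div_mult_self dvd_mult2)
    then have "p dvd q \<or> p dvd (\<Prod>p\<in>small_primes w. p ^ (K + 1))"
      using prime_dvd_multD[OF that(1), of q "\<Prod>p\<in>small_primes w. p ^ (K + 1)"] unfolding period_def by blast
    then consider "p dvd q" | "p dvd (\<Prod>p\<in>small_primes w. p ^ (K + 1))" by blast
    then show ?thesis
    proof cases
      case 1
      then show ?thesis using that(1) wq q_pos dvd_imp_le[of p q] by (auto simp: small_primes_def)
    next
      case 2
      then have "\<exists>p'\<in>small_primes w. p dvd p' ^ (K + 1)"
        by (subst (asm) prime_dvd_prod_iff[OF finite_small_primes pp(1)])
      then obtain p' where p': "p' \<in> small_primes w" "p dvd p' ^ (K + 1)" by blast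
      have "p dvd p'" by (rule prime_dvd_power[OF pp(1) p'(2)])
      then have "p = p'" by (rule primes_dvd_imp_eq[OF pp(1) small_primes_prime[OF p'(1)]])
      then show ?thesis using p'(1) by simp
    qed
  qed
  have dv: "p dvd period w K div a" if "p \<in> small_primes w" for p
    unfolding Q' using that by (intro dvd_mult2 dvd_mult dvd_prodI) auto
  show "prime_factors (period w K div a) = small_primes w"
    using sub dv Q'0 by (auto simp: prime_factors_dvd dest: small_primes_prime)
  show "c div a > 0" using ac a0 c by (simp add: div_greater_zero_iff dvd_imp_le)
  show "coprime (c div a) (period w K div a)"
  proof (rule ccontr)
    assume "\<not> ?thesis"
    then obtain p where p: "prime p" "p dvd c div a" "p dvd period w K div a"
      using not_coprime_prime by blast
    have pw: "p \<in> small_primes w" by (rule sub[OF p(1,3)])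
    have "p ^ multiplicity p c dvd a"
      unfolding a_def smooth_part_def using pw by (intro dvd_prodI) auto
    then have "p ^ multiplicity p c * p dvd a * (c div a)" using p(2) by (rule mult_dvd_mono)
    then have "p ^ Suc (multiplicity p c) dvd c" using ac by (simp add: mult.commute)
    then have "Suc (multiplicity p c) \<le> multiplicity p c"
      using c p(1) by (subst (asm) power_dvd_iff_le_multiplicity) auto
    then show False by simp
  qed
qed

end

end

section \<open>Approximation by periodic sequences\<close>

context pretentious_to
begin

text \<open>Along the class of c the smooth part a is constant, and the cofactor is coprime to a
  because every prime of a divides the modulus of the cofactor's progression. Hence f
  factors.\<close>

lemma G_ap:
  assumes "q \<le> w" "c > 0" "\<And>p. p \<in> small_primes w \<Longrightarrow> \<not> p ^ K dvd c"
  shows "G w K (period w K * m + c) = f (smooth_part w c) * cis (- (t * ln (real (smooth_part w c))))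
      * chi (period w K div smooth_part w c * m + c div smooth_part w c) * exp (- \<kappa> (\<Prod>(small_primes w)))"
    "f (period w K * m + c) = f (smooth_part w c) * f (period w K div smooth_part w c * m + c div smooth_part w c)"
    "period w K * m + c = smooth_part w c * (period w K div smooth_part w c * m + c div smooth_part w c)"
proof -
  define a where "a = smooth_part w c"
  define x where "x = period w K div a * m + c div a"
  note red = reduced_residue[OF assms, folded a_def]
  have ac: "a dvd c" unfolding a_def by (rule smooth_part_dvd) fact
  have a0: "a > 0" by (simp add: a_def smooth_part_pos)
  have eq: "period w K * m + c = a * x"
    using red(1) ac by (simp add: x_def distrib_left mult.assoc[symmetric])
  then show "period w K * m + c = smooth_part w c * (period w K div smooth_part w c * m + c div smooth_part w c)"
    by (simp add: a_def x_def)
  have sm: "smooth_part w (period w K * m + c) = a"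
    unfolding a_def by (rule smooth_part_ap[OF assms])
  have nd: "\<not> p ^ K dvd period w K * m + c" if "p \<in> small_primes w" for p
  proof -
    have "p ^ K dvd period w K * m"
      using power_dvd_period[OF that, of K] by (metis dvd_mult2 dvd_trans le_imp_power_dvd le_add1)
    then show ?thesis using assms(3)[OF that] dvd_add_right_iff by blast
  qed
  have cop: "coprime x (period w K div a)"
    unfolding x_def by (rule coprime_ap[OF red(4)])
  have "coprime a x"
  proof (rule ccontr)
    assume "\<not> coprime a x"
    then obtain p where p: "prime p" "p dvd a" "p dvd x" using not_coprime_prime by blast
    have "\<exists>p'\<in>small_primes w. p dvd p' ^ multiplicity p' c"
      using p(2) unfolding a_def smooth_part_def by (subst (asm) prime_dvd_prod_iff[OF finite_small_primes p(1)])
    then obtain p' where p': "p' \<in> small_primes w" "p dvd p' ^ multiplicity p' c" by blast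
    have "p dvd p'" by (rule prime_dvd_power[OF p(1) p'(2)])
    then have "p = p'" by (rule primes_dvd_imp_eq[OF p(1) small_primes_prime[OF p'(1)]])
    then have "p \<in> small_primes w" using p'(1) by simp
    then have "p dvd period w K div a" using red(3) by auto
    then show False using cop p not_prime_unit coprime_common_divisor by blast
  qed
  moreover have "x > 0" using red(5) by (simp add: x_def)
  ultimately have "f (a * x) = f a * f x" using mult_class_mult[OF f _ a0] by simp
  then show "f (period w K * m + c) = f (smooth_part w c) * f (period w K div smooth_part w c * m + c div smooth_part w c)"
    unfolding eq by (simp add: a_def x_def)
  show "G w K (period w K * m + c) = f (smooth_part w c) * cis (- (t * ln (real (smooth_part w c))))
      * chi (period w K div smooth_part w c * m + c div smooth_part w c) * exp (- \<kappa> (\<Prod>(small_primes w)))"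
  proof -
    have "(period w K * m + c) div a = x" using a0 by (simp add: eq)
    then show ?thesis using nd unfolding G_def sm by (simp add: a_def x_def)
  qed
qed

lemma G_periodic:
  assumes "q \<le> w" "n > 0"
  shows "G w K (n + period w K) = G w K n"
proof (cases "\<exists>p\<in>small_primes w. p ^ K dvd n")
  case True
  then obtain p where p: "p \<in> small_primes w" "p ^ K dvd n" by blast
  have "p ^ K dvd period w K"
    using power_dvd_period[OF p(1), of K] by (metis dvd_trans le_imp_power_dvd le_add1)
  then have "p ^ K dvd n + period w K" using p(2) by simp
  then show ?thesis using p by (auto simp: G_def)
next
  case False
  then have nd: "\<And>p. p \<in> small_primes w \<Longrightarrow> \<not> p ^ K dvd n" by blast
  note red = reduced_residue[OF assms nd]
  have "chi (period w K div smooth_part w n * 1 + n div smooth_part w n) = chi (period w K div smooth_part w n * 0 + n div smooth_part w n)"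
    using red(2) by (intro chi_cong) (auto simp: cong_def elim!: dvdE)
  then show ?thesis using G_ap(1)[OF assms nd, of 1] G_ap(1)[OF assms nd, of 0] by (simp add: add.commute)
qed

text \<open>Multiples of some \<open>p ^ K\<close> with p <= w have density at most card
  (small_primes w) / 2^K and are discarded; K is chosen after w so that 2^K beats the number of
  small primes. The remaining n fall into finitely many classes modulo the period, each reducible to
  a reduced class, and slow variation replaces A at the scale of the class by A N.\<close>

lemma periodic_approximation:
  assumes \<epsilon>: "\<epsilon> > 0"
  obtains w0 where "w0 \<ge> q" "w0 \<ge> 2"
    "\<And>w. w \<ge> w0 \<Longrightarrow> \<exists>K0. \<forall>K\<ge>K0. eventually (\<lambda>N. (\<Sum>n\<in>{1..<N}. cmod (f n - G w K n * cis (t * ln (real n)) * exp (A N))) \<le> \<epsilon> * real N) sequentially"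
proof -
  obtain w1 where w1: "\<And>Q c. q dvd Q \<Longrightarrow> (\<And>p. prime p \<Longrightarrow> p \<le> w1 \<Longrightarrow> p dvd Q) \<Longrightarrow> c > 0 \<Longrightarrow> coprime c Q \<Longrightarrow>
    eventually (\<lambda>N. (\<Sum>n<N. cmod (f (Q * n + c) - tw (Q * n + c) * exp (AQ Q N))) \<le> \<epsilon> / 4 * real N) sequentially"
    using concentration_eventually[of "\<epsilon> / 4"] \<epsilon> by auto
  show ?thesis
  proof (rule that[of "max w1 (max q 2)"])
    fix w assume "max w1 (max q 2) \<le> w"
    then have w: "w1 \<le> w" "q \<le> w" "2 \<le> w" by auto
    have two: "2 \<in> small_primes w" using w by (simp add: small_primes_def)
    have "(\<lambda>K. real (card (small_primes w)) * (1 / 2) ^ K) \<longlonglongrightarrow> 0" by real_asymp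
    then have "eventually (\<lambda>K. real (card (small_primes w)) * (1 / 2) ^ K < \<epsilon> / 4) sequentially"
      by (rule order_tendstoD(2)) (use \<epsilon> in auto)
    then obtain K0 where K0: "\<And>K. K \<ge> K0 \<Longrightarrow> real (card (small_primes w)) * (1 / 2) ^ K < \<epsilon> / 4"
      by (auto simp: eventually_sequentially)
    show "\<exists>K0. \<forall>K\<ge>K0. eventually (\<lambda>N. (\<Sum>n\<in>{1..<N}. cmod (f n - G w K n * cis (t * ln (real n)) * exp (A N))) \<le> \<epsilon> * real N) sequentially"
    proof (intro exI[of _ K0] allI impI)
      fix K assume K: "K0 \<le> K"
      define Q where "Q = period w K"
      have Q0: "Q > 0" by (simp add: Q_def period_pos)
      have "2 ^ (K + 1) dvd Q" unfolding Q_def by (rule power_dvd_period[OF two])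
      then have "2 ^ (K + 1) \<le> Q" using Q0 by (rule dvd_imp_le)
      then have Q2: "Q \<ge> 2" by (metis add.commute one_le_numeral order_trans power_increasing power_one_right le_add1)
      define R where "R = {c. c < Q \<and> c > 0 \<and> (\<forall>p\<in>small_primes w. \<not> p ^ K dvd c)}"
      have finR: "finite R" by (rule finite_subset[of _ "{..<Q}"]) (auto simp: R_def)
      have cardR: "card R \<le> Q" using card_mono[of "{..<Q}" R] by (auto simp: R_def)
      define \<phi> where "\<phi> N n = cmod (f n - G w K n * cis (t * ln (real n)) * exp (A N))" for N n
      \<comment> \<open>One block more than fits below N, so that the blocks cover every n < N; the
        overshoot is at most a factor 2 once N is at least Q.\<close>
      define M where "M N = N div Q + 1" for N
      have Mlim: "filterlim M at_top sequentially"
        unfolding filterlim_at_top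
      proof
        fix B
        show "eventually (\<lambda>N. B \<le> M N) sequentially"
          using eventually_ge_at_top[of "B * Q"]
        proof eventually_elim
          case (elim N)
          have "B * Q div Q \<le> N div Q" using elim by (rule div_le_mono)
          then show ?case using Q0 by (simp add: M_def)
        qed
      qed
      \<comment> \<open>The fraction 3/8 is 1/4 from concentration plus 1/8 from replacing A (M N)
        by A N. The overshoot of the blocks doubles it to 3/4, and the discarded n use up the
        remaining 1/4.\<close>
      have res: "eventually (\<lambda>N. (\<Sum>m<M N. \<phi> N (Q * m + c)) \<le> \<epsilon> * 3 / 8 * real (M N)) sequentially" if "c \<in> R" for c
      proof -
        have c: "c > 0" "\<And>p. p \<in> small_primes w \<Longrightarrow> \<not> p ^ K dvd c" using that by (auto simp: R_def)
        define a where "a = smooth_part w c"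
        define Q' where "Q' = Q div a"
        define c' where "c' = c div a"
        note red = reduced_residue[OF w(2) c, folded a_def Q_def, folded Q'_def c'_def]
        note gap = G_ap[OF w(2) c, folded a_def Q_def, folded Q'_def c'_def]
        have a0: "a > 0" by (simp add: a_def smooth_part_pos)
        have Q'0: "Q' > 0" using Q0 red(1) a0 unfolding Q'_def by (simp add: div_greater_zero_iff dvd_imp_le)
        \<comment> \<open>The modulus Q' varies with the class but its set of primes does not, so
          one correcting factor serves all classes.\<close>
        have \<kappa>: "\<kappa> Q' = \<kappa> (\<Prod>(small_primes w))"
          unfolding \<kappa>_def using red(3) prime_factors_prod_primes[OF finite_small_primes small_primes_prime] by simp
        have "p dvd Q'" if "prime p" "p \<le> w1" for p
        proof -
          have "p \<in> prime_factors Q'" using that w(1) red(3) by (simp add: small_primes_def)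
          then show ?thesis by auto
        qed
        then have "eventually (\<lambda>N. (\<Sum>n<N. cmod (f (Q' * n + c') - tw (Q' * n + c') * exp (AQ Q' N))) \<le> \<epsilon> / 4 * real N) sequentially"
          using red by (intro w1) auto
        then have ev1: "eventually (\<lambda>N. (\<Sum>n<M N. cmod (f (Q' * n + c') - tw (Q' * n + c') * exp (AQ Q' (M N)))) \<le> \<epsilon> / 4 * real (M N)) sequentially"
          by (rule eventually_compose_filterlim[OF _ Mlim])
        obtain N0 where N0: "\<And>N M. N \<ge> N0 \<Longrightarrow> N \<le> M \<Longrightarrow> real M \<le> real Q * real N \<Longrightarrow> cmod (A M - A N) \<le> \<epsilon> / 8"
          using A_slow[of "\<epsilon> / 8" "real Q"] \<epsilon> Q2 by auto
        have ev2: "eventually (\<lambda>N. max N0 (Q' * Q') \<le> M N) sequentially"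
          using Mlim unfolding filterlim_at_top by blast
        show ?thesis
          using ev1 ev2 eventually_ge_at_top[of 2]
        proof eventually_elim
          case (elim N)
          have "N div Q \<le> N div 2" using Q2 by (rule div_le_mono2[rotated]) simp
          then have MN: "M N \<le> N" using elim(3) by (simp add: M_def)
          have "N \<le> Q * M N" unfolding M_def using Q0
            by (metis Suc_eq_plus1 dividend_less_times_div less_imp_le mult_Suc_right add.commute)
          then have "real N \<le> real (Q * M N)" by (simp only: of_nat_le_iff)
          then have AA: "cmod (A N - A (M N)) \<le> \<epsilon> / 8" using elim(2) MN by (intro N0) auto
          have AQ: "AQ Q' (M N) = A (M N) - \<kappa> Q'" using elim(2) Q'0 by (intro AQ_eq) auto
          have "Re (A N - \<kappa> Q') \<le> 0"
          proof -
            have "AQ Q' N = A N - \<kappa> Q'" using elim(2) MN Q'0 by (intro AQ_eq) auto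
            then show ?thesis using Re_AQ_le[of Q' N] by simp
          qed
          then have EE: "cmod (exp (AQ Q' (M N)) - exp (A N - \<kappa> Q')) \<le> \<epsilon> / 8"
            using exp_lipschitz_left_halfplane[of "AQ Q' (M N)" "A N - \<kappa> Q'"] Re_AQ_le[of Q' "M N"] AA
            by (simp add: AQ norm_minus_commute)
          have "\<phi> N (Q * m + c) \<le> cmod (f (Q' * m + c') - tw (Q' * m + c') * exp (AQ Q' (M N))) + \<epsilon> / 8" for m
          proof -
            define x where "x = Q' * m + c'"
            have x0: "x > 0" using red(5) by (simp add: x_def)
            have ln: "ln (real (Q * m + c)) = ln (real a) + ln (real x)"
              using gap(3)[of m] a0 x0 by (simp add: x_def[symmetric] ln_mult)
            have cc: "cis (- (t * ln (real a))) * cis (t * (ln (real a) + ln (real x))) = cis (t * ln (real x))"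
              by (simp add: cis_mult distrib_left)
            have Geq: "G w K (Q * m + c) * cis (t * ln (real (Q * m + c))) * exp (A N)
              = f a * (tw x * exp (A N - \<kappa> Q'))"
            proof -
              have "exp (A N - \<kappa> Q') = exp (- \<kappa> Q') * exp (A N)" by (simp add: exp_add[symmetric])
              moreover have "G w K (Q * m + c) = f a * cis (- (t * ln (real a))) * chi x * exp (- \<kappa> Q')"
                unfolding \<kappa> x_def by (rule gap(1))
              ultimately show ?thesis
                unfolding ln tw_def cc[symmetric] by (simp only: mult_ac)
            qed
            have fx: "f (Q * m + c) = f a * f x" unfolding x_def by (rule gap(2))
            have "\<phi> N (Q * m + c) = cmod (f a * (f x - tw x * exp (A N - \<kappa> Q')))"
              unfolding \<phi>_def Geq fx by (simp add: right_diff_distrib)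
            also have "\<dots> \<le> 1 * cmod (f x - tw x * exp (A N - \<kappa> Q'))"
              unfolding norm_mult by (intro mult_right_mono norm_f) auto
            also have "f x - tw x * exp (A N - \<kappa> Q') = (f x - tw x * exp (AQ Q' (M N))) + tw x * (exp (AQ Q' (M N)) - exp (A N - \<kappa> Q'))"
              by (simp add: algebra_simps)
            also have "1 * cmod \<dots> \<le> cmod (f x - tw x * exp (AQ Q' (M N))) + cmod (tw x * (exp (AQ Q' (M N)) - exp (A N - \<kappa> Q')))"
              by (simp add: norm_triangle_ineq)
            also have "cmod (tw x * (exp (AQ Q' (M N)) - exp (A N - \<kappa> Q'))) \<le> 1 * (\<epsilon> / 8)"
              unfolding norm_mult by (intro mult_mono norm_tw_le EE) auto
            finally show ?thesis by (simp add: x_def)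
          qed
          then have "(\<Sum>m<M N. \<phi> N (Q * m + c)) \<le> (\<Sum>m<M N. cmod (f (Q' * m + c') - tw (Q' * m + c') * exp (AQ Q' (M N))) + \<epsilon> / 8)"
            by (intro sum_mono)
          also have "\<dots> = (\<Sum>m<M N. cmod (f (Q' * m + c') - tw (Q' * m + c') * exp (AQ Q' (M N)))) + real (M N) * (\<epsilon> / 8)"
            by (simp add: sum.distrib)
          also have "\<dots> \<le> \<epsilon> * 3 / 8 * real (M N)" using elim(1) by (simp add: field_simps)
          finally show ?case .
        qed
      qed
      have all: "eventually (\<lambda>N. \<forall>c\<in>R. (\<Sum>m<M N. \<phi> N (Q * m + c)) \<le> \<epsilon> * 3 / 8 * real (M N)) sequentially"
        using res by (intro eventually_ball_finite finR) auto
      have "eventually (\<lambda>N. (\<Sum>n\<in>{1..<N}. \<phi> N n) \<le> \<epsilon> * real N) sequentially"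
        using all eventually_ge_at_top[of Q]
      proof eventually_elim
        case (elim N)
        define Bd where "Bd = {n\<in>{1..<N}. \<exists>p\<in>small_primes w. p ^ K dvd n}"
        define Gd where "Gd = {n\<in>{1..<N}. \<not> (\<exists>p\<in>small_primes w. p ^ K dvd n)}"
        have "(\<Sum>n\<in>{1..<N}. \<phi> N n) = (\<Sum>n\<in>Bd. \<phi> N n) + (\<Sum>n\<in>Gd. \<phi> N n)"
          by (subst sum.union_disjoint[symmetric]) (auto simp: Bd_def Gd_def intro!: sum.cong)
        also have "(\<Sum>n\<in>Bd. \<phi> N n) \<le> \<epsilon> / 4 * real N"
        proof -
          have "(\<Sum>n\<in>Bd. \<phi> N n) \<le> (\<Sum>n\<in>Bd. 1)"
            using norm_f by (intro sum_mono) (auto simp: Bd_def \<phi>_def G_def)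
          also have "\<dots> = real (card Bd)" by simp
          also have "card Bd \<le> card (\<Union>p\<in>small_primes w. {n\<in>{1..<N}. p ^ K dvd n})"
            by (intro card_mono) (auto simp: Bd_def)
          also have "\<dots> \<le> (\<Sum>p\<in>small_primes w. card {n\<in>{1..<N}. p ^ K dvd n})"
            by (intro card_UN_le finite_small_primes)
          also have "real (\<Sum>p\<in>small_primes w. card {n\<in>{1..<N}. p ^ K dvd n}) \<le> (\<Sum>p\<in>small_primes w. real N * (1 / 2) ^ K)"
            unfolding of_nat_sum
          proof (intro sum_mono)
            fix p assume p: "p \<in> small_primes w"
            then have p2: "p \<ge> 2" by (auto simp: small_primes_def prime_ge_2_nat)
            have "{n\<in>{1..<N}. p ^ K dvd n} \<subseteq> (\<lambda>i. p ^ K * i) ` {1..N div p ^ K}"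
            proof
              fix n assume n: "n \<in> {n\<in>{1..<N}. p ^ K dvd n}"
              then obtain i where i: "n = p ^ K * i" by (auto elim: dvdE)
              have "i \<ge> 1" using n i by (cases i) auto
              moreover have "p ^ K * i div p ^ K \<le> N div p ^ K" using n i by (intro div_le_mono) auto
              then have "i \<le> N div p ^ K" using p2 by simp
              ultimately show "n \<in> (\<lambda>i. p ^ K * i) ` {1..N div p ^ K}" using i by auto
            qed
            then have "card {n\<in>{1..<N}. p ^ K dvd n} \<le> card ((\<lambda>i. p ^ K * i) ` {1..N div p ^ K})"
              by (intro card_mono) auto
            also have "\<dots> \<le> N div p ^ K" using card_image_le[of "{1..N div p ^ K}" "\<lambda>i. p ^ K * i"] by simp
            finally have "real (card {n\<in>{1..<N}. p ^ K dvd n}) \<le> real (N div p ^ K)" by simp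
            also have "\<dots> \<le> real N / real (p ^ K)" by (rule of_nat_div_le_of_nat)
            also have "\<dots> \<le> real N / 2 ^ K"
            proof (rule divide_left_mono)
              show "2 ^ K \<le> real (p ^ K)" using p2 by (simp add: power_mono)
            qed (use p2 in auto)
            finally show "real (card {n\<in>{1..<N}. p ^ K dvd n}) \<le> real N * (1 / 2) ^ K"
              by (simp add: power_divide)
          qed
          also have "\<dots> = (real (card (small_primes w)) * (1 / 2) ^ K) * real N" by simp
          also have "\<dots> \<le> \<epsilon> / 4 * real N" using K0[OF K] by (intro mult_right_mono) auto
          finally show ?thesis by simp
        qed
        also have "(\<Sum>n\<in>Gd. \<phi> N n) \<le> \<epsilon> * 3 / 4 * real N"
        proof -
          have "Gd \<subseteq> (\<lambda>(c, m). Q * m + c) ` (R \<times> {..<M N})"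
          proof
            fix n assume n: "n \<in> Gd"
            have "n mod Q \<in> R"
            proof -
              have nd: "\<not> p ^ K dvd n mod Q" if "p \<in> small_primes w" for p
              proof -
                have "p ^ K dvd Q"
                  using power_dvd_period[OF that, of K] unfolding Q_def by (metis dvd_trans le_imp_power_dvd le_add1)
                then show ?thesis using n that by (simp add: Gd_def dvd_mod_iff)
              qed
              have "n mod Q > 0" using nd[OF two] by (intro Nat.gr0I) auto
              then show ?thesis using nd Q0 by (auto simp: R_def)
            qed
            moreover have "n div Q < M N"
            proof -
              have "n div Q \<le> N div Q" using n by (intro div_le_mono) (auto simp: Gd_def)
              then show ?thesis by (simp add: M_def)
            qed
            ultimately show "n \<in> (\<lambda>(c, m). Q * m + c) ` (R \<times> {..<M N})"
              by (intro image_eqI[of _ _ "(n mod Q, n div Q)"]) auto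
          qed
          moreover have inj: "inj_on (\<lambda>(c, m). Q * m + c) (R \<times> {..<M N})"
          proof (rule inj_onI, clarify)
            fix c m c' m' assume "c \<in> R" "c' \<in> R" and eq: "Q * m + c = Q * m' + c'"
            then have "c < Q" "c' < Q" by (auto simp: R_def)
            then have "(Q * m + c) mod Q = c" "(Q * m' + c') mod Q = c'" by auto
            then have "c = c'" using eq by simp
            then show "c = c' \<and> m = m'" using eq Q0 by simp
          qed
          ultimately have "(\<Sum>n\<in>Gd. \<phi> N n) \<le> (\<Sum>n\<in>(\<lambda>(c, m). Q * m + c) ` (R \<times> {..<M N}). \<phi> N n)"
            using finR by (intro sum_mono2) (auto simp: \<phi>_def)
          also have "\<dots> = (\<Sum>c\<in>R. \<Sum>m<M N. \<phi> N (Q * m + c))"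
            by (subst sum.reindex[OF inj]) (simp add: sum.cartesian_product case_prod_beta)
          also have "\<dots> \<le> (\<Sum>c\<in>R. \<epsilon> * 3 / 8 * real (M N))"
            using elim(1) by (intro sum_mono) auto
          also have "\<dots> = \<epsilon> * 3 / 8 * (real (card R) * real (M N))" by simp
          also have "\<dots> \<le> \<epsilon> * 3 / 8 * (2 * real N)"
          proof (rule mult_left_mono)
            have "card R * M N \<le> Q * (N div Q + 1)" unfolding M_def by (intro mult_right_mono cardR) auto
            also have "\<dots> = Q * (N div Q) + Q" by simp
            also have "\<dots> \<le> N + N" using elim(2) by (intro add_mono times_div_less_eq_dividend) auto
            finally have "real (card R * M N) \<le> real (N + N)" by (simp only: of_nat_le_iff)
            then show "real (card R) * real (M N) \<le> 2 * real N" by simp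
          qed (use \<epsilon> in auto)
          finally show ?thesis by simp
        qed
        finally show ?case by (simp add: algebra_simps)
      qed
      then show "eventually (\<lambda>N. (\<Sum>n\<in>{1..<N}. cmod (f n - G w K n * cis (t * ln (real n)) * exp (A N))) \<le> \<epsilon> * real N) sequentially"
        by (simp add: \<phi>_def)
    qed
  qed auto
qed

text \<open>With t = 0 the approximation G(n) exp (A N) depends on N only through exp (A N).
  Replacing this factor by its limit leaves a periodic sequence.\<close>

lemma rap_if_convergent:
  assumes t0: "t = 0" and conv: "convergent (\<lambda>N. exp (A N))"
  shows "rap f"
  unfolding rap_def
proof (intro allI impI)
  fix \<epsilon> :: real assume \<epsilon>: "\<epsilon> > 0"
  obtain E where E: "(\<lambda>N. exp (A N)) \<longlonglongrightarrow> E" using conv by (auto simp: convergent_def)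
  obtain w0 where w0: "w0 \<ge> q" "\<And>w. w \<ge> w0 \<Longrightarrow> \<exists>K0. \<forall>K\<ge>K0. eventually (\<lambda>N. (\<Sum>n\<in>{1..<N}. cmod (f n - G w K n * cis (t * ln (real n)) * exp (A N))) \<le> \<epsilon> / 4 * real N) sequentially"
    using periodic_approximation[of "\<epsilon> / 4" thesis] \<epsilon> by fastforce
  obtain K where K: "eventually (\<lambda>N. (\<Sum>n\<in>{1..<N}. cmod (f n - G w0 K n * cis (t * ln (real n)) * exp (A N))) \<le> \<epsilon> / 4 * real N) sequentially"
    using w0(2)[of w0] by blast
  define g where "g n = G w0 K n * E" for n
  have per: "periodic_seq g"
    unfolding periodic_seq_def
  proof (intro exI[of _ "period w0 K"] conjI allI impI)
    show "period w0 K \<ge> 1" using period_pos[of w0 K] by simp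
    show "g (n + period w0 K) = g n" if "n \<ge> 1" for n
      using G_periodic[OF w0(1), of n K] that by (simp add: g_def)
  qed
  define c where "c = cmod (exp (- \<kappa> (\<Prod>(small_primes w0))))"
  have c0: "c > 0" by (simp add: c_def)
  have Gb: "cmod (G w0 K n) \<le> c" for n
  proof -
    have "cmod (f m) * cmod (chi n) * c \<le> 1 * 1 * c" for m n
      using c0 by (intro mult_mono norm_f norm_chi_le) auto
    then show ?thesis using c0 by (simp add: G_def norm_mult c_def)
  qed
  have "eventually (\<lambda>N. dist (exp (A N)) E < \<epsilon> / (4 * c)) sequentially"
    by (rule tendstoD[OF E]) (use \<epsilon> c0 in auto)
  with K have "eventually (\<lambda>N. ereal (1 / real N * (\<Sum>n\<in>{1..<N}. cmod (f n - g n))) \<le> ereal (\<epsilon> / 2)) sequentially"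
    using eventually_gt_at_top[of 0]
  proof eventually_elim
    case (elim N)
    have "(\<Sum>n\<in>{1..<N}. cmod (f n - g n)) \<le> (\<Sum>n\<in>{1..<N}. cmod (f n - G w0 K n * cis (t * ln (real n)) * exp (A N)) + \<epsilon> / 4)"
    proof (rule sum_mono)
      fix n
      have "f n - g n = (f n - G w0 K n * cis (t * ln (real n)) * exp (A N)) + G w0 K n * (exp (A N) - E)"
        using t0 by (simp add: g_def algebra_simps)
      then have "cmod (f n - g n) \<le> cmod (f n - G w0 K n * cis (t * ln (real n)) * exp (A N)) + cmod (G w0 K n * (exp (A N) - E))"
        by (simp only: norm_triangle_ineq)
      also have "cmod (G w0 K n * (exp (A N) - E)) \<le> c * (\<epsilon> / (4 * c))"
        unfolding norm_mult using elim(2) c0 by (intro mult_mono Gb) (auto simp: dist_norm)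
      finally show "cmod (f n - g n) \<le> cmod (f n - G w0 K n * cis (t * ln (real n)) * exp (A N)) + \<epsilon> / 4"
        using c0 by simp
    qed
    also have "\<dots> = (\<Sum>n\<in>{1..<N}. cmod (f n - G w0 K n * cis (t * ln (real n)) * exp (A N))) + real (N - 1) * (\<epsilon> / 4)"
      by (simp add: sum.distrib)
    also have "\<dots> \<le> \<epsilon> / 4 * real N + real N * (\<epsilon> / 4)"
      using elim(1) \<epsilon> by (intro add_mono mult_right_mono) auto
    finally show ?case using elim(3) by (simp add: field_simps)
  qed
  then have "limsup (\<lambda>N. ereal (1 / real N * (\<Sum>n\<in>{1..<N}. cmod (f n - g n)))) \<le> ereal (\<epsilon> / 2)"
    by (rule Limsup_bounded)
  also have "\<dots> < ereal \<epsilon>" using \<epsilon> by simp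
  finally show "\<exists>g. periodic_seq g \<and> limsup (\<lambda>N. ereal (1 / real N * (\<Sum>n\<in>{1..<N}. cmod (f n - g n)))) < ereal \<epsilon>"
    using per by blast
qed

end

section \<open>Toeplitz and automatic functions\<close>

text \<open>If \<open>r ^ k\<close> is the largest power of r below x, then x =
  \<open>r ^ k * i + j\<close> with a leading digit i < r, so f x is the value at i of one of
  finitely many kernel sequences. The bound x >= r guarantees k >= 1.\<close>

lemma automatic_base_finite_values:
  assumes "automatic_base r f" "r \<ge> 2"
  obtains V where "finite V" "\<And>x. x \<ge> r \<Longrightarrow> f x \<in> V"
proof
  define Ker where "Ker = {restrict (\<lambda>n. f (r ^ k * n + j)) {1..} | k j. k \<ge> 1 \<and> j < r ^ k}"
  have "finite Ker" using assms(1) unfolding automatic_base_def Ker_def .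
  then show "finite ((\<lambda>(\<phi>, i). \<phi> i) ` (Ker \<times> {1..<r}))" by simp
  fix x assume x: "x \<ge> r"
  obtain k where k: "r ^ k \<le> x" "x < r ^ (k + 1)" using ex_power_ivl1[OF assms(2), of x] x assms(2) by auto
  have "k \<noteq> 0" using k(2) x by (intro notI) auto
  have r0: "r ^ k > 0" using assms(2) by simp
  define i where "i = x div r ^ k"
  define j where "j = x mod r ^ k"
  have "j < r ^ k" using r0 by (simp add: j_def)
  then have "restrict (\<lambda>n. f (r ^ k * n + j)) {1..} \<in> Ker" using \<open>k \<noteq> 0\<close> unfolding Ker_def by (auto simp: Suc_le_eq)
  moreover have "i \<ge> 1" unfolding i_def using k(1) r0 by (simp add: Suc_le_eq div_greater_zero_iff)
  moreover have "i < r" unfolding i_def using k(2) r0 by (simp add: less_mult_imp_div_less mult.commute)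
  moreover have "x = r ^ k * i + j" by (simp add: i_def j_def)
  ultimately show "f x \<in> (\<lambda>(\<phi>, i). \<phi> i) ` (Ker \<times> {1..<r})"
    by (intro image_eqI[of _ _ "(restrict (\<lambda>n. f (r ^ k * n + j)) {1..}, i)"]) auto
qed

text \<open>Pigeonhole among the kernel sequences with j = 1, which is admissible for every k >= 1
  as r^k > 1.\<close>

lemma automatic_base_coincidence:
  assumes "automatic_base r f" "r \<ge> 2"
  obtains k l where "k \<ge> 1" "k < l" "\<And>n. n \<ge> 1 \<Longrightarrow> f (r ^ k * n + 1) = f (r ^ l * n + 1)"
proof -
  define F where "F k = restrict (\<lambda>n. f (r ^ k * n + 1)) {1..}" for k
  have "1 < r ^ k" if "k \<ge> 1" for k using assms(2) that by (intro one_less_power) auto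
  then have "F ` {1..} \<subseteq> {restrict (\<lambda>n. f (r ^ k * n + j)) {1..} | k j. k \<ge> 1 \<and> j < r ^ k}"
    unfolding F_def by blast
  then have "finite (F ` {1..})" using assms(1) finite_subset unfolding automatic_base_def by blast
  then have "\<not> inj_on F {1..}" using finite_imageD infinite_Ici by blast
  then obtain k l where kl: "k \<ge> 1" "l \<ge> 1" "k \<noteq> l" "F k = F l" by (auto simp: inj_on_def)
  have eq: "f (r ^ k * n + 1) = f (r ^ l * n + 1)" if "n \<ge> 1" for n
    using fun_cong[OF kl(4), of n] that by (simp add: F_def)
  show ?thesis
  proof (cases "k < l")
    case True
    then show ?thesis using kl eq that[of k l] by blast
  next
    case False
    then show ?thesis using kl eq that[of l k] by simp
  qed
qed

context pretentious_to
begin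

lemma rap_if_Z_convergent:
  assumes "convergent Z"
  shows "t = 0" "rap f"
proof -
  have c: "convergent (\<lambda>N. Z N ^ 1)" using assms by simp
  show t0: "t = 0" by (rule Z_power_convergent(1)[OF _ c]) simp
  show "rap f" by (rule rap_if_convergent[OF t0 Z_power_convergent(2)[OF _ c]]) simp
qed

text \<open>The Toeplitz property at 1 makes f constant on a progression m n + 1, so the criterion
  for finitely many values applies.\<close>

lemma toeplitz_imp_rap:
  assumes "toeplitz f"
  shows "rap f"
proof -
  have "\<exists>m\<ge>1. \<forall>n'\<ge>1. [n' = 1] (mod m) \<longrightarrow> f n' = f 1" using assms unfolding toeplitz_def by simp
  then obtain m where m: "m \<ge> 1" "\<And>n'. n' \<ge> 1 \<Longrightarrow> [n' = 1] (mod m) \<Longrightarrow> f n' = f 1" by blast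
  have "convergent Z"
  proof (rule finite_values_Z_convergent[of m "{1}"])
    show "f (m * n + 1) \<in> {1}" for n
    proof -
      have "[m * n + 1 = 0 + 1] (mod m)" by (intro cong_add cong_refl) (simp add: cong_0_iff)
      then show ?thesis using m(2)[of "m * n + 1"] f1 by simp
    qed
  qed (use m in auto)
  then show ?thesis by (rule rap_if_Z_convergent)
qed

text \<open>
  A coincidence \<open>f (a n + 1) = f (b n + 1)\<close> makes the value at a prime power visible: for suitable
  \<open>n\<close> the number \<open>a n + 1\<close> is \<open>p ^ e\<close> times a typical number, while \<open>b n + 1\<close> is typical.
\<close>

lemma coincidence_prime_power:
  fixes a b :: nat
  assumes t0: "t = 0" and ab: "0 < a" "a < b" and co: "\<And>n. n \<ge> 1 \<Longrightarrow> f (a * n + 1) = f (b * n + 1)"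
    and \<epsilon>: "\<epsilon> > 0"
  obtains w where "\<And>p e. prime p \<Longrightarrow> p > w \<Longrightarrow> cmod (f (p ^ e) - chi (p ^ e)) \<le> \<epsilon>"
proof -
  obtain \<rho> where \<rho>: "\<rho> > 0" "\<And>N. cmod (exp (A N)) \<ge> \<rho>" using exp_A_lower by blast
  \<comment> \<open>Two averages will be added, and the common factor X of modulus at least
    \<open>\<rho>\<close> divided out.\<close>
  have "\<epsilon> * \<rho> / 2 > 0" using \<epsilon> \<rho>(1) by simp
  then obtain w1 where w1: "\<And>Q c. q dvd Q \<Longrightarrow> (\<And>p. prime p \<Longrightarrow> p \<le> w1 \<Longrightarrow> p dvd Q) \<Longrightarrow> c > 0 \<Longrightarrow> coprime c Q \<Longrightarrow>
    eventually (\<lambda>N. (\<Sum>n<N. cmod (f (Q * n + c) - tw (Q * n + c) * exp (AQ Q N))) \<le> \<epsilon> * \<rho> / 2 * real N) sequentially"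
    using concentration_eventually by blast
  define w where "w = max w1 (max q b)"
  show ?thesis
  proof (rule that[of w])
    fix p e assume p: "prime p" "p > w"
    show "cmod (f (p ^ e) - chi (p ^ e)) \<le> \<epsilon>"
    proof (cases "e = 0")
      case True
      then show ?thesis using f1 chi_1 \<epsilon> by simp
    next
      case False
      have p0: "p > 0" "p \<ge> 2" using p by (auto simp: prime_ge_2_nat)
      \<comment> \<open>Its prime factors are exactly the primes up to w. Including a and b makes a
        W and b W have the same primes, and p is not among them.\<close>
      define W where "W = q * a * b * fact w"
      have W0: "W > 0" using q_pos ab by (simp add: W_def)
      have Wp: "p' \<le> w" if "prime p'" "p' dvd W" for p'
      proof -
        have "p' dvd q \<or> p' dvd a \<or> p' dvd b \<or> p' dvd fact w"
          using that(2) prime_dvd_multD[OF that(1)] unfolding W_def by blast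
        moreover have "p' \<le> w" if "p' dvd fact w" using that \<open>prime p'\<close> by (simp add: prime_dvd_fact_iff)
        ultimately show ?thesis
          using that(1) q_pos ab dvd_imp_le[of p' q] dvd_imp_le[of p' a] dvd_imp_le[of p' b]
          by (auto simp: w_def)
      qed
      have Wd: "p' dvd W" if "prime p'" "p' \<le> w" for p'
        using dvd_fact[of p' w] that prime_ge_1_nat by (auto simp: W_def)
      have npW: "\<not> p dvd W" using Wp[of p] p by auto
      then have pW: "coprime p W" using p prime_imp_coprime by blast
      have aW: "a dvd W" and bW: "b dvd W" and qW: "q dvd W" by (auto simp: W_def)
      have pa: "coprime p a" using pW aW by (meson coprime_divisors dvd_refl)
      have "coprime (a * W) (p ^ (e + 1))" using pW pa by (simp add: coprime_commute)
      from cong_solve_coprime_nat[OF this]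
      obtain y0 where y0: "[(a * W) * y0 = 1] (mod p ^ (e + 1))" by auto
      \<comment> \<open>A solution of a W y + 1 = p^e modulo p^(e+1), with p^(e+1) - 1 standing for
        -1; thus p^e divides a W y + 1 exactly.\<close>
      define y where "y = y0 * (p ^ e + (p ^ (e + 1) - 1))"
      have "[a * W * y + 1 = p ^ e] (mod p ^ (e + 1))"
      proof -
        have "[(a * W * y0) * (p ^ e + (p ^ (e + 1) - 1)) + 1 = 1 * (p ^ e + (p ^ (e + 1) - 1)) + 1] (mod p ^ (e + 1))"
          by (intro cong_add cong_mult cong_refl y0)
        also have "1 * (p ^ e + (p ^ (e + 1) - 1)) + 1 = p ^ e + p ^ (e + 1)" using p0 by simp
        also have "[p ^ e + p ^ (e + 1) = p ^ e + 0] (mod p ^ (e + 1))"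
          by (intro cong_add cong_refl) (simp add: cong_0_iff)
        finally show ?thesis by (simp add: y_def mult.assoc)
      qed
      then have ay: "[a * W * y + 1 = p ^ e] (mod p ^ e * p)" by (simp add: mult.commute)
      have "[a * W * y + 1 = p ^ e] (mod p ^ e)" using ay by (rule cong_modulus_mult_nat)
      from cong_dvd_iff[OF this] have "p ^ e dvd a * W * y + 1" by simp
      then obtain v where v: "a * W * y + 1 = p ^ e * v" by (elim dvdE)
      have pv: "\<not> p dvd v"
      proof
        assume "p dvd v"
        then have "p ^ e * p dvd a * W * y + 1" unfolding v by (intro mult_dvd_mono) auto
        then have "[a * W * y + 1 = 0] (mod p ^ e * p)" by (simp add: cong_0_iff)
        then have "[p ^ e = 0] (mod p ^ e * p)" using ay cong_sym cong_trans by blast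
        then have "p ^ e * p dvd p ^ e * 1" by (simp add: cong_0_iff)
        then have "p dvd 1" using p0 by (subst (asm) dvd_times_left_cancel_iff) auto
        then show False using p(1) by simp
      qed
      have v0: "v > 0" using v by (cases v) auto
      have y1: "y > 0"
      proof (rule Nat.gr0I)
        assume "y = 0"
        then have "p ^ e * v = 1" using v by simp
        then have "p ^ e = 1" using nat_mult_eq_1_iff by blast
        then show False using False p0 by simp
      qed
      have cv: "coprime v (a * W)"
      proof (rule coprimeI)
        fix d assume d: "d dvd v" "d dvd a * W"
        then have "d dvd a * W * y + 1" "d dvd a * W * y" unfolding v by auto
        then have "d dvd 1" using dvd_add_right_iff by blast
        then show "is_unit d" by simp
      qed
      \<comment> \<open>For n = W y + W p^(e+1) m one gets a n + 1 = p^e (Q1 m + v) and b n + 1 = Q2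
        m + c2. Q1 and Q2 have the same prime factors, so the same exponential factor belongs to
        both progressions and can be cancelled.\<close>
      define Q1 where "Q1 = a * W * p"
      define Q2 where "Q2 = b * W * p ^ (e + 1)"
      define c2 where "c2 = b * W * y + 1"
      have "coprime p v" using p(1) pv prime_imp_coprime by blast
      then have cop1: "coprime v Q1" using cv by (simp add: Q1_def coprime_commute)
      have cop2: "coprime c2 Q2"
      proof -
        \<comment> \<open>A prime dividing both a W y + 1 and b W y + 1 divides (b - a) W y; the
          choice p > w >= b rules out b - a.\<close>
        have "\<not> p dvd b * W * y + 1"
        proof
          assume 1: "p dvd b * W * y + 1"
          have "p dvd p ^ e" using False by (simp add: dvd_power)
          then have 2: "p dvd a * W * y + 1" unfolding v by simp
          have "p dvd (b * W * y + 1) - (a * W * y + 1)" using 1 2 by (rule dvd_diff_nat)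
          also have "(b * W * y + 1) - (a * W * y + 1) = (b - a) * W * y" by (simp add: diff_mult_distrib)
          finally have "p dvd b - a \<or> p dvd W \<or> p dvd y" using prime_dvd_multD[OF p(1)] by blast
          moreover have "\<not> p dvd y"
          proof
            assume "p dvd y"
            then have "p dvd 1" using 2 dvd_add_right_iff[of p "a * W * y" 1] by simp
            then show False using p(1) by simp
          qed
          moreover have "\<not> p dvd b - a" using ab p dvd_imp_le[of p "b - a"] by (auto simp: w_def)
          ultimately show False using npW by blast
        qed
        then have "coprime p c2" unfolding c2_def using p(1) prime_imp_coprime by blast
        moreover have "coprime c2 (b * W)"
          unfolding c2_def by (rule coprime_ap) simp
        ultimately show ?thesis by (simp add: Q2_def coprime_commute)
      qed
      have Q0: "Q1 > 0" "Q2 > 0" using ab W0 p0 by (auto simp: Q1_def Q2_def)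
      have pf: "prime_factors Q1 = prime_factors Q2"
      proof -
        have "p' dvd Q1 \<longleftrightarrow> p' dvd Q2" if p': "prime p'" for p'
        proof -
          have "p' dvd Q1 \<longleftrightarrow> p' dvd W \<or> p' dvd p"
            using dvd_trans[OF _ aW, of p'] prime_dvd_multD[OF p'] unfolding Q1_def by (meson dvd_mult dvd_mult2)
          moreover have "p' dvd p ^ (e + 1) \<longleftrightarrow> p' dvd p"
            using prime_dvd_power[OF p'] dvd_power[of "e + 1" p] dvd_trans by (metis add_gr_0 zero_less_one)
          then have "p' dvd Q2 \<longleftrightarrow> p' dvd W \<or> p' dvd p"
            using dvd_trans[OF _ bW, of p'] prime_dvd_multD[OF p'] unfolding Q2_def by (meson dvd_mult dvd_mult2)
          ultimately show ?thesis by blast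
        qed
        then show ?thesis using Q0 by (auto simp: prime_factors_dvd)
      qed
      have W_Q: "W dvd Q1" "W dvd Q2" by (auto simp: Q1_def Q2_def)
      have ev1: "eventually (\<lambda>N. (\<Sum>n<N. cmod (f (Q1 * n + v) - tw (Q1 * n + v) * exp (AQ Q1 N))) \<le> \<epsilon> * \<rho> / 2 * real N) sequentially"
        by (rule w1) (use Wd W_Q qW v0 cop1 in \<open>auto simp: w_def intro: dvd_trans\<close>)
      have ev2: "eventually (\<lambda>N. (\<Sum>n<N. cmod (f (Q2 * n + c2) - tw (Q2 * n + c2) * exp (AQ Q2 N))) \<le> \<epsilon> * \<rho> / 2 * real N) sequentially"
        by (rule w1) (use Wd W_Q qW cop2 in \<open>auto simp: w_def c2_def intro: dvd_trans\<close>)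
      have "eventually (\<lambda>N. cmod (f (p ^ e) * chi v - 1) \<le> \<epsilon>) sequentially"
        using ev1 ev2 eventually_ge_at_top[of "Q1 * Q1"] eventually_ge_at_top[of "Q2 * Q2"] eventually_gt_at_top[of 0]
      proof eventually_elim
        case (elim N)
        define X where "X = exp (AQ Q1 N)"
        have X2: "exp (AQ Q2 N) = X"
          using AQ_eq[OF Q0(1) elim(3)] AQ_eq[OF Q0(2) elim(4)] pf by (simp add: X_def \<kappa>_def)
        have "X = exp (A N) * exp (- \<kappa> Q1)"
          unfolding X_def AQ_eq[OF Q0(1) elim(3)] by (simp add: exp_add[symmetric])
        then have "cmod X = cmod (exp (A N)) * cmod (exp (- \<kappa> Q1))" by (simp only: norm_mult)
        also have "\<dots> \<ge> \<rho> * 1"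
          using \<rho> by (intro mult_mono norm_exp_\<kappa>) auto
        finally have X\<rho>: "cmod X \<ge> \<rho>" by simp
        define E1 where "E1 n = cmod (f (Q1 * n + v) - tw (Q1 * n + v) * X)" for n
        define E2 where "E2 n = cmod (f (Q2 * n + c2) - tw (Q2 * n + c2) * X)" for n
        have "(\<Sum>n<N. E1 n + E2 n) \<le> \<epsilon> * \<rho> * real N"
          using elim(1,2) X2 by (simp add: E1_def E2_def X_def sum.distrib)
        have "\<exists>n<N. E1 n + E2 n \<le> \<epsilon> * \<rho>"
        proof (rule ccontr)
          assume "\<not> ?thesis"
          then have "(\<Sum>n<N. \<epsilon> * \<rho>) < (\<Sum>n<N. E1 n + E2 n)"
            using elim(5) by (intro sum_strict_mono) (auto simp: not_le)
          then show False using \<open>(\<Sum>n<N. E1 n + E2 n) \<le> \<epsilon> * \<rho> * real N\<close> by (simp add: mult.commute)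
        qed
        then obtain m where m: "E1 m + E2 m \<le> \<epsilon> * \<rho>" by blast
        define n where "n = W * y + W * p ^ (e + 1) * m"
        have "n \<ge> 1" using W0 y1 by (simp add: n_def Suc_le_eq)
        have an: "a * n + 1 = p ^ e * (Q1 * m + v)"
        proof -
          have "a * n + 1 = (a * W * y + 1) + a * W * p ^ (e + 1) * m" by (simp add: n_def algebra_simps)
          also have "\<dots> = p ^ e * (Q1 * m + v)" unfolding v by (simp add: Q1_def algebra_simps)
          finally show ?thesis .
        qed
        have bn: "b * n + 1 = Q2 * m + c2" by (simp add: n_def Q2_def c2_def algebra_simps)
        have "\<not> p dvd Q1 * m + v"
          using pv dvd_add_right_iff[of p "Q1 * m" v] by (simp add: Q1_def)
        then have "coprime p (Q1 * m + v)" using p(1) prime_imp_coprime by blast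
        then have "coprime (p ^ e) (Q1 * m + v)" by simp
        then have "f (p ^ e * (Q1 * m + v)) = f (p ^ e) * f (Q1 * m + v)"
          using v0 p0 by (intro mult_class_mult[OF f]) auto
        then have ff: "f (Q2 * m + c2) = f (p ^ e) * f (Q1 * m + v)"
          using co[OF \<open>n \<ge> 1\<close>] an bn by simp
        have tw0: "tw x = chi x" for x unfolding tw_def by (simp add: t0)
        have "[Q1 * m + v = 0 + v] (mod q)" using W_Q qW
          by (intro cong_add cong_refl) (auto simp: cong_0_iff intro: dvd_trans)
        then have tw1: "tw (Q1 * m + v) = chi v" using chi_cong tw0 by simp
        have "[Q2 * m + (b * W * y + 1) = 0 + (0 + 1)] (mod q)" using W_Q qW
          by (intro cong_add cong_refl) (auto simp: cong_0_iff intro: dvd_trans)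
        then have tw2: "tw (Q2 * m + c2) = 1" using chi_cong tw0 chi_1 by (simp add: c2_def)
        have "(f (p ^ e) * chi v - 1) * X = (f (Q2 * m + c2) - X) - f (p ^ e) * (f (Q1 * m + v) - chi v * X)"
          unfolding ff by (simp add: algebra_simps)
        also have "cmod \<dots> \<le> cmod (f (Q2 * m + c2) - X) + cmod (f (p ^ e) * (f (Q1 * m + v) - chi v * X))"
          by (rule norm_triangle_ineq4)
        also have "cmod (f (p ^ e) * (f (Q1 * m + v) - chi v * X)) \<le> 1 * E1 m"
          unfolding norm_mult E1_def tw1 by (intro mult_right_mono norm_f) auto
        also have "cmod (f (Q2 * m + c2) - X) = E2 m" unfolding E2_def tw2 by simp
        finally have "cmod (f (p ^ e) * chi v - 1) * cmod X \<le> \<epsilon> * \<rho>" using m by (simp add: norm_mult)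
        moreover have "cmod (f (p ^ e) * chi v - 1) * \<rho> \<le> cmod (f (p ^ e) * chi v - 1) * cmod X"
          by (intro mult_left_mono X\<rho>) auto
        ultimately have "cmod (f (p ^ e) * chi v - 1) * \<rho> \<le> \<epsilon> * \<rho>" by linarith
        then show ?case using \<rho>(1) by simp
      qed
      then have fv: "cmod (f (p ^ e) * chi v - 1) \<le> \<epsilon>" by (auto dest: eventually_happens)
      have "[a * W * y + 1 = 0 + 1] (mod q)" using qW
        by (intro cong_add cong_refl) (auto simp: cong_0_iff)
      then have "chi (p ^ e * v) = 1" using chi_cong chi_1 v by simp
      then have pv1: "chi (p ^ e) * chi v = 1" by (simp add: chi_mult)
      then have "f (p ^ e) - chi (p ^ e) = (f (p ^ e) * chi v - 1) * chi (p ^ e)"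
        by (simp add: algebra_simps)
      also have "cmod \<dots> \<le> \<epsilon> * 1"
        unfolding norm_mult using \<epsilon> by (intro mult_mono fv norm_chi_le) auto
      finally show ?thesis by simp
    qed
  qed
qed

lemma chi_prod: "finite S \<Longrightarrow> chi (\<Prod>p\<in>S. g p) = (\<Prod>p\<in>S. chi (g p))"
  by (induction S rule: finite_induct) (use chi_1 chi_mult in auto)

text \<open>In the class of n modulo the period the smooth part is fixed and the cofactor has only
  primes above w, where f agrees with chi on prime powers. Hence f of the cofactor is a character
  value, which depends only on the residue modulo q.\<close>

lemma toeplitz_if_eventually_character:
  assumes ev: "\<And>p e. prime p \<Longrightarrow> p > w \<Longrightarrow> f (p ^ e) = chi (p ^ e)"
  shows "toeplitz f"
  unfolding toeplitz_def
proof (intro allI impI)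
  fix n :: nat assume n: "n \<ge> 1"
  define u where "u = max w (max q 2)"
  have u: "w \<le> u" "q \<le> u" "2 \<in> small_primes u" by (auto simp: u_def small_primes_def)
  \<comment> \<open>p^n > n, so no small prime has its K-th power dividing n.\<close>
  define K where "K = n"
  define c where "c = n mod period u K"
  have pd: "p ^ K dvd period u K" if "p \<in> small_primes u" for p
    using power_dvd_period[OF that, of K] by (metis dvd_trans le_imp_power_dvd le_add1)
  have nd: "\<not> p ^ K dvd c" if "p \<in> small_primes u" for p
  proof
    assume "p ^ K dvd c"
    then have "p ^ K dvd n" using pd[OF that] by (simp add: c_def dvd_mod_iff)
    then have "p ^ K \<le> n" using n by (intro dvd_imp_le) auto
    moreover have "p ^ K > K"
      using small_primes_prime[OF that] by (intro power_gt_expt) (auto simp: prime_ge_2_nat numeral_2_eq_2 dest: prime_gt_1_nat)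
    ultimately show False by (simp add: K_def)
  qed
  have c0: "c > 0" using nd[OF u(3)] by (intro Nat.gr0I) auto
  define a where "a = smooth_part u c"
  define Q' where "Q' = period u K div a"
  define c' where "c' = c div a"
  note red = reduced_residue[OF u(2) c0 nd, folded a_def, folded Q'_def c'_def]
  have val: "f (period u K * m + c) = f a * chi c'" for m
  proof -
    define x where "x = Q' * m + c'"
    have x0: "x > 0" using red(5) by (simp add: x_def)
    have fx: "f (period u K * m + c) = f a * f x"
      unfolding x_def Q'_def c'_def a_def by (rule G_ap(2)[OF u(2) c0 nd])
    have cop: "coprime x Q'" unfolding x_def by (rule coprime_ap[OF red(4)])
    have gt: "p > w" if p: "p \<in> prime_factors x" for p
    proof (rule ccontr)
      assume "\<not> p > w"
      then have "p \<in> small_primes u" using p u(1) by (auto simp: small_primes_def)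
      then have "p dvd Q'" using red(3) by auto
      moreover have "p dvd x" "prime p" using p by auto
      ultimately show False using cop not_prime_unit coprime_common_divisor by blast
    qed
    have "f x = (\<Prod>p\<in>prime_factors x. f (p ^ multiplicity p x))"
      by (rule mult_class_prime_factors[OF f f1 x0])
    also have "\<dots> = (\<Prod>p\<in>prime_factors x. chi (p ^ multiplicity p x))"
      using gt by (intro prod.cong refl ev) auto
    also have "\<dots> = chi (\<Prod>p\<in>prime_factors x. p ^ multiplicity p x)"
      by (simp add: chi_prod)
    also have "\<dots> = chi x" using x0 by (simp add: prime_factorization_nat[symmetric])
    also have "\<dots> = chi (0 + c')" unfolding x_def using red(2)
      by (intro chi_cong cong_add cong_refl) (auto simp: cong_0_iff)
    finally show ?thesis using fx by simp
  qed
  show "\<exists>m\<ge>1. \<forall>n'\<ge>1. [n' = n] (mod m) \<longrightarrow> f n' = f n"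
  proof (intro exI[of _ "period u K"] conjI allI impI)
    show "period u K \<ge> 1" using period_pos[of u K] by simp
    fix n' assume "[n' = n] (mod period u K)"
    then have "n' mod period u K = c" by (simp add: c_def cong_def)
    then have "n' = period u K * (n' div period u K) + c" by (metis mult_div_mod_eq)
    moreover have "n = period u K * (n div period u K) + c" by (simp add: c_def)
    ultimately show "f n' = f n" using val by metis
  qed
qed

text \<open>Beyond r the values of f form a finite set, and so do those of chi. At large prime
  powers f and chi are closer than the minimal separation s of the union, so they are equal
  there.\<close>

lemma automatic_imp_toeplitz:
  assumes "automatic f"
  shows "toeplitz f"
proof -
  obtain r where r: "r \<ge> 2" "automatic_base r f" using assms by (auto simp: automatic_def)
  obtain V where V: "finite V" "\<And>x. x \<ge> r \<Longrightarrow> f x \<in> V"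
    using automatic_base_finite_values[OF r(2,1)] by blast
  have "convergent Z"
  proof (rule finite_values_Z_convergent[of r V])
    show "f (r * n + 1) \<in> V" if "n \<ge> 1" for n
    proof -
      have "r \<le> r * n" using that by simp
      then show ?thesis by (intro V(2)) linarith
    qed
  qed (use r V in auto)
  then have t0: "t = 0" by (rule rap_if_Z_convergent)
  obtain k l where kl: "k \<ge> 1" "k < l" "\<And>n. n \<ge> 1 \<Longrightarrow> f (r ^ k * n + 1) = f (r ^ l * n + 1)"
    using automatic_base_coincidence[OF r(2,1)] by blast
  define V' where "V' = V \<union> chi ` {..<q}"
  have "finite V'" using V(1) by (simp add: V'_def)
  then obtain s where s: "s > 0" "\<And>u v. u \<in> V' \<Longrightarrow> v \<in> V' \<Longrightarrow> u \<noteq> v \<Longrightarrow> cmod (u - v) \<ge> s"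
    using finite_separation by blast
  have "0 < r ^ k" "r ^ k < r ^ l" using r(1) kl(2) by (auto intro: power_strict_increasing)
  then obtain w where w: "\<And>p e. prime p \<Longrightarrow> p > w \<Longrightarrow> cmod (f (p ^ e) - chi (p ^ e)) \<le> s / 2"
    using coincidence_prime_power[OF t0 _ _ kl(3), of "s / 2"] s(1) by auto
  show ?thesis
  proof (rule toeplitz_if_eventually_character[of "max w r"])
    fix p e assume p: "prime p" "p > max w r"
    show "f (p ^ e) = chi (p ^ e)"
    proof (cases "e = 0")
      case False
      have "p ^ 1 \<le> p ^ e" using False p by (intro power_increasing) (auto simp: prime_ge_1_nat)
      then have "f (p ^ e) \<in> V'" using p by (auto simp: V'_def intro!: V(2))
      moreover have "chi (p ^ e) = chi (p ^ e mod q)" by (rule chi_cong) (simp add: cong_def)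
      then have "chi (p ^ e) \<in> V'" using q_pos by (auto simp: V'_def)
      ultimately show ?thesis using s w[of p e] p by (metis (no_types, lifting) max_less_iff_conj field_sum_of_halves less_add_same_cancel1 half_gt_zero order_less_le_trans not_le)
    qed (use f1 chi_1 in simp)
  qed
qed

end

section \<open>Power means\<close>

text \<open>On a tail with sum at most 1/2 the Weierstrass inequality gives a product of at least
  1/2; the finite head is a positive constant.\<close>

lemma prod_one_minus_lower_bound:
  fixes y :: "nat \<Rightarrow> real"
  assumes "\<And>n. 0 \<le> y n" "\<And>n. y n < 1" "summable y"
  obtains c where "c > 0" "\<And>S. finite S \<Longrightarrow> (\<Prod>n\<in>S. 1 - y n) \<ge> c"
proof -
  have weier: "(\<Prod>n\<in>S. 1 - y n) \<ge> 1 - sum y S" if "finite S" for S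
    using that
  proof (induction S rule: finite_induct)
    case (insert x S)
    have le1: "(\<Prod>n\<in>S. 1 - y n) \<le> 1" using assms(1,2) by (intro prod_le_1) (auto intro: less_imp_le)
    have "y x * (\<Prod>n\<in>S. 1 - y n) \<le> y x * 1" using le1 assms(1) by (intro mult_left_mono) auto
    then show ?case using insert by (simp add: algebra_simps)
  qed auto
  obtain M where M: "\<And>S. finite S \<Longrightarrow> (\<forall>n\<in>S. M \<le> n) \<Longrightarrow> sum y S \<le> 1 / 2"
    using summable_tail_small[OF assms(3,1), of "1 / 2"] by auto
  define c where "c = (\<Prod>n<M. 1 - y n)"
  have c0: "c > 0" unfolding c_def using assms(2) by (intro prod_pos) auto
  show ?thesis
  proof (rule that[of "c / 2"])
    fix S :: "nat set" assume S: "finite S"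
    have "c * (1 / 2) \<le> (\<Prod>n\<in>S \<inter> {..<M}. 1 - y n) * (\<Prod>n\<in>S - {..<M}. 1 - y n)"
    proof (rule mult_mono)
      have "c = (\<Prod>n\<in>S \<inter> {..<M}. 1 - y n) * (\<Prod>n\<in>{..<M} - S. 1 - y n)"
        unfolding c_def using prod.Int_Diff[of "{..<M}" "\<lambda>n. 1 - y n" S] by (simp add: Int_commute)
      also have "\<dots> \<le> (\<Prod>n\<in>S \<inter> {..<M}. 1 - y n) * 1"
        using assms(1,2) by (intro mult_left_mono prod_le_1 prod_nonneg) (auto intro: less_imp_le)
      finally show "c \<le> (\<Prod>n\<in>S \<inter> {..<M}. 1 - y n)" by simp
      have "sum y (S - {..<M}) \<le> 1 / 2" using S by (intro M) auto
      then show "1 / 2 \<le> (\<Prod>n\<in>S - {..<M}. 1 - y n)" using weier[of "S - {..<M}"] S by simp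
      show "0 \<le> (\<Prod>n\<in>S \<inter> {..<M}. 1 - y n)"
        using assms(2) by (intro prod_nonneg) (auto intro: less_imp_le)
    qed simp
    also have "\<dots> = (\<Prod>n\<in>S. 1 - y n)" using S by (rule prod.Int_Diff[symmetric])
    finally show "c / 2 \<le> (\<Prod>n\<in>S. 1 - y n)" by simp
  qed (use c0 in simp)
qed

lemma periodic_mod:
  fixes g :: "nat \<Rightarrow> 'a"
  assumes "\<And>n. g (n + d) = g n"
  shows "g (n mod d) = g n"
proof -
  have "g (r + k * d) = g r" for r k
  proof (induction k)
    case (Suc k)
    have "g (r + Suc k * d) = g ((r + k * d) + d)" by (simp add: algebra_simps)
    then show ?case using Suc assms by simp
  qed auto
  then show ?thesis by (metis mod_div_mult_eq)
qed

text \<open>Chinese remainder theorem: the pair of residues runs through all pairs exactly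
  once.\<close>

lemma sum_coprime_product:
  fixes g g' :: "nat \<Rightarrow> complex"
  assumes "coprime a b" "a > 0" "b > 0" "\<And>n. g (n + a) = g n" "\<And>n. g' (n + b) = g' n"
  shows "(\<Sum>n<a * b. g n * g' n) = (\<Sum>n<a. g n) * (\<Sum>n<b. g' n)"
proof -
  define \<psi> where "\<psi> n = (n mod a, n mod b)" for n
  have inj: "inj_on \<psi> {..<a * b}"
  proof (rule inj_onI)
    fix m n assume "m \<in> {..<a * b}" "n \<in> {..<a * b}" "\<psi> m = \<psi> n"
    then have "[m = n] (mod a)" "[m = n] (mod b)" "m < a * b" "n < a * b" by (auto simp: \<psi>_def cong_def)
    then show "m = n" using coprime_cong_mult_nat[OF _ _ assms(1), of m n] by (simp add: cong_def)
  qed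
  have sub: "\<psi> ` {..<a * b} \<subseteq> {..<a} \<times> {..<b}" using assms(2,3) by (auto simp: \<psi>_def)
  have "\<psi> ` {..<a * b} = {..<a} \<times> {..<b}"
    by (rule card_subset_eq[OF _ sub]) (simp_all add: card_image[OF inj] card_cartesian_product)
  then have "(\<Sum>(i, j)\<in>{..<a} \<times> {..<b}. g i * g' j) = (\<Sum>n<a * b. (\<lambda>(i, j). g i * g' j) (\<psi> n))"
    by (metis (no_types, lifting) sum.reindex[OF inj] comp_apply sum.cong)
  also have "\<dots> = (\<Sum>n<a * b. g n * g' n)"
    using periodic_mod[of g a, OF assms(4)] periodic_mod[of g' b, OF assms(5)] by (simp add: \<psi>_def)
  finally show ?thesis by (simp add: sum_product sum.cartesian_product)
qed

text \<open>Periodicity of the product is carried along because the induction step applies the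
  two-factor case to it.\<close>

lemma sum_coprime_product_finite:
  fixes g :: "nat \<Rightarrow> nat \<Rightarrow> complex" and d :: "nat \<Rightarrow> nat"
  assumes "finite P" "\<And>p. p \<in> P \<Longrightarrow> d p > 0" "\<And>p n. p \<in> P \<Longrightarrow> g p (n + d p) = g p n"
    "\<And>p p'. p \<in> P \<Longrightarrow> p' \<in> P \<Longrightarrow> p \<noteq> p' \<Longrightarrow> coprime (d p) (d p')"
  shows "(\<Sum>n<prod d P. \<Prod>p\<in>P. g p n) = (\<Prod>p\<in>P. \<Sum>n<d p. g p n) \<and> (\<forall>n. (\<Prod>p\<in>P. g p (n + prod d P)) = (\<Prod>p\<in>P. g p n))"
  using assms
proof (induction P rule: finite_induct)
  case (insert p P)
  have IH: "(\<Sum>n<prod d P. \<Prod>p\<in>P. g p n) = (\<Prod>p\<in>P. \<Sum>n<d p. g p n)"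
    "\<And>n. (\<Prod>p\<in>P. g p (n + prod d P)) = (\<Prod>p\<in>P. g p n)"
    using insert.IH[OF insert.prems(1)[OF insertI2] insert.prems(2)[OF insertI2] insert.prems(3)[OF insertI2 insertI2]]
    by blast+
  have cop: "coprime (d p) (prod d P)" using insert.hyps insert.prems(3)[of p] by (intro prod_coprime_right) (metis insertI1 insertI2)
  have per: "g p' (n + k * d p') = g p' n" if "p' \<in> insert p P" for p' n k
  proof (induction k)
    case (Suc k)
    have "g p' (n + Suc k * d p') = g p' ((n + k * d p') + d p')" by (simp add: algebra_simps)
    then show ?case using Suc insert.prems(2)[OF that] by simp
  qed auto
  have "(\<Sum>n<d p * prod d P. g p n * (\<Prod>p\<in>P. g p n)) = (\<Sum>n<d p. g p n) * (\<Sum>n<prod d P. \<Prod>p\<in>P. g p n)"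
  proof (rule sum_coprime_product[OF cop])
    show "d p > 0" by (rule insert.prems(1)[OF insertI1])
    show "prod d P > 0" by (rule prod_pos) (rule insert.prems(1)[OF insertI2])
    show "g p (n + d p) = g p n" for n by (rule insert.prems(2)[OF insertI1])
  qed (rule IH(2))
  moreover have "(\<Prod>p'\<in>insert p P. g p' (n + prod d (insert p P))) = (\<Prod>p'\<in>insert p P. g p' n)" for n
  proof (intro prod.cong refl)
    fix p' assume p': "p' \<in> insert p P"
    then have "d p' dvd prod d (insert p P)" using insert.hyps by (intro dvd_prodI) auto
    then obtain k where "prod d (insert p P) = k * d p'" by (metis dvdE mult.commute)
    then show "g p' (n + prod d (insert p P)) = g p' n" using per[OF p'] by simp
  qed
  ultimately show ?case using insert.hyps IH(1) by simp
qed auto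

lemma periodic_sum_bound:
  fixes g :: "nat \<Rightarrow> complex"
  assumes D: "D > 0" and per: "\<And>n. g (n + D) = g n" and bd: "\<And>n. cmod (g n) \<le> 1" and ab: "a \<le> b"
  shows "cmod ((\<Sum>n\<in>{a..<b}. g n) - of_nat (b - a) * ((\<Sum>n<D. g n) / of_nat D)) \<le> 4 * real D"
proof -
  define M where "M = (\<Sum>n<D. g n) / of_nat D"
  have "cmod (\<Sum>n<D. g n) \<le> real D" using sum_norm_bound[of "{..<D}" g 1] bd by simp
  then have M1: "cmod M \<le> 1" using D by (simp add: M_def norm_divide)
  have *: "cmod ((\<Sum>n<N. g n) - of_nat N * M) \<le> 2 * real D" for N
  proof -
    have per': "g (n + k * D) = g n" for n k
    proof (induction k)
      case (Suc k)
      have "g (n + Suc k * D) = g ((n + k * D) + D)" by (simp add: algebra_simps)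
      then show ?case using Suc per by simp
    qed auto
    have blocks: "(\<Sum>n<k * D. g n) = of_nat (k * D) * M" for k
    proof (induction k)
      case (Suc k)
      have "(\<Sum>n<Suc k * D. g n) = (\<Sum>n<k * D. g n) + (\<Sum>n<D. g (k * D + n))"
        using sum.nat_group[of g D] by (simp add: sum_diff_nat add.commute sum.atLeastLessThan_concat lessThan_atLeast0
          sum.shift_bounds_nat_ivl[symmetric] flip: sum.atLeastLessThan_shift_0)
      also have "(\<Sum>n<D. g (k * D + n)) = of_nat D * M" using D per'[of _ k] by (simp add: M_def add.commute)
      finally show ?case using Suc by (simp add: algebra_simps)
    qed auto
    have "(\<Sum>n<N. g n) = (\<Sum>n<(N div D) * D. g n) + (\<Sum>n\<in>{(N div D) * D..<N}. g n)"
      by (metis sum.atLeastLessThan_concat lessThan_atLeast0 le0 div_times_less_eq_dividend)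
    then have "(\<Sum>n<N. g n) - of_nat N * M = (\<Sum>n\<in>{(N div D) * D..<N}. g n) - of_nat (N - (N div D) * D) * M"
      unfolding blocks by (simp add: of_nat_diff left_diff_distrib)
    also have "cmod \<dots> \<le> cmod (\<Sum>n\<in>{(N div D) * D..<N}. g n) + cmod (of_nat (N - (N div D) * D) * M)"
      by (rule norm_triangle_ineq4)
    also have "cmod (\<Sum>n\<in>{(N div D) * D..<N}. g n) \<le> real (N - (N div D) * D)"
      using sum_norm_bound[of "{(N div D) * D..<N}" g 1] bd by simp
    also have "cmod (of_nat (N - (N div D) * D) * M) \<le> real (N - (N div D) * D) * 1"
      unfolding norm_mult norm_of_nat by (rule mult_left_mono[OF M1 of_nat_0_le_iff])
    also have "real (N - (N div D) * D) + real (N - (N div D) * D) * 1 \<le> 2 * real D"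
    proof -
      have "N - (N div D) * D \<le> D" using D by (simp add: minus_div_mult_eq_mod less_imp_le)
      then have "real (N - (N div D) * D) \<le> real D" by (simp only: of_nat_le_iff)
      then show ?thesis by linarith
    qed
    finally show ?thesis by simp
  qed
  have "(\<Sum>n\<in>{a..<b}. g n) = (\<Sum>n<b. g n) - (\<Sum>n<a. g n)"
    using ab by (metis add_diff_cancel_left' sum.atLeastLessThan_concat lessThan_atLeast0 le0)
  then have "(\<Sum>n\<in>{a..<b}. g n) - of_nat (b - a) * M = ((\<Sum>n<b. g n) - of_nat b * M) - ((\<Sum>n<a. g n) - of_nat a * M)"
    using ab by (simp add: of_nat_diff algebra_simps)
  also have "cmod \<dots> \<le> 2 * real D + 2 * real D"
    by (rule order.trans[OF norm_triangle_ineq4]) (intro add_mono *)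
  finally show ?thesis by (simp add: M_def)
qed

text \<open>From 1 - Re v = (|1 - v|^2 + (1 - |v|^2)) / 2: for v = z^k the first square is at most
  k^2 |1 - z|^2, and the Bernoulli inequality bounds the second part. So k-th powers keep a finite
  pretentious distance.\<close>

lemma one_minus_Re_power:
  assumes "cmod z \<le> 1"
  shows "1 - Re (z ^ k) \<le> ((real k)\<^sup>2 + real k) * (1 - Re z)"
proof -
  have id: "1 - Re v = ((cmod (1 - v))\<^sup>2 + (1 - (cmod v)\<^sup>2)) / 2" for v
    by (simp add: cmod_power2) (simp add: power2_eq_square algebra_simps)
  have "(cmod (1 - z ^ k))\<^sup>2 \<le> (real k * cmod (1 - z))\<^sup>2"
    using norm_power_diff[of 1 z k] assms by (intro power_mono) auto
  also have "\<dots> = (real k)\<^sup>2 * (cmod (1 - z))\<^sup>2" by (simp add: power_mult_distrib)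
  also have "\<dots> \<le> (real k)\<^sup>2 * (2 * (1 - Re z))"
  proof (rule mult_left_mono)
    have "(cmod z)\<^sup>2 \<le> 1" using assms by (simp add: power_le_one)
    then show "(cmod (1 - z))\<^sup>2 \<le> 2 * (1 - Re z)" using id[of z] by simp
  qed auto
  finally have 1: "(cmod (1 - z ^ k))\<^sup>2 \<le> (real k)\<^sup>2 * (2 * (1 - Re z))" .
  have "1 + real (2 * k) * (cmod z - 1) \<le> (1 + (cmod z - 1)) ^ (2 * k)"
    by (rule Bernoulli_inequality) simp
  then have "1 - (cmod (z ^ k))\<^sup>2 \<le> 2 * real k * (1 - cmod z)"
    by (simp add: norm_power power_mult[symmetric] mult.commute algebra_simps)
  also have "\<dots> \<le> 2 * real k * (1 - Re z)"
    using complex_Re_le_cmod[of z] by (intro mult_left_mono) auto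
  finally have 2: "1 - (cmod (z ^ k))\<^sup>2 \<le> 2 * real k * (1 - Re z)" .
  show ?thesis using 1 2 id[of "z ^ k"] by (simp add: algebra_simps)
qed

lemma card_multiples_less:
  fixes a b :: nat
  assumes "a > 0"
  shows "card {n. n < a * b \<and> a dvd n} = b"
proof -
  have "{n. n < a * b \<and> a dvd n} = (\<lambda>i. a * i) ` {..<b}" using assms by auto
  also have "card \<dots> = b" using assms by (subst card_image) (auto simp: inj_on_def)
  finally show ?thesis .
qed

lemma multiplicity_add_power:
  assumes "prime p" "\<not> p ^ K dvd (n :: nat)"
  shows "multiplicity p (n + p ^ K) = multiplicity p n"
proof -
  have n0: "n > 0" using assms(2) by (intro Nat.gr0I) auto
  have less: "multiplicity p n < K" using assms(2) multiplicity_dvd' by (metis not_le)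
  show ?thesis
  proof (rule multiplicity_eqI)
    show "p ^ multiplicity p n dvd n + p ^ K"
      using less by (intro dvd_add multiplicity_dvd le_imp_power_dvd) auto
    have "p ^ Suc (multiplicity p n) dvd p ^ K" using less by (intro le_imp_power_dvd) auto
    moreover have "\<not> p ^ Suc (multiplicity p n) dvd n"
      using n0 assms(1) by (subst power_dvd_iff_le_multiplicity) auto
    ultimately show "\<not> p ^ Suc (multiplicity p n) dvd n + p ^ K" using dvd_add_left_iff by blast
  qed
qed

lemma cis_ln_prod:
  assumes "finite P" "\<And>p. p \<in> P \<Longrightarrow> g p > (0::nat)"
  shows "cis (s * ln (real (\<Prod>p\<in>P. g p))) = (\<Prod>p\<in>P. cis (s * ln (real (g p))))"
  using assms
proof (induction P rule: finite_induct)
  case (insert p P)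
  then have "real (g p) > 0" "real (prod g P) > 0" by (auto intro!: prod_pos)
  then have "cis (s * ln (real (g p) * real (prod g P))) = cis (s * ln (real (g p))) * cis (s * ln (real (prod g P)))"
    by (simp add: ln_mult distrib_left cis_mult)
  then show ?case using insert by simp
qed auto

section \<open>Euler product for the means of k-th powers of f\<close>

context pretentious_to
begin

text \<open>The k-th power of f(m) m^(-it). No character appears because k will be such that chi^k
  is 1 on units.\<close>

definition upow :: "nat \<Rightarrow> nat \<Rightarrow> complex" where
  "upow k m = (f m * cis (- t * ln (real m))) ^ k"

definition u_loc :: "nat \<Rightarrow> nat \<Rightarrow> nat \<Rightarrow> nat \<Rightarrow> complex" where
  "u_loc K k p n = (if p ^ K dvd n then 0 else upow k (p ^ multiplicity p n))"

definition U :: "nat \<Rightarrow> nat \<Rightarrow> nat \<Rightarrow> nat \<Rightarrow> complex" where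
  "U w K k n = (\<Prod>p\<in>small_primes w. u_loc K k p n)"

lemma norm_upow_le: "cmod (upow k m) \<le> 1"
  unfolding upow_def norm_power norm_mult using norm_f[of m] by (simp add: power_le_one)

lemma norm_u_loc_le: "cmod (u_loc K k p n) \<le> 1"
  using norm_upow_le by (simp add: u_loc_def)

lemma norm_U_le: "cmod (U w K k n) \<le> 1"
  unfolding U_def using norm_u_loc_le by (intro order.trans[OF norm_prod_le] prod_le_1) auto

text \<open>Raising to the power k removes the character, and what remains splits into local
  factors, the one at p being periodic modulo p^K. The mean of G^k is therefore an Euler
  product.\<close>

lemma G_power:
  assumes w: "q \<le> w" and n: "n > 0" and k: "k > 0" "\<And>n. coprime n q \<Longrightarrow> chi n ^ k = 1"
  shows "G w K n ^ k = U w K k n * exp (- \<kappa> (\<Prod>(small_primes w))) ^ k"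
proof (cases "\<exists>p\<in>small_primes w. p ^ K dvd n")
  case True
  then have "U w K k n = 0" unfolding U_def by (intro prod_zero) (auto simp: u_loc_def)
  then show ?thesis using True k by (simp add: G_def zero_power)
next
  case False
  then have nd: "\<And>p. p \<in> small_primes w \<Longrightarrow> \<not> p ^ K dvd n" by blast
  note red = reduced_residue[OF w n nd]
  have "coprime (n div smooth_part w n) q" using red(2,4) by (meson coprime_divisors dvd_refl)
  then have c: "chi (n div smooth_part w n) ^ k = 1" by (rule k(2))
  have "U w K k n = (\<Prod>p\<in>small_primes w. upow k (p ^ multiplicity p n))"
    unfolding U_def using nd by (intro prod.cong) (auto simp: u_loc_def)
  also have "\<dots> = ((\<Prod>p\<in>small_primes w. f (p ^ multiplicity p n)) * (\<Prod>p\<in>small_primes w. cis (- t * ln (real (p ^ multiplicity p n))))) ^ k"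
    unfolding upow_def prod_power_distrib[symmetric] prod.distrib[symmetric] by simp
  also have "(\<Prod>p\<in>small_primes w. f (p ^ multiplicity p n)) = f (smooth_part w n)"
    unfolding smooth_part_def by (rule mult_class_prod_primes[OF f f1, symmetric]) (auto simp: small_primes_def)
  also have "(\<Prod>p\<in>small_primes w. cis (- t * ln (real (p ^ multiplicity p n)))) = cis (- t * ln (real (smooth_part w n)))"
    unfolding smooth_part_def by (rule cis_ln_prod[symmetric]) (auto simp: small_primes_gt_0)
  finally show ?thesis using False c by (simp add: G_def power_mult_distrib)
qed

lemma u_loc_periodic: "prime p \<Longrightarrow> u_loc K k p (n + p ^ K) = u_loc K k p n"
  using multiplicity_add_power[of p K n] by (simp add: u_loc_def)

lemma U_sum:
  "(\<Sum>n<(\<Prod>p\<in>small_primes w. p ^ K). U w K k n) = (\<Prod>p\<in>small_primes w. \<Sum>n<p ^ K. u_loc K k p n)"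
  "U w K k (n + (\<Prod>p\<in>small_primes w. p ^ K)) = U w K k n"
proof -
  have *: "(\<Sum>n<prod (\<lambda>p. p ^ K) (small_primes w). \<Prod>p\<in>small_primes w. u_loc K k p n) = (\<Prod>p\<in>small_primes w. \<Sum>n<p ^ K. u_loc K k p n)
    \<and> (\<forall>n. (\<Prod>p\<in>small_primes w. u_loc K k p (n + prod (\<lambda>p. p ^ K) (small_primes w))) = (\<Prod>p\<in>small_primes w. u_loc K k p n))"
    by (rule sum_coprime_product_finite)
      (auto simp: small_primes_gt_0 small_primes_prime u_loc_periodic intro!: primes_coprime)
  show "(\<Sum>n<(\<Prod>p\<in>small_primes w. p ^ K). U w K k n) = (\<Prod>p\<in>small_primes w. \<Sum>n<p ^ K. u_loc K k p n)"
    using * by (simp add: U_def)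
  show "U w K k (n + (\<Prod>p\<in>small_primes w. p ^ K)) = U w K k n"
    using * by (simp add: U_def)
qed

lemma upow_1: "upow k (Suc 0) = 1"
  using f1 by (simp add: upow_def)

lemma Re_u_loc_ge: "Re (u_loc K k p n) \<ge> -1"
  using norm_u_loc_le[of K k p n] abs_Re_le_cmod[of "u_loc K k p n"] by linarith

lemma u_loc_coprime:
  assumes "K > 0" "\<not> p dvd n"
  shows "u_loc K k p n = 1"
proof -
  have "\<not> p ^ K dvd n" using assms by (meson dvd_power dvd_trans)
  then show ?thesis using assms upow_1 by (simp add: u_loc_def not_dvd_imp_multiplicity_0)
qed

lemma u_loc_exact:
  assumes "prime p" "j < K" "p ^ j dvd n" "\<not> p ^ Suc j dvd n"
  shows "u_loc K k p n = upow k (p ^ j)"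
proof -
  have "\<not> p ^ K dvd n" using assms(2,4) by (meson Suc_leI dvd_trans le_imp_power_dvd)
  moreover have "multiplicity p n = j" using assms(3,4) by (rule multiplicity_eqI)
  ultimately show ?thesis by (simp add: u_loc_def)
qed

lemma sum_multiples:
  assumes "p > 0" "i \<le> K"
  shows "(\<Sum>n<p ^ K. of_bool (p ^ i dvd n) :: real) = real p ^ K / real p ^ i"
proof -
  have pK: "p ^ K = p ^ i * p ^ (K - i)" using assms(2) by (simp add: power_add[symmetric])
  have "(\<Sum>n<p ^ K. of_bool (p ^ i dvd n) :: real) = real (p ^ (K - i))"
    unfolding sum_of_bool_less pK using card_multiples_less[of "p ^ i" "p ^ (K - i)"] assms(1) by simp
  also have "\<dots> = real p ^ K / real p ^ i"
  proof -
    have "real p ^ K = real p ^ i * real p ^ (K - i)" using assms(2) by (simp add: power_add[symmetric])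
    then show ?thesis using assms(1) by simp
  qed
  finally show ?thesis .
qed

text \<open>The local factor is 1 off the multiples of p and has real part at least -1 everywhere.
  Using only this gives the first bound. The second also evaluates it where p divides n exactly, for
  summability over p. The third evaluates it where p^j divides n exactly; it serves p = 2, where the
  first bound is 0.\<close>

lemma local_sum_ge:
  assumes p: "prime p" and K: "K \<ge> 2"
  shows "Re (\<Sum>n<p ^ K. u_loc K k p n) \<ge> real p ^ K * (1 - 2 / real p)"
    "Re (\<Sum>n<p ^ K. u_loc K k p n) \<ge> real p ^ K * (1 - (1 - Re (upow k p)) / real p - 2 / (real p)\<^sup>2)"
    "1 \<le> j \<Longrightarrow> j < K \<Longrightarrow> Re (\<Sum>n<p ^ K. u_loc K k p n) \<ge>
      real p ^ K * (1 - 2 / real p + (1 + Re (upow k (p ^ j))) * (1 / real p ^ j - 1 / real p ^ Suc j))"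
proof -
  have p0: "p > 0" using p by (simp add: prime_gt_0_nat)
  have c: "Re (u_loc K k p n) = 1" if "\<not> p dvd n" for n
    using u_loc_coprime[of K p n k] that K by simp
  have "real p ^ K * (1 - 2 / real p) = (\<Sum>n<p ^ K. 1 - 2 * of_bool (p ^ 1 dvd n))"
    unfolding sum_subtractf sum_distrib_left[symmetric] using sum_multiples[OF p0, of 1 K] K by (simp add: algebra_simps)
  also have "\<dots> \<le> (\<Sum>n<p ^ K. Re (u_loc K k p n))"
    using c Re_u_loc_ge[of K k p] by (intro sum_mono) (auto simp: of_bool_def)
  finally show "Re (\<Sum>n<p ^ K. u_loc K k p n) \<ge> real p ^ K * (1 - 2 / real p)" by simp
next
  have p0: "p > 0" using p by (simp add: prime_gt_0_nat)
  have c: "Re (u_loc K k p n) = 1" if "\<not> p dvd n" for n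
    using u_loc_coprime[of K p n k] that K by simp
  define R where "R = Re (upow k p)"
  have R: "-1 \<le> R" "R \<le> 1" using norm_upow_le[of k p] abs_Re_le_cmod[of "upow k p"] by (auto simp: R_def)
  have "real p ^ K * (1 - (1 - R) / real p - 2 / (real p)\<^sup>2) \<le> real p ^ K * (1 - (1 - R) / real p - (1 + R) / (real p)\<^sup>2)"
    using R by (intro mult_left_mono diff_left_mono divide_right_mono) auto
  also have "\<dots> = (\<Sum>n<p ^ K. 1 - (1 - R) * of_bool (p ^ 1 dvd n) - (1 + R) * of_bool (p ^ 2 dvd n))"
    unfolding sum_subtractf sum_distrib_left[symmetric]
    using sum_multiples[OF p0, of 1 K] sum_multiples[OF p0, of 2 K] K by (simp add: algebra_simps)
  also have "\<dots> \<le> (\<Sum>n<p ^ K. Re (u_loc K k p n))"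
  proof (intro sum_mono)
    fix n
    consider "\<not> p dvd n" | "p dvd n" "\<not> p ^ 2 dvd n" | "p ^ 2 dvd n" by blast
    then show "1 - (1 - R) * of_bool (p ^ 1 dvd n) - (1 + R) * of_bool (p ^ 2 dvd n) \<le> Re (u_loc K k p n)"
    proof cases
      case 1
      moreover have "\<not> p ^ 2 dvd n" using 1 by (meson dvd_power dvd_trans zero_less_numeral)
      ultimately show ?thesis using c by simp
    next
      case 2
      then have "u_loc K k p n = upow k (p ^ 1)" using K by (intro u_loc_exact[OF p]) (auto simp: power2_eq_square)
      then show ?thesis using 2 by (simp add: R_def)
    next
      case 3
      then have "p dvd n" by (meson dvd_power dvd_trans zero_less_numeral)
      then show ?thesis using 3 Re_u_loc_ge[of K k p n] by simp
    qed
  qed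
  finally show "Re (\<Sum>n<p ^ K. u_loc K k p n) \<ge> real p ^ K * (1 - (1 - Re (upow k p)) / real p - 2 / (real p)\<^sup>2)"
    by (simp add: R_def)
next
  assume j: "1 \<le> j" "j < K"
  have p0: "p > 0" using p by (simp add: prime_gt_0_nat)
  have c: "Re (u_loc K k p n) = 1" if "\<not> p dvd n" for n
    using u_loc_coprime[of K p n k] that K by simp
  define \<tau> where "\<tau> = 1 + Re (upow k (p ^ j))"
  have "real p ^ K * (1 - 2 / real p + \<tau> * (1 / real p ^ j - 1 / real p ^ Suc j))
    = (\<Sum>n<p ^ K. 1 - 2 * of_bool (p ^ 1 dvd n) + (\<tau> * of_bool (p ^ j dvd n) - \<tau> * of_bool (p ^ Suc j dvd n)))"
    unfolding sum_subtractf sum.distrib sum_distrib_left[symmetric]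
    using sum_multiples[OF p0, of 1 K] sum_multiples[OF p0, of j K] sum_multiples[OF p0, of "Suc j" K] K j
    by (simp add: algebra_simps)
  also have "\<dots> \<le> (\<Sum>n<p ^ K. Re (u_loc K k p n))"
  proof (intro sum_mono)
    fix n
    consider "\<not> p dvd n" | "p dvd n" "p ^ j dvd n" "\<not> p ^ Suc j dvd n" | "p dvd n" "p ^ Suc j dvd n" "p ^ j dvd n"
       | "p dvd n" "\<not> p ^ j dvd n" by (meson dvd_trans le_imp_power_dvd le_SucI order_refl)
    then show "1 - 2 * of_bool (p ^ 1 dvd n) + (\<tau> * of_bool (p ^ j dvd n) - \<tau> * of_bool (p ^ Suc j dvd n)) \<le> Re (u_loc K k p n)"
    proof cases
      case 1
      moreover have "\<not> p ^ j dvd n" "\<not> p ^ Suc j dvd n" using 1 j by (meson dvd_power dvd_trans less_le_trans zero_less_one zero_less_Suc)+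
      ultimately show ?thesis using c by simp
    next
      case 2
      then have "u_loc K k p n = upow k (p ^ j)" using j by (intro u_loc_exact[OF p]) auto
      then show ?thesis using 2 by (simp add: \<tau>_def)
    next
      case 3
      then show ?thesis using Re_u_loc_ge[of K k p n] by simp
    next
      case 4
      moreover have "\<not> p ^ Suc j dvd n" using 4 by (meson dvd_trans le_imp_power_dvd le_SucI order_refl)
      ultimately show ?thesis using Re_u_loc_ge[of K k p n] by simp
    qed
  qed
  finally show "Re (\<Sum>n<p ^ K. u_loc K k p n) \<ge>
      real p ^ K * (1 - 2 / real p + (1 + Re (upow k (p ^ j))) * (1 / real p ^ j - 1 / real p ^ Suc j))"
    by (simp add: \<tau>_def)
qed

lemma upow_eq_F_power:
  assumes "prime p" "coprime p q" "\<And>n. coprime n q \<Longrightarrow> chi n ^ k = 1"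
  shows "upow k p = (1 + h p) ^ k"
proof -
  have "1 + h p = (f p * cis (- t * ln (real p))) * cnj (chi p)"
    using assms(1) by (simp add: h_def tw_def cis_cnj)
  then have "(1 + h p) ^ k = upow k p * cnj (chi p ^ k)"
    by (simp only: upow_def power_mult_distrib complex_cnj_power)
  then show ?thesis using assms by simp
qed

text \<open>If all values at 2^j with j >= 1 were -1, odd and even n would nearly cancel in the
  factor at 2. In that case doubling k turns these values into 1.\<close>

lemma character_order:
  obtains k j where "k > 0" "\<And>n. coprime n q \<Longrightarrow> chi n ^ k = 1" "j \<ge> 1" "Re (upow k (2 ^ j)) > -1"
proof -
  define k0 where "k0 = totient q"
  have k0: "k0 > 0" "\<And>n. coprime n q \<Longrightarrow> chi n ^ k0 = 1" using q_pos chi_totient by (auto simp: k0_def)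
  have Re_gt: "Re u > -1" if "cmod u \<le> 1" "u \<noteq> -1" for u
  proof (rule ccontr)
    assume "\<not> Re u > -1"
    moreover have "\<bar>Re u\<bar> \<le> 1" using abs_Re_le_cmod[of u] that(1) by linarith
    ultimately have re: "Re u = -1" by linarith
    have "(Re u)\<^sup>2 + (Im u)\<^sup>2 \<le> 1" using that(1) power_le_one[of "cmod u" 2] by (simp add: cmod_power2)
    then have "Im u = 0" using re by simp
    then show False using re that(2) by (simp add: complex_eq_iff)
  qed
  show ?thesis
  proof (cases "\<exists>j\<ge>1. upow k0 (2 ^ j) \<noteq> -1")
    case True
    then obtain j where "j \<ge> 1" "upow k0 (2 ^ j) \<noteq> -1" by blast
    then show ?thesis using Re_gt[OF norm_upow_le] k0 that by blast
  next
    case False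
    then have "upow k0 (2 ^ 1) = -1" by blast
    then have "upow (2 * k0) (2 ^ 1) = 1" by (simp add: upow_def mult.commute[of 2] power_mult)
    moreover have "chi n ^ (2 * k0) = 1" if "coprime n q" for n
      using k0(2)[OF that] by (simp add: mult.commute[of 2] power_mult)
    ultimately show ?thesis using k0(1) that[of "2 * k0" 1] by simp
  qed
qed

text \<open>Each local mean has modulus at least 1 - y p, where y p < 1 is summable, so the bound is
  uniform in w and K.\<close>

lemma U_mean_lower_bound:
  assumes k: "k > 0" "\<And>n. coprime n q \<Longrightarrow> chi n ^ k = 1" and j: "j \<ge> 1" "Re (upow k (2 ^ j)) > -1"
  obtains c where "c > 0" "\<And>w K. K > max j 2 \<Longrightarrow>
    cmod (\<Sum>n<(\<Prod>p\<in>small_primes w. p ^ K). U w K k n) \<ge> c * real (\<Prod>p\<in>small_primes w. p ^ K)"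
proof -
  define \<tau> where "\<tau> = 1 + Re (upow k (2 ^ j))"
  have \<tau>: "\<tau> > 0" "\<tau> \<le> 2" using j(2) norm_upow_le[of k "2 ^ j"] abs_Re_le_cmod[of "upow k (2 ^ j)"] by (auto simp: \<tau>_def)
  define x where "x p = (1 - Re (upow k p)) / real p + 2 / (real p)\<^sup>2" for p
  have x0: "x p \<ge> 0" for p
    using norm_upow_le[of k p] abs_Re_le_cmod[of "upow k p"] by (auto simp: x_def intro!: add_nonneg_nonneg divide_nonneg_nonneg)
  \<comment> \<open>At 2 the third local bound reads 1 - 1 + \<open>\<tau> / 2 ^ Suc j\<close>. At
    odd p the crude bound 1 - 2 / p >= 1/3 keeps y p below 1, while x p, from the second bound,
    provides summability.\<close>
  define y where "y p = (if p = 2 then 1 - \<tau> * (1 / 2 ^ Suc j) else if prime p then min (2 / 3) (x p) else 0)" for p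
  have tj: "\<tau> * (1 / 2 ^ Suc j) \<le> 1"
  proof -
    have "\<tau> * (1 / 2 ^ Suc j) \<le> 2 * (1 / 2 ^ 1)"
    proof (rule mult_mono)
      show "1 / 2 ^ Suc j \<le> (1 / 2 ^ 1 :: real)" by (intro divide_left_mono power_increasing) auto
    qed (use \<tau> in auto)
    then show ?thesis by simp
  qed
  have y0: "0 \<le> y p" "y p < 1" for p using tj \<tau>(1) x0[of p] by (auto simp: y_def)
  have "summable y"
  proof (rule summable_comparison_test_ev)
    have "summable (\<lambda>n. ((real k)\<^sup>2 + real k) * (- Re (h n) / real n) + 2 * (1 / (real n)\<^sup>2))"
      using inverse_power_summable[of 2, where 'a = real] by (intro summable_add summable_mult summable_Re_h) (auto simp: inverse_eq_divide)
    then show "summable (\<lambda>n. ((real k)\<^sup>2 + real k) * (- Re (h n) / real n) + 2 * (1 / (real n)\<^sup>2))" .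
    show "eventually (\<lambda>p. norm (y p) \<le> ((real k)\<^sup>2 + real k) * (- Re (h p) / real p) + 2 * (1 / (real p)\<^sup>2)) sequentially"
      using eventually_gt_at_top[of "max q 2"]
    proof eventually_elim
      case (elim p)
      show ?case
      proof (cases "prime p")
        case True
        have "\<not> p dvd q" using elim q_pos dvd_imp_le[of p q] by auto
        then have "coprime p q" using True prime_imp_coprime by blast
        then have u: "upow k p = (1 + h p) ^ k" using upow_eq_F_power True k(2) by blast
        have "cmod (1 + h p) \<le> 1" using True norm_F_le[of p p] by (simp add: h_def)
        then have "1 - Re (upow k p) \<le> ((real k)\<^sup>2 + real k) * (- Re (h p))"
          using one_minus_Re_power[of "1 + h p" k] unfolding u by simp
        then have "(1 - Re (upow k p)) / real p \<le> ((real k)\<^sup>2 + real k) * (- Re (h p)) / real p"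
          by (rule divide_right_mono) simp
        then have "x p \<le> ((real k)\<^sup>2 + real k) * (- Re (h p) / real p) + 2 * (1 / (real p)\<^sup>2)" by (simp add: x_def)
        moreover have "norm (y p) \<le> x p" using elim x0[of p] True by (simp add: y_def)
        ultimately show ?thesis by linarith
      next
        case False
        then show ?thesis using elim Re_h_le[of p] by (auto simp: y_def h_def intro!: add_nonneg_nonneg mult_nonneg_nonneg divide_nonpos_nonneg)
      qed
    qed
  qed
  then obtain c where c: "c > 0" "\<And>S. finite S \<Longrightarrow> (\<Prod>n\<in>S. 1 - y n) \<ge> c"
    using prod_one_minus_lower_bound[of y] y0 by blast
  show ?thesis
  proof (rule that[OF c(1)])
    fix w K assume K: "K > max j 2"
    have loc: "real p ^ K * (1 - y p) \<le> cmod (\<Sum>n<p ^ K. u_loc K k p n)" if "p \<in> small_primes w" for p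
    proof -
      have p: "prime p" using that by (rule small_primes_prime)
      have "real p ^ K * (1 - y p) \<le> Re (\<Sum>n<p ^ K. u_loc K k p n)"
      proof (cases "p = 2")
        case True
        have "real p ^ K * (1 - y p) = real p ^ K * (1 - 2 / real p + (1 + Re (upow k (p ^ j))) * (1 / real p ^ j - 1 / real p ^ Suc j))"
          using True by (simp add: y_def \<tau>_def field_simps)
        also have "\<dots> \<le> Re (\<Sum>n<p ^ K. u_loc K k p n)"
          using K j(1) by (intro local_sum_ge(3)[OF p]) auto
        finally show ?thesis .
      next
        case False
        then have p3: "real p \<ge> 3" using p prime_ge_2_nat[OF p] by simp
        show ?thesis
        proof (cases "x p \<le> 2 / 3")
          case True
          then have "y p = x p" using False p by (simp add: y_def)
          then have "real p ^ K * (1 - y p) = real p ^ K * (1 - (1 - Re (upow k p)) / real p - 2 / (real p)\<^sup>2)"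
            by (simp add: x_def)
          also have "\<dots> \<le> Re (\<Sum>n<p ^ K. u_loc K k p n)"
            using K by (intro local_sum_ge(2)[OF p]) auto
          finally show ?thesis .
        next
          case False
          then have "y p = 2 / 3" using \<open>p \<noteq> 2\<close> p by (simp add: y_def)
          moreover have "2 / real p \<le> 2 / 3" using p3 by (intro divide_left_mono) auto
          ultimately have "real p ^ K * (1 - y p) \<le> real p ^ K * (1 - 2 / real p)"
            by (intro mult_left_mono) auto
          also have "\<dots> \<le> Re (\<Sum>n<p ^ K. u_loc K k p n)"
            using K by (intro local_sum_ge(1)[OF p]) auto
          finally show ?thesis .
        qed
      qed
      also have "\<dots> \<le> cmod (\<Sum>n<p ^ K. u_loc K k p n)" by (rule complex_Re_le_cmod)
      finally show ?thesis .
    qed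
    have "c * real (\<Prod>p\<in>small_primes w. p ^ K) \<le> (\<Prod>p\<in>small_primes w. 1 - y p) * real (\<Prod>p\<in>small_primes w. p ^ K)"
      by (rule mult_right_mono[OF c(2)[OF finite_small_primes] of_nat_0_le_iff])
    also have "\<dots> = (\<Prod>p\<in>small_primes w. real p ^ K * (1 - y p))"
      by (simp add: prod.distrib mult.commute)
    also have "\<dots> \<le> (\<Prod>p\<in>small_primes w. cmod (\<Sum>n<p ^ K. u_loc K k p n))"
      using less_imp_le[OF y0(2)] by (intro prod_mono conjI loc) (auto intro!: mult_nonneg_nonneg)
    also have "\<dots> = cmod (\<Sum>n<(\<Prod>p\<in>small_primes w. p ^ K). U w K k n)"
      unfolding U_sum(1) by (rule prod_norm)
    finally show "cmod (\<Sum>n<(\<Prod>p\<in>small_primes w. p ^ K). U w K k n) \<ge> c * real (\<Prod>p\<in>small_primes w. p ^ K)" .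
  qed
qed

end

section \<open>From a unique Furstenberg system to the convergence of Z^k\<close>

lemma integral_empirical:
  fixes F :: "(int \<Rightarrow> complex) \<Rightarrow> real"
  assumes f: "f \<in> mult_class" and F: "continuous_on disc_seqs F" and N: "N > 0"
  shows "integral\<^sup>L (empirical f N) F = (\<Sum>n=1..N. F ((left_shift ^^ n) (two_sided f))) / real N"
proof -
  let ?g = "\<lambda>n. (left_shift ^^ n) (two_sided f)"
  have g: "?g \<in> measurable (uniform_count_measure {1..N}) borel_disc_seqs"
    using shifts_in_disc_seqs[OF f]
    by (auto simp: measurable_def space_uniform_count_measure sets_uniform_count_measure
        borel_disc_seqs_def space_restrict_space)
  have F': "F \<in> borel_measurable borel_disc_seqs"
    unfolding borel_disc_seqs_def by (rule borel_measurable_continuous_on_restrict[OF F])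
  have "integral\<^sup>L (empirical f N) F = integral\<^sup>L (uniform_count_measure {1..N}) (\<lambda>n. F (?g n))"
    unfolding empirical_def by (rule integral_distr[OF g F'])
  also have "\<dots> = (\<Sum>n\<in>{1..N}. (1 / real N) * F (?g n))"
    unfolding uniform_count_measure_def by (subst lebesgue_integral_point_measure_finite) auto
  finally show ?thesis by (simp add: sum_divide_distrib)
qed

text \<open>The real and imaginary parts of x(0)^k are continuous test functions, and the zeroth
  coordinate of the n-th shift is f n.\<close>

lemma unique_furstenberg_power_means:
  assumes f: "f \<in> mult_class" and u: "unique_furstenberg f"
  obtains L where "(\<lambda>N. (\<Sum>n\<in>{1..<N}. f n ^ k) / of_nat N) \<longlonglongrightarrow> L"
proof -
  obtain \<nu> where \<nu>: "weak_star_lim (empirical f) \<nu>" using u by (auto simp: unique_furstenberg_def)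
  have c0: "continuous_on disc_seqs (\<lambda>x. x (0::int) ^ k)"
    by (intro continuous_on_power continuous_on_subset[OF continuous_on_product_coordinates]) auto
  have x0: "(left_shift ^^ n) (two_sided f) 0 = f n" if "n \<ge> 1" for n
    using that by (simp add: left_shift_funpow two_sided_def)
  have lim: "(\<lambda>N. (\<Sum>n=1..N. \<phi> (f n ^ k)) / real N) \<longlonglongrightarrow> integral\<^sup>L \<nu> (\<lambda>x. \<phi> (x 0 ^ k))"
    if \<phi>: "continuous_on UNIV \<phi>" for \<phi> :: "complex \<Rightarrow> real"
  proof -
    have c: "continuous_on disc_seqs (\<lambda>x. \<phi> (x (0::int) ^ k))"
      using c0 by (rule continuous_on_compose2[OF \<phi>]) auto
    have "(\<lambda>N. integral\<^sup>L (empirical f N) (\<lambda>x. \<phi> (x 0 ^ k))) \<longlonglongrightarrow> integral\<^sup>L \<nu> (\<lambda>x. \<phi> (x 0 ^ k))"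
      using \<nu> c unfolding weak_star_lim_def by blast
    moreover have "eventually (\<lambda>N. integral\<^sup>L (empirical f N) (\<lambda>x. \<phi> (x 0 ^ k)) = (\<Sum>n=1..N. \<phi> (f n ^ k)) / real N) sequentially"
      using eventually_gt_at_top[of 0]
    proof eventually_elim
      case (elim N)
      have "(\<Sum>n=1..N. \<phi> ((left_shift ^^ n) (two_sided f) 0 ^ k)) = (\<Sum>n=1..N. \<phi> (f n ^ k))"
        by (intro sum.cong refl) (simp add: x0)
      then show ?case unfolding integral_empirical[OF f c elim] by simp
    qed
    ultimately show ?thesis by (rule Lim_transform_eventually)
  qed
  define L where "L = Complex (integral\<^sup>L \<nu> (\<lambda>x. Re (x 0 ^ k))) (integral\<^sup>L \<nu> (\<lambda>x. Im (x 0 ^ k)))"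
  have 1: "(\<lambda>N. (\<Sum>n=1..N. f n ^ k) / of_nat N) \<longlonglongrightarrow> L"
    unfolding tendsto_complex_iff L_def
    using lim[of Re] lim[of Im] by (simp add: Re_divide_of_nat Im_divide_of_nat continuous_intros)
  \<comment> \<open>The empirical measure includes the index N, at which the mean in the conclusion
    stops short.\<close>
  have 2: "(\<lambda>N. f N ^ k / of_nat N) \<longlonglongrightarrow> 0"
  proof (rule Lim_null_comparison[OF always_eventually lim_inverse_n], intro allI)
    fix N
    have "cmod (f N) ^ k \<le> 1" using mult_class_norm_le[OF f] by (simp add: power_le_one)
    then have "cmod (f N) ^ k * inverse (real N) \<le> 1 * inverse (real N)" by (rule mult_right_mono) simp
    then show "cmod (f N ^ k / of_nat N) \<le> inverse (real N)"
      by (simp add: norm_divide norm_power inverse_eq_divide)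
  qed
  have "(\<lambda>N. (\<Sum>n=1..N. f n ^ k) / of_nat N - f N ^ k / of_nat N) \<longlonglongrightarrow> L - 0" by (intro tendsto_diff 1 2)
  moreover have "eventually (\<lambda>N. (\<Sum>n=1..N. f n ^ k) / of_nat N - f N ^ k / of_nat N = (\<Sum>n\<in>{1..<N}. f n ^ k) / of_nat N) sequentially"
    using eventually_gt_at_top[of 0]
  proof eventually_elim
    case (elim N)
    then have "{1..N} = insert N {1..<N}" by auto
    then show ?case by (simp add: diff_divide_distrib add_divide_distrib)
  qed
  ultimately have "(\<lambda>N. (\<Sum>n\<in>{1..<N}. f n ^ k) / of_nat N) \<longlonglongrightarrow> L - 0" by (rule Lim_transform_eventually)
  then show ?thesis by (intro that) simp
qed

context pretentious_to
begin

lemma norm_G_le: "cmod (G w K n) \<le> cmod (exp (- \<kappa> (\<Prod>(small_primes w))))"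
proof -
  have "cmod (f m) * cmod (chi n) * c \<le> 1 * 1 * c" if "c \<ge> 0" for m n c
    using that by (intro mult_mono norm_f norm_chi_le) auto
  then show ?thesis by (simp add: G_def norm_mult)
qed

text \<open>G alone may exceed 1 through its correcting factor; once N exceeds the square of the
  product of the small primes, exp (A N) contains the compensating factor.\<close>

lemma norm_G_exp_A_le:
  assumes "N \<ge> (\<Prod>(small_primes w)) * (\<Prod>(small_primes w))"
  shows "cmod (G w K n * exp (A N)) \<le> 1"
proof -
  define P where "P = \<Prod>(small_primes w)"
  have P0: "P > 0" unfolding P_def by (auto intro!: prod_pos small_primes_gt_0)
  have "cmod (G w K n * exp (A N)) \<le> cmod (exp (- \<kappa> P)) * cmod (exp (A N))"
    unfolding norm_mult P_def by (intro mult_right_mono norm_G_le) auto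
  also have "\<dots> = cmod (exp (- \<kappa> P) * exp (A N))" by (simp only: norm_mult)
  also have "exp (- \<kappa> P) * exp (A N) = exp (AQ P N)"
    using AQ_eq[OF P0, of N] assms by (simp add: P_def exp_add[symmetric])
  also have "cmod \<dots> \<le> 1" by (rule norm_exp_AQ_le)
  finally show ?thesis .
qed

text \<open>Compares sums over the window [N, N + N / j), where n^(it) is nearly N^(it): the sum T
  of f^k is close to L times the window length d, then f is replaced by its model (T2), the phase
  and A by their values at N (T3), and the periodic factor by its mean. The errors are 1, 1, 2 and 1
  fifths of \<open>\<delta> * d\<close>.\<close>

lemma power_mean_approximation:
  assumes k: "k > 0" "\<And>n. coprime n q \<Longrightarrow> chi n ^ k = 1"
    and L: "(\<lambda>N. (\<Sum>n\<in>{1..<N}. f n ^ k) / of_nat N) \<longlonglongrightarrow> L" and \<delta>: "\<delta> > 0"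
  shows "\<exists>w K0. \<forall>K\<ge>K0. eventually (\<lambda>N. cmod (L - exp (- \<kappa> (\<Prod>(small_primes w))) ^ k *
      ((\<Sum>n<(\<Prod>p\<in>small_primes w. p ^ K). U w K k n) / of_nat (\<Prod>p\<in>small_primes w. p ^ K)) * Z N ^ k) \<le> \<delta>) sequentially"
proof -
  \<comment> \<open>On the window the logarithm varies by at most 1 / j, and the k-th power
    multiplies the phase error by k; this j keeps the result below
    \<open>\<delta> / 5\<close>.\<close>
  obtain j :: nat where j: "real j > 5 * real k * \<bar>t\<bar> / \<delta> + 1" using reals_Archimedean2 by blast
  have "5 * real k * \<bar>t\<bar> / \<delta> \<ge> 0" using \<delta> by simp
  then have j1: "real j > 1" using j by linarith
  have tj: "real k * (\<bar>t\<bar> / real j) \<le> \<delta> / 5"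
  proof -
    have "5 * real k * \<bar>t\<bar> / \<delta> \<le> real j" using j by linarith
    then have "5 * real k * \<bar>t\<bar> \<le> real j * \<delta>" using \<delta> by (simp add: field_simps)
    then show ?thesis using j1 by (simp add: field_simps)
  qed
  \<comment> \<open>Estimates on initial segments are used on a window of length d >= N / (2 j)
    ending below 2 N: k \<open>\<epsilon>\<close> 2 N and \<open>\<epsilon>1\<close> 3 N are at most
    \<open>\<delta> / 5\<close> times d.\<close>
  define \<epsilon> where "\<epsilon> = \<delta> / (20 * real k * real j)"
  define \<epsilon>1 where "\<epsilon>1 = \<delta> / (30 * real j)"
  have \<epsilon>: "\<epsilon> > 0" "\<epsilon>1 > 0" using \<delta> k(1) j1 by (auto simp: \<epsilon>_def \<epsilon>1_def)
  obtain w where wq: "q \<le> w" and "\<exists>K0. \<forall>K\<ge>K0. eventually (\<lambda>N. (\<Sum>n\<in>{1..<N}. cmod (f n - G w K n * cis (t * ln (real n)) * exp (A N))) \<le> \<epsilon> * real N) sequentially"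
    by (rule periodic_approximation[OF \<epsilon>(1)]) blast
  then obtain K0 where K0: "\<And>K. K \<ge> K0 \<Longrightarrow> eventually (\<lambda>N. (\<Sum>n\<in>{1..<N}. cmod (f n - G w K n * cis (t * ln (real n)) * exp (A N))) \<le> \<epsilon> * real N) sequentially"
    by blast
  define P where "P = \<Prod>(small_primes w)"
  define X where "X = exp (- \<kappa> P)"
  have X1: "cmod X \<ge> 1" unfolding X_def by (rule norm_exp_\<kappa>)
  show ?thesis
  proof (rule exI[of _ w], rule exI[of _ K0], intro allI impI)
    fix K assume K: "K0 \<le> K"
    define D where "D = (\<Prod>p\<in>small_primes w. p ^ K)"
    define MU where "MU = (\<Sum>n<D. U w K k n) / of_nat D"
    have D0: "D > 0" unfolding D_def by (auto intro!: prod_pos small_primes_gt_0)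
    define N2 where "N2 N = N + N div j" for N
    have N2lim: "filterlim N2 at_top sequentially"
      by (rule filterlim_at_top_mono[OF filterlim_ident]) (auto simp: N2_def)
    have e1: "eventually (\<lambda>N. cmod ((\<Sum>n\<in>{1..<N}. f n ^ k) - L * of_nat N) \<le> \<epsilon>1 * real N) sequentially"
      using tendstoD[OF L \<epsilon>(2)] eventually_gt_at_top[of 0]
    proof eventually_elim
      case (elim N)
      have "(\<Sum>n\<in>{1..<N}. f n ^ k) - L * of_nat N = ((\<Sum>n\<in>{1..<N}. f n ^ k) / of_nat N - L) * of_nat N"
        using elim(2) by (simp add: field_simps)
      then have "cmod ((\<Sum>n\<in>{1..<N}. f n ^ k) - L * of_nat N) = dist ((\<Sum>n\<in>{1..<N}. f n ^ k) / of_nat N) L * real N"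
        by (simp add: norm_mult dist_norm)
      then show ?case using elim(1) by (simp add: mult_right_mono)
    qed
    have e1': "eventually (\<lambda>N. cmod ((\<Sum>n\<in>{1..<N2 N}. f n ^ k) - L * of_nat (N2 N)) \<le> \<epsilon>1 * real (N2 N)) sequentially"
      by (rule eventually_compose_filterlim[OF e1 N2lim])
    have e2: "eventually (\<lambda>N. (\<Sum>n\<in>{1..<N2 N}. cmod (f n - G w K n * cis (t * ln (real n)) * exp (A (N2 N)))) \<le> \<epsilon> * real (N2 N)) sequentially"
      by (rule eventually_compose_filterlim[OF K0[OF K] N2lim])
    have "\<delta> / (5 * real k * cmod X) > 0" using \<delta> k(1) X1 by (auto intro!: divide_pos_pos mult_pos_pos)
    then obtain N0 where N0: "\<And>N M. N \<ge> N0 \<Longrightarrow> N \<le> M \<Longrightarrow> real M \<le> 2 * real N \<Longrightarrow> cmod (A M - A N) \<le> \<delta> / (5 * real k * cmod X)"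
      using A_slow[of "\<delta> / (5 * real k * cmod X)" 2] by auto
    \<comment> \<open>Makes 4 D, the error of replacing U by its mean on an interval, at most
      \<open>\<delta> / 5\<close> times d.\<close>
    obtain N1 :: nat where N1: "real N1 > 40 * real D * real j / \<delta>" using reals_Archimedean2 by blast
    show "eventually (\<lambda>N. cmod (L - exp (- \<kappa> (\<Prod>(small_primes w))) ^ k *
      ((\<Sum>n<(\<Prod>p\<in>small_primes w. p ^ K). U w K k n) / of_nat (\<Prod>p\<in>small_primes w. p ^ K)) * Z N ^ k) \<le> \<delta>) sequentially"
      using e1 e1' e2 eventually_ge_at_top[of "P * P"] eventually_ge_at_top[of N0] eventually_ge_at_top[of "2 * j"] eventually_ge_at_top[of N1]
    proof eventually_elim
      case (elim N)
      define M where "M = N2 N"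
      define d where "d = N div j"
      have Md: "M = N + d" by (simp add: M_def N2_def d_def)
      have dN: "real d \<le> real N / real j" unfolding d_def by (rule of_nat_div_le_of_nat)
      have Npos: "N > 0" using elim(6) j1 by (cases N) auto
      have jd: "real N \<le> 2 * real j * real d"
      proof -
        have "N < (d + 1) * j" unfolding d_def using j1
          by (metis Suc_eq_plus1 dividend_less_div_times mult.commute mult_Suc add.commute gr0I not_one_less_zero of_nat_0)
        then have "real N < real ((d + 1) * j)" by (simp only: of_nat_less_iff)
        moreover have "real (2 * j) \<le> real N" using elim(6) by (simp only: of_nat_le_iff)
        ultimately show ?thesis by (simp add: algebra_simps)
      qed
      have d0: "real d > 0"
      proof (rule ccontr)
        assume "\<not> real d > 0"
        then show False using jd Npos by simp
      qed
      have M2: "real M \<le> 2 * real N"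
      proof -
        have "real N / real j \<le> real N / 1" using j1 by (intro divide_left_mono) auto
        then show ?thesis using dN by (simp add: Md)
      qed
      have sub: "(\<Sum>n\<in>{N..<M}. g n) = (\<Sum>n\<in>{1..<M}. g n) - (\<Sum>n\<in>{1..<N}. g n)" for g :: "nat \<Rightarrow> complex"
      proof -
        have "(\<Sum>n\<in>{1..<N}. g n) + (\<Sum>n\<in>{N..<M}. g n) = (\<Sum>n\<in>{1..<M}. g n)"
          using Npos by (intro sum.atLeastLessThan_concat) (auto simp: Md)
        then show ?thesis by (metis eq_diff_eq add.commute)
      qed
      define T where "T = (\<Sum>n\<in>{N..<M}. f n ^ k)"
      define T2 where "T2 = (\<Sum>n\<in>{N..<M}. (G w K n * cis (t * ln (real n)) * exp (A M)) ^ k)"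
      define T3 where "T3 = (\<Sum>n\<in>{N..<M}. (G w K n * Z N) ^ k)"
      have GN: "cmod (G w K n * exp (A N)) \<le> 1" "cmod (G w K n * exp (A M)) \<le> 1" for n
        using elim(4) by (auto intro!: norm_G_exp_A_le simp: P_def Md)
      have GN': "cmod (G w K n * cis (t * ln (real n)) * exp (A M)) \<le> 1" "cmod (G w K n * Z N) \<le> 1" for n
        using GN[of n] by (simp_all add: norm_mult Z_def)
      have 1: "cmod (L * of_nat d - T) \<le> \<delta> / 5 * real d"
      proof -
        have "L * of_nat d - T = ((\<Sum>n\<in>{1..<N}. f n ^ k) - L * of_nat N) - ((\<Sum>n\<in>{1..<M}. f n ^ k) - L * of_nat M)"
          unfolding T_def sub by (simp add: Md algebra_simps)
        also have "cmod \<dots> \<le> cmod ((\<Sum>n\<in>{1..<N}. f n ^ k) - L * of_nat N) + cmod ((\<Sum>n\<in>{1..<M}. f n ^ k) - L * of_nat M)"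
          by (rule norm_triangle_ineq4)
        also have "\<dots> \<le> \<epsilon>1 * real N + \<epsilon>1 * real M"
          using elim(1,2) unfolding M_def by (rule add_mono)
        also have "\<dots> \<le> \<epsilon>1 * (3 * real N)" using M2 \<epsilon>(2) by (simp add: distrib_left[symmetric])
        also have "\<dots> \<le> \<epsilon>1 * (3 * (2 * real j * real d))" using jd \<epsilon>(2) by (intro mult_left_mono) auto
        also have "\<dots> = \<delta> / 5 * real d" using j1 by (simp add: \<epsilon>1_def)
        finally show ?thesis .
      qed
      have 2: "cmod (T - T2) \<le> \<delta> / 5 * real d"
      proof -
        have "cmod (T - T2) \<le> (\<Sum>n\<in>{N..<M}. cmod (f n ^ k - (G w K n * cis (t * ln (real n)) * exp (A M)) ^ k))"
          unfolding T_def T2_def sum_subtractf[symmetric] by (rule norm_sum)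
        also have "\<dots> \<le> (\<Sum>n\<in>{N..<M}. real k * cmod (f n - G w K n * cis (t * ln (real n)) * exp (A M)))"
          by (intro sum_mono norm_power_diff norm_f GN')
        also have "\<dots> \<le> (\<Sum>n\<in>{1..<M}. real k * cmod (f n - G w K n * cis (t * ln (real n)) * exp (A M)))"
          using Npos by (intro sum_mono2) auto
        also have "\<dots> = real k * (\<Sum>n\<in>{1..<M}. cmod (f n - G w K n * cis (t * ln (real n)) * exp (A M)))"
          by (simp add: sum_distrib_left)
        also have "\<dots> \<le> real k * (\<epsilon> * real M)" using elim(3) by (intro mult_left_mono) (auto simp: M_def)
        also have "\<dots> \<le> real k * (\<epsilon> * (2 * (2 * real j * real d)))"
          using M2 jd \<epsilon>(1) by (intro mult_left_mono) auto
        also have "\<dots> = \<delta> / 5 * real d" using j1 k(1) by (simp add: \<epsilon>_def)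
        finally show ?thesis .
      qed
      have 3: "cmod (T2 - T3) \<le> 2 * \<delta> / 5 * real d"
      proof -
        have "cmod ((G w K n * cis (t * ln (real n)) * exp (A M)) ^ k - (G w K n * Z N) ^ k) \<le> 2 * \<delta> / 5" if n: "n \<in> {N..<M}" for n
        proof -
          have "G w K n * cis (t * ln (real n)) * exp (A M) - G w K n * Z N
            = (cis (t * ln (real n)) - cis (t * ln (real N))) * (G w K n * exp (A M)) + cis (t * ln (real N)) * (G w K n * (exp (A M) - exp (A N)))"
            by (simp add: Z_def algebra_simps)
          then have b0: "cmod (G w K n * cis (t * ln (real n)) * exp (A M) - G w K n * Z N) \<le> cmod ((cis (t * ln (real n)) - cis (t * ln (real N))) * (G w K n * exp (A M))) + cmod (cis (t * ln (real N)) * (G w K n * (exp (A M) - exp (A N))))"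
            by (simp only: norm_triangle_ineq)
          have b1: "cmod ((cis (t * ln (real n)) - cis (t * ln (real N))) * (G w K n * exp (A M))) \<le> \<bar>t\<bar> / real j * 1"
            unfolding norm_mult[of "cis (t * ln (real n)) - cis (t * ln (real N))"]
          proof (rule mult_mono[OF _ GN(2)])
            have "cmod (cis (t * ln (real n)) - cis (t * ln (real N))) \<le> \<bar>t * ln (real n) - t * ln (real N)\<bar>"
              by (rule norm_cis_diff_le)
            also have "\<dots> = \<bar>t\<bar> * \<bar>ln (real n) - ln (real N)\<bar>" by (simp only: abs_mult[symmetric] right_diff_distrib)
            also have "\<bar>ln (real n) - ln (real N)\<bar> = ln (real n / real N)" using n Npos by (simp add: ln_div)
            also have "\<dots> \<le> real n / real N - 1" using n Npos by (intro ln_le_minus_one) auto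
            also have "\<dots> \<le> 1 / real j"
            proof -
              have "real n \<le> real N + real d" using n Md by auto
              then have "real n \<le> real N + real N / real j" using dN by linarith
              then have "real n / real N \<le> (real N + real N / real j) / real N" by (rule divide_right_mono) simp
              also have "\<dots> = 1 + 1 / real j" using Npos by (simp add: add_divide_distrib)
              finally show ?thesis by simp
            qed
            finally show "cmod (cis (t * ln (real n)) - cis (t * ln (real N))) \<le> \<bar>t\<bar> / real j" by (simp add: mult_left_mono)
          qed auto
          have b2: "cmod (cis (t * ln (real N)) * (G w K n * (exp (A M) - exp (A N)))) \<le> cmod X * (\<delta> / (5 * real k * cmod X))"
            unfolding norm_mult
          proof -
            have "cmod (exp (A M) - exp (A N)) \<le> cmod (A M - A N)" by (intro exp_lipschitz_left_halfplane Re_A_le)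
            also have "\<dots> \<le> \<delta> / (5 * real k * cmod X)" using elim(5) M2 by (intro N0) (auto simp: Md)
            finally have "cmod (G w K n) * cmod (exp (A M) - exp (A N)) \<le> cmod X * (\<delta> / (5 * real k * cmod X))"
              using norm_G_le[of w K n] by (intro mult_mono) (auto simp: X_def P_def)
            then show "cmod (cis (t * ln (real N))) * (cmod (G w K n) * cmod (exp (A M) - exp (A N))) \<le> cmod X * (\<delta> / (5 * real k * cmod X))" by simp
          qed
          have "cmod X * (\<delta> / (5 * real k * cmod X)) = \<delta> / (5 * real k)" using X1 by auto
          then have "cmod (G w K n * cis (t * ln (real n)) * exp (A M) - G w K n * Z N) \<le> \<bar>t\<bar> / real j + \<delta> / (5 * real k)"
            using b0 b1 b2 by linarith
          then have "real k * cmod (G w K n * cis (t * ln (real n)) * exp (A M) - G w K n * Z N) \<le> real k * (\<bar>t\<bar> / real j + \<delta> / (5 * real k))"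
            by (rule mult_left_mono) simp
          also have "\<dots> \<le> 2 * \<delta> / 5" using tj k(1) by (simp add: distrib_left)
          finally show ?thesis
            using norm_power_diff[OF GN'(1)[of n] GN'(2)[of n], of k] by linarith
        qed
        then have "cmod (T2 - T3) \<le> of_nat (card {N..<M}) * (2 * \<delta> / 5)"
          unfolding T2_def T3_def sum_subtractf[symmetric] by (rule sum_norm_bound)
        then show ?thesis by (simp add: Md mult.commute)
      qed
      have 4: "cmod (T3 - of_nat d * (X ^ k * MU * Z N ^ k)) \<le> \<delta> / 5 * real d"
      proof -
        have "T3 = (X * Z N) ^ k * (\<Sum>n\<in>{N..<M}. U w K k n)"
          unfolding T3_def sum_distrib_left
        proof (rule sum.cong[OF refl])
          fix n assume "n \<in> {N..<M}"
          then have "n > 0" using Npos by auto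
          then show "(G w K n * Z N) ^ k = (X * Z N) ^ k * U w K k n"
            using G_power[OF wq _ k, of n K] by (simp add: power_mult_distrib X_def P_def)
        qed
        then have "T3 - of_nat d * (X ^ k * MU * Z N ^ k) = (X * Z N) ^ k * ((\<Sum>n\<in>{N..<M}. U w K k n) - of_nat (M - N) * MU)"
          by (simp add: Md power_mult_distrib algebra_simps)
        also have "cmod \<dots> \<le> 1 * (4 * real D)"
          unfolding norm_mult
        proof (rule mult_mono)
          have "X * exp (A N) = exp (AQ P N)"
            using AQ_eq[of P N] elim(4) by (simp add: X_def P_def exp_add[symmetric] prod_pos small_primes_gt_0)
          then have "X * Z N = exp (AQ P N) * cis (t * ln (real N))" by (simp only: Z_def mult.assoc[symmetric])
          then have "cmod (X * Z N) = cmod (exp (AQ P N))" by (simp only: norm_mult norm_cis mult_1_right)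
          then have "cmod (X * Z N) \<le> 1" using norm_exp_AQ_le[of P N] by (simp only:)
          then show "cmod ((X * Z N) ^ k) \<le> 1" unfolding norm_power by (simp add: power_le_one)
          show "cmod ((\<Sum>n\<in>{N..<M}. U w K k n) - of_nat (M - N) * MU) \<le> 4 * real D"
            unfolding MU_def by (rule periodic_sum_bound[OF D0 _ norm_U_le]) (auto simp: U_sum(2) D_def Md)
        qed auto
        also have "\<dots> \<le> \<delta> / 5 * real d"
        proof -
          have "40 * real D * real j / \<delta> < real N" using N1 elim(7) by linarith
          then have "40 * real D * real j < real N * \<delta>" using \<delta> by (simp add: field_simps)
          also have "\<dots> \<le> (2 * real j * real d) * \<delta>" using jd \<delta> by (intro mult_right_mono) auto
          finally have "real j * (40 * real D) < real j * (2 * real d * \<delta>)" by (simp add: mult_ac)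
          then show ?thesis using j1 by simp
        qed
        finally show ?thesis .
      qed
      have "cmod (of_nat d * (L - X ^ k * MU * Z N ^ k)) = cmod ((L * of_nat d - T) + (T - T2) + (T2 - T3) + (T3 - of_nat d * (X ^ k * MU * Z N ^ k)))"
        by (simp add: algebra_simps)
      also have "\<dots> \<le> cmod (L * of_nat d - T) + cmod (T - T2) + cmod (T2 - T3) + cmod (T3 - of_nat d * (X ^ k * MU * Z N ^ k))"
        by (intro norm_triangle_le add_mono norm_triangle_ineq order.refl)
      also have "\<dots> \<le> \<delta> * real d" using 1 2 3 4 by (simp add: field_simps)
      finally have "real d * cmod (L - X ^ k * MU * Z N ^ k) \<le> real d * \<delta>" by (simp add: norm_mult mult.commute)
      then show ?case using d0 by (simp add: X_def MU_def P_def D_def)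
    qed
  qed
qed

text \<open>For each \<open>\<delta>\<close> the numbers m Z(N)^k are eventually within
  \<open>\<delta>\<close> of L. Here m depends on \<open>\<delta>\<close>, but |m| >= c with c fixed
  beforehand, so Z^k is a Cauchy sequence.\<close>

lemma unique_furstenberg_imp_rap:
  assumes "unique_furstenberg f"
  shows "t = 0" "rap f"
proof -
  obtain k j where k: "k > 0" "\<And>n. coprime n q \<Longrightarrow> chi n ^ k = 1" and j: "j \<ge> 1" "Re (upow k (2 ^ j)) > -1"
    using character_order by blast
  obtain c where c: "c > 0" "\<And>w K. K > max j 2 \<Longrightarrow>
    cmod (\<Sum>n<(\<Prod>p\<in>small_primes w. p ^ K). U w K k n) \<ge> c * real (\<Prod>p\<in>small_primes w. p ^ K)"
    using U_mean_lower_bound[OF k j] by blast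
  obtain L where L: "(\<lambda>N. (\<Sum>n\<in>{1..<N}. f n ^ k) / of_nat N) \<longlonglongrightarrow> L"
    using unique_furstenberg_power_means[OF f assms] by blast
  have "Cauchy (\<lambda>N. Z N ^ k)"
  proof (rule metric_CauchyI)
    fix e :: real assume e: "e > 0"
    define \<delta> where "\<delta> = c * e / 3"
    have \<delta>: "\<delta> > 0" using c(1) e by (simp add: \<delta>_def)
    obtain w K0 where wK: "\<And>K. K \<ge> K0 \<Longrightarrow> eventually (\<lambda>N. cmod (L - exp (- \<kappa> (\<Prod>(small_primes w))) ^ k *
      ((\<Sum>n<(\<Prod>p\<in>small_primes w. p ^ K). U w K k n) / of_nat (\<Prod>p\<in>small_primes w. p ^ K)) * Z N ^ k) \<le> \<delta>) sequentially"
      using power_mean_approximation[OF k L \<delta>] by metis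
    define K where "K = K0 + j + 3"
    define D where "D = (\<Prod>p\<in>small_primes w. p ^ K)"
    have D0: "D > 0" unfolding D_def by (auto intro!: prod_pos small_primes_gt_0)
    define m where "m = exp (- \<kappa> (\<Prod>(small_primes w))) ^ k * ((\<Sum>n<D. U w K k n) / of_nat D)"
    have "1 * c \<le> cmod m"
      unfolding m_def norm_mult
    proof (rule mult_mono)
      show "1 \<le> cmod (exp (- \<kappa> (\<Prod>(small_primes w))) ^ k)" unfolding norm_power by (intro one_le_power norm_exp_\<kappa>)
      have "c * real D \<le> cmod (\<Sum>n<D. U w K k n)" unfolding D_def by (rule c(2)) (simp add: K_def)
      then show "c \<le> cmod ((\<Sum>n<D. U w K k n) / of_nat D)" using D0 by (simp add: norm_divide field_simps)
    qed (use c in auto)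
    then have mc: "c \<le> cmod m" by simp
    have "eventually (\<lambda>N. cmod (L - m * Z N ^ k) \<le> \<delta>) sequentially"
      using wK[of K] by (simp add: m_def D_def K_def)
    then obtain N0 where N0: "\<And>N. N \<ge> N0 \<Longrightarrow> cmod (L - m * Z N ^ k) \<le> \<delta>" by (auto simp: eventually_sequentially)
    show "\<exists>M. \<forall>a\<ge>M. \<forall>b\<ge>M. dist (Z a ^ k) (Z b ^ k) < e"
    proof (intro exI[of _ N0] allI impI)
      fix a b assume "N0 \<le> a" "N0 \<le> b"
      have "c * cmod (Z a ^ k - Z b ^ k) \<le> cmod m * cmod (Z a ^ k - Z b ^ k)" by (intro mult_right_mono mc) auto
      also have "\<dots> = cmod ((L - m * Z b ^ k) - (L - m * Z a ^ k))" by (simp add: norm_mult[symmetric] algebra_simps)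
      also have "\<dots> \<le> cmod (L - m * Z b ^ k) + cmod (L - m * Z a ^ k)" by (rule norm_triangle_ineq4)
      also have "\<dots> \<le> \<delta> + \<delta>" using N0[OF \<open>N0 \<le> b\<close>] N0[OF \<open>N0 \<le> a\<close>] by (rule add_mono)
      also have "\<dots> < c * e" using c(1) e by (simp add: \<delta>_def)
      finally show "dist (Z a ^ k) (Z b ^ k) < e" using c(1) by (simp add: dist_norm)
    qed
  qed
  then have conv: "convergent (\<lambda>N. Z N ^ k)" by (simp add: Cauchy_convergent_iff)
  show t0: "t = 0" by (rule Z_power_convergent(1)[OF k(1) conv])
  show "rap f" by (rule rap_if_convergent[OF t0 Z_power_convergent(2)[OF k(1) conv]])
qed

end

section \<open>Rationally almost periodic functions have a unique Furstenberg system\<close>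

definition unit_measure :: "real measure" where "unit_measure = restrict_space lborel {0..<1}"

lemma space_unit_measure [simp]: "space unit_measure = {0..<1}"
  by (simp add: unit_measure_def space_restrict_space)

lemma prob_space_unit_measure: "prob_space unit_measure"
  by (rule prob_spaceI) (simp add: unit_measure_def space_restrict_space emeasure_restrict_space)

lemma measurable_floor_index: "(\<lambda>x::real. nat \<lfloor>x * c\<rfloor>) \<in> measurable unit_measure (count_space UNIV)"
  unfolding unit_measure_def by (intro measurable_restrict_space1) measurable

lemma floor_index_less:
  assumes "x \<in> {0..<1::real}" "Q > 0"
  shows "nat \<lfloor>x * real Q\<rfloor> < Q"
proof -
  have "x * real Q < 1 * real Q" using assms by (intro mult_strict_right_mono) auto
  then have "\<lfloor>x * real Q\<rfloor> < int Q" by (simp add: floor_less_iff)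
  then show ?thesis using assms(2) by linarith
qed

lemma integral_floor_index:
  fixes \<Phi> :: "nat \<Rightarrow> real"
  assumes Q: "Q > 0"
  shows "(\<integral>x. \<Phi> (nat \<lfloor>x * real Q\<rfloor>) \<partial>unit_measure) = (\<Sum>i<Q. \<Phi> i) / real Q"
proof -
  have pt: "indicator {0..<1} x *\<^sub>R \<Phi> (nat \<lfloor>x * real Q\<rfloor>) = (\<Sum>i<Q. \<Phi> i * indicator {real i / real Q..<real (Suc i) / real Q} x)" for x
  proof (cases "x \<in> {0..<1}")
    case True
    define i0 where "i0 = nat \<lfloor>x * real Q\<rfloor>"
    have i0: "i0 < Q" unfolding i0_def by (rule floor_index_less[OF True Q])
    have ind: "x \<in> {real i / real Q..<real (Suc i) / real Q} \<longleftrightarrow> i = i0" for i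
    proof -
      have "x \<in> {real i / real Q..<real (Suc i) / real Q} \<longleftrightarrow> real i \<le> x * real Q \<and> x * real Q < real i + 1"
        using Q by (simp add: field_simps)
      also have "\<dots> \<longleftrightarrow> \<lfloor>x * real Q\<rfloor> = int i" by (simp add: floor_eq_iff)
      also have "\<dots> \<longleftrightarrow> i = i0" using True by (auto simp: i0_def)
      finally show ?thesis .
    qed
    have "(\<Sum>i<Q. \<Phi> i * indicator {real i / real Q..<real (Suc i) / real Q} x) = (\<Sum>i<Q. if i = i0 then \<Phi> i else 0)"
      by (intro sum.cong refl) (simp add: indicator_def ind del: atLeastLessThan_iff of_nat_Suc)
    also have "\<dots> = \<Phi> i0" using i0 by simp
    finally show ?thesis using True by (simp add: i0_def)
  next
    case False
    have "x \<notin> {real i / real Q..<real (Suc i) / real Q}" if "i < Q" for i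
    proof
      assume x: "x \<in> {real i / real Q..<real (Suc i) / real Q}"
      have "real (Suc i) / real Q \<le> 1" using that Q by (simp add: field_simps)
      moreover have "0 \<le> real i / real Q" by simp
      ultimately show False using x False by (simp only: atLeastLessThan_iff) linarith
    qed
    then have "(\<Sum>i<Q. \<Phi> i * indicator {real i / real Q..<real (Suc i) / real Q} x) = 0"
      by (intro sum.neutral ballI) (simp del: of_nat_Suc atLeastLessThan_iff)
    then show ?thesis using False by (simp del: of_nat_Suc)
  qed
  have "(\<integral>x. \<Phi> (nat \<lfloor>x * real Q\<rfloor>) \<partial>unit_measure) = (\<integral>x. indicator {0..<1} x *\<^sub>R \<Phi> (nat \<lfloor>x * real Q\<rfloor>) \<partial>lborel)"
    unfolding unit_measure_def by (rule integral_restrict_space) simp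
  also have "\<dots> = (\<integral>x. (\<Sum>i<Q. \<Phi> i * indicator {real i / real Q..<real (Suc i) / real Q} x) \<partial>lborel)"
    by (simp only: pt)
  also have "\<dots> = (\<Sum>i<Q. \<integral>x. \<Phi> i * indicator {real i / real Q..<real (Suc i) / real Q} x \<partial>lborel)"
    by (rule Bochner_Integration.integral_sum) (intro integrable_mult_right integrable_real_indicator; simp add: divide_right_mono)
  also have "\<dots> = (\<Sum>i<Q. \<Phi> i * (1 / real Q))"
  proof (intro sum.cong refl)
    fix i
    have "real i / real Q \<le> real (Suc i) / real Q" by (intro divide_right_mono) auto
    then have "measure lborel {real i / real Q..<real (Suc i) / real Q} = real (Suc i) / real Q - real i / real Q"
      by (simp add: measure_def)
    also have "\<dots> = 1 / real Q" using Q by (simp add: field_simps)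
    finally show "(\<integral>x. \<Phi> i * indicator {real i / real Q..<real (Suc i) / real Q} x \<partial>lborel) = \<Phi> i * (1 / real Q)"
      by simp
  qed
  finally show ?thesis by (simp add: sum_divide_distrib)
qed

text \<open>Mixed radix expansion with digits modulo Q (k + 1) / Q k. Truncating the floor of x Q (k
  + 1) drops the last digit by division, whereas compatible residues must drop the most significant
  one by reduction modulo Q k; reversing the digits exchanges the two.\<close>

fun digit_reversal :: "(nat \<Rightarrow> nat) \<Rightarrow> nat \<Rightarrow> nat \<Rightarrow> nat" where
  "digit_reversal Q 0 m = m"
| "digit_reversal Q (Suc k) m = digit_reversal Q k (m div (Q (Suc k) div Q k)) + Q k * (m mod (Q (Suc k) div Q k))"

text \<open>
  A uniformly distributed point of the profinite completion: the residues \<open>profinite_residue Q k x\<close>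
  modulo \<open>Q k\<close> are uniform and compatible with each other when \<open>x\<close> is uniform in the unit interval.
\<close>

definition profinite_residue :: "(nat \<Rightarrow> nat) \<Rightarrow> nat \<Rightarrow> real \<Rightarrow> nat" where
  "profinite_residue Q k x = digit_reversal Q k (nat \<lfloor>x * real (Q k)\<rfloor>)"

context
  fixes Q :: "nat \<Rightarrow> nat"
  assumes Q0: "\<And>k. Q k > 0" and Qd: "\<And>k. Q k dvd Q (Suc k)"
begin

lemma ratio_pos: "Q (Suc k) div Q k > 0"
  using Q0[of k] Q0[of "Suc k"] Qd[of k] by (simp add: div_greater_zero_iff dvd_imp_le)

lemma ratio_mult: "Q k * (Q (Suc k) div Q k) = Q (Suc k)"
  using Qd[of k] by simp

lemma digit_reversal_less: "m < Q k \<Longrightarrow> digit_reversal Q k m < Q k"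
proof (induction k arbitrary: m)
  case (Suc k)
  define r where "r = Q (Suc k) div Q k"
  have r0: "r > 0" unfolding r_def by (rule ratio_pos)
  have Qr: "Q (Suc k) = Q k * r" unfolding r_def by (rule ratio_mult[symmetric])
  have "m div r < Q k" using Suc.prems Qr by (simp add: less_mult_imp_div_less)
  then have 1: "digit_reversal Q k (m div r) < Q k" by (rule Suc.IH)
  have "m mod r + 1 \<le> r" using r0 by (simp add: Suc_le_eq)
  then have "Q k * (m mod r + 1) \<le> Q k * r" by (rule mult_le_mono2)
  then show ?case using 1 by (simp add: r_def[symmetric] Qr)
qed auto

lemma digit_reversal_mod:
  assumes "m < Q (Suc k)"
  shows "digit_reversal Q (Suc k) m mod Q k = digit_reversal Q k (m div (Q (Suc k) div Q k))"
    "digit_reversal Q (Suc k) m div Q k = m mod (Q (Suc k) div Q k)"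
proof -
  have "m div (Q (Suc k) div Q k) < Q k"
    using assms ratio_mult[of k] by (simp add: less_mult_imp_div_less)
  then have "digit_reversal Q k (m div (Q (Suc k) div Q k)) < Q k" by (rule digit_reversal_less)
  then show "digit_reversal Q (Suc k) m mod Q k = digit_reversal Q k (m div (Q (Suc k) div Q k))"
    "digit_reversal Q (Suc k) m div Q k = m mod (Q (Suc k) div Q k)" using Q0[of k] by simp_all
qed

lemma digit_reversal_bij: "bij_betw (digit_reversal Q k) {..<Q k} {..<Q k}"
proof -
  have inj: "inj_on (digit_reversal Q k) {..<Q k}"
  proof (induction k)
    case (Suc k)
    define r where "r = Q (Suc k) div Q k"
    show ?case
    proof (rule inj_onI)
      fix m n assume mn: "m \<in> {..<Q (Suc k)}" "n \<in> {..<Q (Suc k)}" and eq: "digit_reversal Q (Suc k) m = digit_reversal Q (Suc k) n"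
      have "digit_reversal Q k (m div r) = digit_reversal Q k (n div r)" "m mod r = n mod r"
        using digit_reversal_mod[of m k] digit_reversal_mod[of n k] mn eq by (auto simp: r_def)
      moreover have "m div r < Q k" "n div r < Q k"
        using mn ratio_mult[of k] by (auto simp: less_mult_imp_div_less r_def)
      ultimately have "m div r = n div r" "m mod r = n mod r" using Suc by (auto simp: inj_on_def)
      then show "m = n" by (metis div_mult_mod_eq)
    qed
  qed auto
  moreover have "digit_reversal Q k ` {..<Q k} \<subseteq> {..<Q k}" using digit_reversal_less by auto
  ultimately show ?thesis using endo_inj_surj[of "{..<Q k}"] by (auto simp: bij_betw_def)
qed

lemma profinite_residue_compatible:
  assumes "x \<in> {0..<1}"
  shows "profinite_residue Q (Suc k) x mod Q k = profinite_residue Q k x"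
proof -
  define r where "r = Q (Suc k) div Q k"
  have r0: "r > 0" unfolding r_def by (rule ratio_pos)
  have Qr: "Q (Suc k) = Q k * r" unfolding r_def by (rule ratio_mult[symmetric])
  have "\<lfloor>x * real (Q k)\<rfloor> = \<lfloor>x * real (Q (Suc k)) / real_of_int (int r)\<rfloor>"
    using r0 by (simp add: Qr)
  also have "\<dots> = \<lfloor>x * real (Q (Suc k))\<rfloor> div int r" by (rule floor_divide_real_eq_div) simp
  finally have "nat \<lfloor>x * real (Q k)\<rfloor> = nat \<lfloor>x * real (Q (Suc k))\<rfloor> div r"
    using assms by (simp add: nat_div_distrib)
  then show ?thesis
    unfolding profinite_residue_def digit_reversal_mod(1)[OF floor_index_less[OF assms Q0]] by (simp add: r_def)
qed

lemma integral_profinite_residue: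
  fixes \<Phi> :: "nat \<Rightarrow> real"
  shows "(\<integral>x. \<Phi> (profinite_residue Q k x) \<partial>unit_measure) = (\<Sum>i<Q k. \<Phi> i) / real (Q k)"
proof -
  have "(\<integral>x. \<Phi> (profinite_residue Q k x) \<partial>unit_measure) = (\<Sum>i<Q k. \<Phi> (digit_reversal Q k i)) / real (Q k)"
    unfolding profinite_residue_def by (rule integral_floor_index[OF Q0])
  also have "(\<Sum>i<Q k. \<Phi> (digit_reversal Q k i)) = (\<Sum>i<Q k. \<Phi> i)"
    by (rule sum.reindex_bij_betw[OF digit_reversal_bij])
  finally show ?thesis .
qed

lemma measurable_profinite_residue: "profinite_residue Q k \<in> measurable unit_measure (count_space UNIV)"
  unfolding profinite_residue_def[abs_def] by (rule measurable_compose[OF measurable_floor_index]) simp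

end

section \<open>Periodic approximants, compactness and averages along shifts\<close>

lemma periodic_int_shift:
  fixes d :: "int \<Rightarrow> real"
  assumes "\<And>i. d (i + int q) = d i"
  shows "(\<Sum>i<q. d (int i + j)) = (\<Sum>i<q. d (int i))"
proof -
  have step: "(\<Sum>i<q. d (int i + (j + 1))) = (\<Sum>i<q. d (int i + j))" for j
  proof -
    have "(\<Sum>i<q. d (int i + (j + 1))) + d j = (\<Sum>i<Suc q. d (int i + j))"
      by (subst sum.lessThan_Suc_shift) (simp add: algebra_simps)
    also have "\<dots> = (\<Sum>i<q. d (int i + j)) + d j" using assms[of j] by (simp add: add.commute)
    finally show ?thesis by simp
  qed
  show ?thesis
  proof (induction j rule: int_induct[where k = 0])
    case (step2 i)
    then show ?case using step[of "i - 1"] by simp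
  qed (simp_all add: step)
qed

lemma periodic_int_mod:
  fixes g :: "int \<Rightarrow> 'a"
  assumes "\<And>i. g (i + int q) = g i"
  shows "g (i + int q * j) = g i"
proof (induction j rule: int_induct[where k = 0])
  case (step1 j)
  then show ?case using assms[of "i + int q * j"] by (simp add: algebra_simps)
next
  case (step2 j)
  then show ?case using assms[of "i + int q * (j - 1)"] by (simp add: algebra_simps)
qed simp

lemma rap_approximants:
  assumes fb: "\<And>n. cmod (f n) \<le> 1" and rap: "rap f"
  obtains G :: "nat \<Rightarrow> int \<Rightarrow> complex" and Q :: "nat \<Rightarrow> nat" where
    "\<And>k. Q k > 0" "\<And>k. Q k dvd Q (Suc k)" "\<And>k i. G k (i + int (Q k)) = G k i" "\<And>k i. cmod (G k i) \<le> 1"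
    "\<And>k. eventually (\<lambda>N. (\<Sum>n\<in>{1..<N}. cmod (f n - G k (int n))) \<le> (1 / 2) ^ k * real N) sequentially"
proof -
  have ex: "\<exists>gq. snd gq \<ge> 1 \<and> (\<forall>n\<ge>1. fst gq (n + snd gq) = fst gq n) \<and> limsup (\<lambda>N. ereal (1 / real N * (\<Sum>n\<in>{1..<N}. cmod (f n - fst gq n)))) < ereal ((1 / 2) ^ k)" for k :: nat
  proof -
    have "(1 / 2) ^ k > (0::real)" by simp
    then obtain g where "periodic_seq g" "limsup (\<lambda>N. ereal (1 / real N * (\<Sum>n\<in>{1..<N}. cmod (f n - g n)))) < ereal ((1 / 2) ^ k)"
      using rap unfolding rap_def by blast
    then obtain q where "q \<ge> 1" "\<forall>n\<ge>1. g (n + q) = g n" unfolding periodic_seq_def by blast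
    then show ?thesis
      using \<open>limsup (\<lambda>N. ereal (1 / real N * (\<Sum>n\<in>{1..<N}. cmod (f n - g n)))) < ereal ((1 / 2) ^ k)\<close>
      by (intro exI[of _ "(g, q)"]) simp
  qed
  from choice[OF allI[OF ex]] obtain gq where gq: "\<forall>k. snd (gq k) \<ge> 1 \<and> (\<forall>n\<ge>1. fst (gq k) (n + snd (gq k)) = fst (gq k) n) \<and>
      limsup (\<lambda>N. ereal (1 / real N * (\<Sum>n\<in>{1..<N}. cmod (f n - fst (gq k) n)))) < ereal ((1 / 2) ^ k)" ..
  define g where "g k = fst (gq k)" for k
  define q where "q k = snd (gq k)" for k
  have q: "\<And>k. q k \<ge> 1" and per: "\<And>k n. n \<ge> 1 \<Longrightarrow> g k (n + q k) = g k n"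
    and lim: "\<And>k. limsup (\<lambda>N. ereal (1 / real N * (\<Sum>n\<in>{1..<N}. cmod (f n - g k n)))) < ereal ((1 / 2) ^ k)"
    using gq unfolding g_def q_def by auto
  \<comment> \<open>Partial products of the periods, which form a divisibility chain.\<close>
  define Q where "Q k = (\<Prod>i\<le>k. q i)" for k
  \<comment> \<open>Nearest-point projection to the disc: it fixes the values of f and is
    1-Lipschitz, so the approximation does not get worse.\<close>
  define clip :: "complex \<Rightarrow> complex" where "clip = closest_point (cball 0 1)"
  have clip_le: "cmod (clip z) \<le> 1" for z
    using closest_point_in_set[of "cball 0 (1::real)" z] by (simp add: clip_def)
  have clip_lip: "cmod (z - clip w) \<le> cmod (z - w)" if "cmod z \<le> 1" for z w
  proof -
    have "clip z = z" unfolding clip_def using that by (intro closest_point_self) simp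
    moreover have "dist (clip z) (clip w) \<le> dist z w"
      unfolding clip_def by (rule closest_point_lipschitz) auto
    ultimately show ?thesis by (simp add: dist_norm)
  qed
  \<comment> \<open>Extends the approximant periodically to all integers. The added q k keeps the
    argument positive, since the given period is valid from 1 on.\<close>
  define G where "G k i = clip (g k (nat (i mod int (q k)) + q k))" for k i
  have Gg: "G k (int n) = clip (g k n)" if "n \<ge> 1" for k n
  proof -
    have l: "g k (m + l * q k) = g k m" if "m \<ge> 1" for m l
    proof (induction l)
      case (Suc l)
      have "g k (m + Suc l * q k) = g k ((m + l * q k) + q k)" by (simp add: algebra_simps)
      then show ?case using Suc per[of "m + l * q k" k] that by simp
    qed auto
    have "g k n = g k (n + q k)" using per[OF that] by simp
    also have "n + q k = (n mod q k + q k) + (n div q k) * q k" by simp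
    also have "g k \<dots> = g k (n mod q k + q k)" using q[of k] by (intro l) auto
    finally show ?thesis by (simp add: G_def zmod_int[symmetric])
  qed
  show ?thesis
  proof (rule that[of Q G])
    show Q0: "Q k > 0" for k unfolding Q_def using q by (intro prod_pos) (simp add: Suc_le_eq)
    show "Q k dvd Q (Suc k)" for k by (simp add: Q_def)
    show "cmod (G k i) \<le> 1" for k i unfolding G_def by (rule clip_le)
    show "G k (i + int (Q k)) = G k i" for k i
    proof -
      have "q k dvd Q k" unfolding Q_def by (intro dvd_prodI) auto
      then have "int (q k) dvd int (Q k)" by simp
      then have "(i + int (Q k)) mod int (q k) = i mod int (q k)" by (metis add.right_neutral dvd_imp_mod_0 mod_add_right_eq)
      then show ?thesis by (simp add: G_def)
    qed
    show "eventually (\<lambda>N. (\<Sum>n\<in>{1..<N}. cmod (f n - G k (int n))) \<le> (1 / 2) ^ k * real N) sequentially" for k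
    proof -
      have "eventually (\<lambda>N. ereal (1 / real N * (\<Sum>n\<in>{1..<N}. cmod (f n - g k n))) < ereal ((1 / 2) ^ k)) sequentially"
        using Limsup_le_iff[THEN iffD1, OF order_refl, rule_format, OF lim[of k]] .
      then show ?thesis using eventually_gt_at_top[of 0]
      proof eventually_elim
        case (elim N)
        have "(\<Sum>n\<in>{1..<N}. cmod (f n - G k (int n))) \<le> (\<Sum>n\<in>{1..<N}. cmod (f n - g k n))"
          using clip_lip[OF fb] by (intro sum_mono) (simp add: Gg)
        also have "\<dots> \<le> (1 / 2) ^ k * real N" using elim by (simp add: field_simps)
        finally show ?case .
      qed
    qed
  qed
qed

lemma compact_disc_seqs: "compact disc_seqs"
proof -
  have "disc_seqs = PiE UNIV (\<lambda>_. cball 0 1)" by (auto simp: disc_seqs_def PiE_def)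
  moreover have "compactin (product_topology (\<lambda>_::int. euclidean :: complex topology) UNIV) (PiE UNIV (\<lambda>_. cball 0 1))"
    by (subst compactin_PiE) auto
  ultimately show ?thesis by (simp add: euclidean_product_topology)
qed

lemma tendsto_coordinatewise_fun:
  fixes x :: "nat \<Rightarrow> int \<Rightarrow> complex"
  assumes "\<And>j. (\<lambda>k. x k j) \<longlonglongrightarrow> l j"
  shows "x \<longlonglongrightarrow> l"
proof -
  have "limitin (product_topology (\<lambda>_::int. euclidean :: complex topology) UNIV) x l sequentially"
    unfolding limitin_componentwise using assms by simp
  then show ?thesis by (simp add: euclidean_product_topology)
qed

text \<open>Uniform continuity on a compact space. The product metric is at most twice the maximal
  distance over the coordinates enumerated up to N plus (1/2)^N, so d / 4 per coordinate and a tail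
  below d / 2 suffice.\<close>

lemma disc_seqs_finite_modulus:
  fixes F :: "(int \<Rightarrow> complex) \<Rightarrow> real"
  assumes F: "continuous_on disc_seqs F" and e: "e > 0"
  obtains J :: "int set" and \<delta> where "finite J" "\<delta> > 0"
    "\<And>x y. x \<in> disc_seqs \<Longrightarrow> y \<in> disc_seqs \<Longrightarrow> (\<And>j. j \<in> J \<Longrightarrow> cmod (x j - y j) < \<delta>) \<Longrightarrow> \<bar>F x - F y\<bar> < e"
proof -
  have "uniformly_continuous_on disc_seqs F" using F compact_disc_seqs by (rule compact_uniformly_continuous)
  then obtain d where d: "d > 0" "\<And>x y. x \<in> disc_seqs \<Longrightarrow> y \<in> disc_seqs \<Longrightarrow> dist y x < d \<Longrightarrow> dist (F y) (F x) < e"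
    using e unfolding uniformly_continuous_on_def by metis
  have "(\<lambda>N. (1 / 2 :: real) ^ N) \<longlonglongrightarrow> 0" by (rule LIMSEQ_realpow_zero) auto
  then have "eventually (\<lambda>N. (1 / 2 :: real) ^ N < d / 2) sequentially"
    by (rule order_tendstoD(2)) (use d in simp)
  then obtain N where N: "(1 / 2 :: real) ^ N < d / 2" by (auto simp: eventually_sequentially)
  show ?thesis
  proof (rule that[of "from_nat ` {..N}" "d / 4"])
    show "d / 4 > 0" using d by simp
    fix x y :: "int \<Rightarrow> complex"
    assume xy: "x \<in> disc_seqs" "y \<in> disc_seqs" and close: "\<And>j. j \<in> from_nat ` {..N} \<Longrightarrow> cmod (x j - y j) < d / 4"
    have set: "{dist (x (from_nat n)) (y (from_nat n)) |n. n \<le> N} = (\<lambda>n. dist (x (from_nat n)) (y (from_nat n))) ` {..N}" by auto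
    have "Max {dist (x (from_nat n)) (y (from_nat n)) |n. n \<le> N} < d / 4"
      unfolding set using close by (subst Max_less_iff) (auto simp: dist_norm)
    then have "dist x y < d" using dist_fun_le_dist_first_terms[of x y N] N by linarith
    then show "\<bar>F x - F y\<bar> < e" using d(2)[OF xy(2,1)] by (simp add: dist_real_def)
  qed auto
qed

lemma nat_periodic_block_sum:
  fixes d :: "nat \<Rightarrow> real"
  assumes "\<And>n. d (n + q) = d n"
  shows "(\<Sum>n<k * q. d n) = real k * (\<Sum>n<q. d n)"
proof (induction k)
  case (Suc k)
  have per: "d (k * q + i) = d i" for i
    using periodic_mod[of d q "k * q + i", OF assms] periodic_mod[of d q i, OF assms] by simp
  have "(\<Sum>n<Suc k * q. d n) = (\<Sum>n<k * q. d n) + (\<Sum>n\<in>{k * q..<k * q + q}. d n)"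
    using sum.atLeastLessThan_concat[of 0 "k * q" "k * q + q" d] by (simp add: lessThan_atLeast0 add.commute)
  also have "(\<Sum>n\<in>{k * q..<k * q + q}. d n) = (\<Sum>i<q. d (k * q + i))"
    using sum.shift_bounds_nat_ivl[of d 0 "k * q" q] by (simp add: lessThan_atLeast0 add.commute)
  finally show ?case using Suc per by (simp add: algebra_simps)
qed simp

lemma periodic_average_tendsto:
  fixes d :: "nat \<Rightarrow> real"
  assumes q: "q > 0" and per: "\<And>n. d (n + q) = d n"
  shows "(\<lambda>N. (\<Sum>n=1..N. d n) / real N) \<longlonglongrightarrow> (\<Sum>n<q. d n) / real q"
proof -
  define B where "B = Max ((\<lambda>n. \<bar>d n\<bar>) ` {..<q}) + 1"
  have dB: "\<bar>d n\<bar> \<le> B" for n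
  proof -
    have "\<bar>d (n mod q)\<bar> \<le> Max ((\<lambda>n. \<bar>d n\<bar>) ` {..<q})" using q by (intro Max_ge) auto
    then show ?thesis using periodic_mod[of d q n, OF per] by (simp add: B_def)
  qed
  have B0: "B > 0"
  proof -
    have "0 \<le> \<bar>d 0\<bar>" by simp
    also have "\<dots> \<le> Max ((\<lambda>n. \<bar>d n\<bar>) ` {..<q})" using q by (intro Max_ge) auto
    finally show ?thesis by (simp add: B_def)
  qed
  \<comment> \<open>Rescaled to modulus at most 1, as the estimate for sums over intervals
    requires.\<close>
  define g where "g n = complex_of_real (d n / B)" for n
  have bd: "\<bar>(\<Sum>n=1..N. d n) - real N * ((\<Sum>n<q. d n) / real q)\<bar> \<le> 4 * real q * B" for N
  proof -
    have "cmod ((\<Sum>n\<in>{1..<Suc N}. g n) - of_nat (Suc N - 1) * ((\<Sum>n<q. g n) / of_nat q)) \<le> 4 * real q"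
      by (rule periodic_sum_bound[OF q]) (use dB B0 in \<open>auto simp: g_def per norm_divide\<close>)
    also have "(\<Sum>n\<in>{1..<Suc N}. g n) - of_nat (Suc N - 1) * ((\<Sum>n<q. g n) / of_nat q)
      = complex_of_real (((\<Sum>n=1..N. d n) - real N * ((\<Sum>n<q. d n) / real q)) / B)"
      unfolding g_def atLeastLessThanSuc_atLeastAtMost
      by (simp add: sum_divide_distrib[symmetric] diff_divide_distrib mult.commute)
    finally show ?thesis using B0 by (simp add: norm_divide field_simps del: of_real_diff of_real_mult of_real_divide of_real_sum)
  qed
  have "(\<lambda>N. 4 * real q * B / real N) \<longlonglongrightarrow> 0" by real_asymp
  then have "(\<lambda>N. (\<Sum>n=1..N. d n) / real N - (\<Sum>n<q. d n) / real q) \<longlonglongrightarrow> 0"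
  proof (rule Lim_null_comparison[rotated])
    show "eventually (\<lambda>N. norm ((\<Sum>n=1..N. d n) / real N - (\<Sum>n<q. d n) / real q) \<le> 4 * real q * B / real N) sequentially"
      using eventually_gt_at_top[of 0]
    proof eventually_elim
      case (elim N)
      have "(\<Sum>n=1..N. d n) / real N - (\<Sum>n<q. d n) / real q = ((\<Sum>n=1..N. d n) - real N * ((\<Sum>n<q. d n) / real q)) / real N"
        using elim by (simp add: diff_divide_distrib)
      then have "norm ((\<Sum>n=1..N. d n) / real N - (\<Sum>n<q. d n) / real q) = \<bar>(\<Sum>n=1..N. d n) - real N * ((\<Sum>n<q. d n) / real q)\<bar> / real N"
        by (simp add: abs_divide)
      also have "\<dots> \<le> 4 * real q * B / real N" using bd by (intro divide_right_mono) auto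
      finally show ?case .
    qed
  qed
  then show ?thesis using LIM_zero_iff by blast
qed

text \<open>At most |j| of the shifted indices are nonpositive, each contributing at most 2; the
  others are distinct and positive.\<close>

lemma shifted_sum_le:
  fixes \<psi> :: "int \<Rightarrow> real"
  assumes "\<And>i. 0 \<le> \<psi> i" "\<And>i. \<psi> i \<le> 2"
  shows "(\<Sum>n=1..N. \<psi> (int n + j)) \<le> 2 * real (nat \<bar>j\<bar>) + (\<Sum>m\<in>{1..<N + nat \<bar>j\<bar> + 1}. \<psi> (int m))"
proof -
  define S1 where "S1 = {n \<in> {1..N}. int n + j \<le> 0}"
  define S2 where "S2 = {n \<in> {1..N}. \<not> int n + j \<le> 0}"
  have "(\<Sum>n=1..N. \<psi> (int n + j)) = (\<Sum>n\<in>S1. \<psi> (int n + j)) + (\<Sum>n\<in>S2. \<psi> (int n + j))"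
    by (subst sum.union_disjoint[symmetric]) (auto simp: S1_def S2_def intro!: sum.cong)
  also have "(\<Sum>n\<in>S1. \<psi> (int n + j)) \<le> 2 * real (nat \<bar>j\<bar>)"
  proof -
    have "S1 \<subseteq> {1..nat \<bar>j\<bar>}" by (auto simp: S1_def)
    then have "card S1 \<le> nat \<bar>j\<bar>" using card_mono[of "{1..nat \<bar>j\<bar>}" S1] by simp
    have "(\<Sum>n\<in>S1. \<psi> (int n + j)) \<le> (\<Sum>n\<in>S1. 2)" using assms(2) by (intro sum_mono)
    also have "\<dots> = 2 * real (card S1)" by simp
    also have "\<dots> \<le> 2 * real (nat \<bar>j\<bar>)" using \<open>card S1 \<le> nat \<bar>j\<bar>\<close> by (intro mult_left_mono) (auto simp only: of_nat_le_iff)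
    finally show ?thesis .
  qed
  also have "(\<Sum>n\<in>S2. \<psi> (int n + j)) \<le> (\<Sum>m\<in>{1..<N + nat \<bar>j\<bar> + 1}. \<psi> (int m))"
  proof -
    have inj: "inj_on (\<lambda>n. nat (int n + j)) S2" by (auto simp: inj_on_def S2_def)
    have "(\<Sum>n\<in>S2. \<psi> (int n + j)) = (\<Sum>n\<in>S2. \<psi> (int (nat (int n + j))))"
      by (intro sum.cong) (auto simp: S2_def)
    also have "\<dots> = (\<Sum>m\<in>(\<lambda>n. nat (int n + j)) ` S2. \<psi> (int m))"
      by (subst sum.reindex[OF inj]) simp
    also have "\<dots> \<le> (\<Sum>m\<in>{1..<N + nat \<bar>j\<bar> + 1}. \<psi> (int m))"
      using assms(1) by (intro sum_mono2) (auto simp: S2_def)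
    finally show ?thesis .
  qed
  finally show ?thesis by simp
qed

text \<open>Reading \<open>G k\<close> from a uniform residue modulo \<open>Q k\<close> gives a
  random sequence \<open>X k\<close> whose law is the Furstenberg measure of the k-th approximant.
  Compatible residues put all \<open>X k\<close> on one probability space, where their increments
  are summable in L1, so they converge almost surely. The law of the limit is the required
  measure.\<close>

theorem rap_imp_unique_furstenberg:
  assumes f: "f \<in> mult_class" and rap: "rap f"
  shows "unique_furstenberg f"
proof -
  interpret prob_space unit_measure by (rule prob_space_unit_measure)
  have fb: "cmod (f n) \<le> 1" for n by (rule mult_class_norm_le[OF f])
  obtain G :: "nat \<Rightarrow> int \<Rightarrow> complex" and Q :: "nat \<Rightarrow> nat" where
    Q0: "\<And>k. Q k > 0" and Qd: "\<And>k. Q k dvd Q (Suc k)" and Gper: "\<And>k i. G k (i + int (Q k)) = G k i" and G1: "\<And>k i. cmod (G k i) \<le> 1"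
    and app: "\<And>k. eventually (\<lambda>N. (\<Sum>n\<in>{1..<N}. cmod (f n - G k (int n))) \<le> (1 / 2) ^ k * real N) sequentially"
    by (rule rap_approximants[OF fb rap]) (rule that)
  have Gper': "G k (i + int (Q (Suc k))) = G k i" for k i
  proof -
    obtain r where "Q (Suc k) = Q k * r" using Qd[of k] by (elim dvdE)
    then show ?thesis using periodic_int_mod[of "G k" "Q k" i "int r", OF Gper] by simp
  qed
  define \<omega> where "\<omega> = profinite_residue Q"
  define X where "X k x j = G k (int (\<omega> k x) + j)" for k x j
  \<comment> \<open>The triangle inequality gives average distance 3/2 (1/2)^k on [1, N). Over M
    full periods this is a statement about one period, except for the index 0, whose term is
    absorbed in the remaining 1/2 (1/2)^k for large M.\<close>
  have diff: "(\<Sum>i<Q (Suc k). cmod (G (Suc k) (int i) - G k (int i))) \<le> 2 * (1 / 2) ^ k * real (Q (Suc k))" for k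
  proof -
    define q where "q = Q (Suc k)"
    define d where "d i = cmod (G (Suc k) (int i) - G k (int i))" for i
    have q1: "q \<ge> 1" using Q0[of "Suc k"] by (simp add: q_def)
    have dper: "d (n + q) = d n" for n using Gper[of "Suc k" "int n"] Gper'[of k "int n"] by (simp add: d_def q_def)
    have d2: "d n \<le> 2" for n
      using norm_triangle_ineq4[of "G (Suc k) (int n)" "G k (int n)"] G1[of "Suc k" "int n"] G1[of k "int n"] by (simp add: d_def)
    have qlim: "filterlim (\<lambda>M. M * q) at_top sequentially"
      using q1 by (intro filterlim_at_top_mono[OF filterlim_ident]) (auto intro: always_eventually)
    have "eventually (\<lambda>N. (\<Sum>n\<in>{1..<N}. d n) \<le> 3 / 2 * (1 / 2) ^ k * real N) sequentially"
      using app[of k] app[of "Suc k"]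
    proof eventually_elim
      case (elim N)
      have "(\<Sum>n\<in>{1..<N}. d n) \<le> (\<Sum>n\<in>{1..<N}. cmod (f n - G k (int n)) + cmod (f n - G (Suc k) (int n)))"
      proof (intro sum_mono)
        fix n
        have "G (Suc k) (int n) - G k (int n) = (f n - G k (int n)) - (f n - G (Suc k) (int n))" by simp
        then show "d n \<le> cmod (f n - G k (int n)) + cmod (f n - G (Suc k) (int n))"
          unfolding d_def by (simp only: norm_triangle_ineq4)
      qed
      also have "\<dots> \<le> (1 / 2) ^ k * real N + (1 / 2) ^ Suc k * real N"
        unfolding sum.distrib by (intro add_mono elim)
      finally show ?case by (simp add: algebra_simps)
    qed
    from eventually_compose_filterlim[OF this qlim]
    have "eventually (\<lambda>M. (\<Sum>n\<in>{1..<M * q}. d n) \<le> 3 / 2 * (1 / 2) ^ k * real (M * q)) sequentially" .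
    moreover have "eventually (\<lambda>M. 2 \<le> 1 / 2 * (1 / 2) ^ k * real M) sequentially"
      by real_asymp
    ultimately have "eventually (\<lambda>M. (\<Sum>n\<in>{1..<M * q}. d n) \<le> 3 / 2 * (1 / 2) ^ k * real (M * q) \<and> 2 \<le> 1 / 2 * (1 / 2) ^ k * real M \<and> M > 0) sequentially"
      using eventually_gt_at_top[of 0] by eventually_elim auto
    then obtain M where M: "(\<Sum>n\<in>{1..<M * q}. d n) \<le> 3 / 2 * (1 / 2) ^ k * real (M * q)" "2 \<le> 1 / 2 * (1 / 2) ^ k * real M" "M > 0"
      by (auto dest: eventually_happens)
    have "real M * (\<Sum>n<q. d n) = (\<Sum>n<M * q. d n)" using nat_periodic_block_sum[of d q M] dper by simp
    also have "{..<M * q} = insert 0 {1..<M * q}" using M(3) q1 by auto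
    also have "(\<Sum>n\<in>insert 0 {1..<M * q}. d n) = d 0 + (\<Sum>n\<in>{1..<M * q}. d n)" by simp
    also have "\<dots> \<le> 1 / 2 * (1 / 2) ^ k * real M + 3 / 2 * (1 / 2) ^ k * real (M * q)"
      using M(1,2) d2[of 0] by linarith
    also have "\<dots> \<le> 1 / 2 * (1 / 2) ^ k * real (M * q) + 3 / 2 * (1 / 2) ^ k * real (M * q)"
    proof (intro add_mono mult_left_mono order.refl)
      show "real M \<le> real (M * q)" using q1 by (simp only: of_nat_le_iff) simp
    qed simp_all
    also have "\<dots> = real M * (2 * (1 / 2) ^ k * real q)" by (simp add: algebra_simps)
    finally have "(\<Sum>n<q. d n) \<le> 2 * (1 / 2) ^ k * real q" using M(3) by simp
    then show ?thesis by (simp add: d_def q_def)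
  qed
  have Xm: "(\<lambda>x. X k x j) \<in> borel_measurable unit_measure" for k j
    unfolding X_def \<omega>_def
    by (rule measurable_compose[OF measurable_profinite_residue[where Q = Q, OF Q0 Qd]]) simp
  have XmF: "(\<lambda>x. F (X k x)) \<in> borel_measurable unit_measure" for F :: "(int \<Rightarrow> complex) \<Rightarrow> real" and k
    unfolding X_def \<omega>_def
    by (rule measurable_compose[OF measurable_profinite_residue[where Q = Q, OF Q0 Qd]]) simp
  have Xm': "(\<lambda>x. cmod (X (Suc k) x j - X k x j)) \<in> borel_measurable unit_measure" for k j
    using Xm[measurable] by measurable
  have int_diff: "(\<integral>x. cmod (X (Suc k) x j - X k x j) \<partial>unit_measure) \<le> 2 * (1 / 2) ^ k" for k j
  proof -
    have "(\<integral>x. cmod (X (Suc k) x j - X k x j) \<partial>unit_measure)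
      = (\<integral>x. cmod (G (Suc k) (int (\<omega> (Suc k) x) + j) - G k (int (\<omega> (Suc k) x) + j)) \<partial>unit_measure)"
    proof (rule Bochner_Integration.integral_cong[OF refl])
      fix x assume "x \<in> space unit_measure"
      then have c: "\<omega> (Suc k) x mod Q k = \<omega> k x"
        unfolding \<omega>_def by (intro profinite_residue_compatible[where Q = Q, OF Q0 Qd]) simp
      have "int (\<omega> (Suc k) x) + j = (int (\<omega> k x) + j) + int (Q k) * int (\<omega> (Suc k) x div Q k)"
        unfolding c[symmetric] by (simp add: of_nat_mult[symmetric] of_nat_add[symmetric] del: of_nat_mult of_nat_add)
      then have "G k (int (\<omega> (Suc k) x) + j) = G k (int (\<omega> k x) + j)"
        using periodic_int_mod[of "G k" "Q k", OF Gper] by metis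
      then show "cmod (X (Suc k) x j - X k x j) = cmod (G (Suc k) (int (\<omega> (Suc k) x) + j) - G k (int (\<omega> (Suc k) x) + j))"
        by (simp add: X_def)
    qed
    \<comment> \<open>Both approximants are now read from the same residue, which is uniform modulo
      Q (k + 1).\<close>
    also have "\<dots> = (\<Sum>i<Q (Suc k). cmod (G (Suc k) (int i + j) - G k (int i + j))) / real (Q (Suc k))"
      unfolding \<omega>_def by (rule integral_profinite_residue[where Q = Q, OF Q0 Qd])
    also have "(\<Sum>i<Q (Suc k). cmod (G (Suc k) (int i + j) - G k (int i + j))) = (\<Sum>i<Q (Suc k). cmod (G (Suc k) (int i) - G k (int i)))"
      by (rule periodic_int_shift) (simp add: Gper Gper')
    also have "\<dots> / real (Q (Suc k)) \<le> 2 * (1 / 2) ^ k"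
      using diff[of k] Q0[of "Suc k"] by (simp add: field_simps)
    finally show ?thesis .
  qed
  have X1: "cmod (X k x j) \<le> 1" for k x j unfolding X_def by (rule G1)
  have conv: "AE x in unit_measure. \<forall>j. convergent (\<lambda>k. X k x j)"
    unfolding AE_all_countable
  proof
    fix j
    \<comment> \<open>Increments summable in L1 are almost surely absolutely summable.\<close>
    have "(\<integral>\<^sup>+x. (\<Sum>k. ennreal (cmod (X (Suc k) x j - X k x j))) \<partial>unit_measure) = (\<Sum>k. \<integral>\<^sup>+x. ennreal (cmod (X (Suc k) x j - X k x j)) \<partial>unit_measure)"
      using Xm' by (intro nn_integral_suminf) simp
    also have "\<dots> \<le> (\<Sum>k. ennreal (2 * (1 / 2) ^ k))"
    proof (intro suminf_le allI)
      fix k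
      have "integrable unit_measure (\<lambda>x. cmod (X (Suc k) x j - X k x j))"
      proof (rule integrable_const_bound[where B = 2])
        show "AE x in unit_measure. norm (cmod (X (Suc k) x j - X k x j)) \<le> 2"
        proof (intro AE_I2)
          fix x
          show "norm (cmod (X (Suc k) x j - X k x j)) \<le> 2"
            using norm_triangle_ineq4[of "X (Suc k) x j" "X k x j"] X1[of "Suc k" x j] X1[of k x j] by simp
        qed
      qed (rule Xm')
      then have "(\<integral>\<^sup>+x. ennreal (cmod (X (Suc k) x j - X k x j)) \<partial>unit_measure) = ennreal (\<integral>x. cmod (X (Suc k) x j - X k x j) \<partial>unit_measure)"
        by (intro nn_integral_eq_integral) auto
      also have "\<dots> \<le> ennreal (2 * (1 / 2) ^ k)" by (intro ennreal_leI int_diff)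
      finally show "(\<integral>\<^sup>+x. ennreal (cmod (X (Suc k) x j - X k x j)) \<partial>unit_measure) \<le> ennreal (2 * (1 / 2) ^ k)" .
    qed auto
    also have "\<dots> = ennreal (\<Sum>k. 2 * (1 / 2) ^ k)"
      by (rule suminf_ennreal2) (auto intro!: summable_mult summable_geometric)
    also have "\<dots> < \<infinity>" by simp
    finally have fin: "(\<integral>\<^sup>+x. (\<Sum>k. ennreal (cmod (X (Suc k) x j - X k x j))) \<partial>unit_measure) \<noteq> \<infinity>" by simp
    have "AE x in unit_measure. (\<Sum>k. ennreal (cmod (X (Suc k) x j - X k x j))) \<noteq> \<infinity>"
      by (rule nn_integral_noteq_infinite[OF _ fin]) (use Xm' in simp)
    then show "AE x in unit_measure. convergent (\<lambda>k. X k x j)"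
    proof eventually_elim
      case (elim x)
      then have "summable (\<lambda>k. cmod (X (Suc k) x j - X k x j))" by (intro summable_suminf_not_top) auto
      then have "summable (\<lambda>k. X (Suc k) x j - X k x j)" by (rule summable_norm_cancel)
      then have "convergent (\<lambda>n. \<Sum>k<n. X (Suc k) x j - X k x j)" by (simp add: summable_iff_convergent)
      moreover have "(\<lambda>n. \<Sum>k<n. X (Suc k) x j - X k x j) = (\<lambda>n. X n x j - X 0 x j)"
        by (rule ext) (rule sum_lessThan_telescope)
      ultimately have "convergent (\<lambda>n. X n x j - X 0 x j)" by simp
      then show ?case by (simp add: convergent_diff_const_right_iff)
    qed
  qed
  \<comment> \<open>The projection keeps L x in the space of sequences also on the null set where
    the limit does not exist.\<close>
  define L where "L x j = closest_point (cball 0 1) (lim (\<lambda>k. X k x j))" for x j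
  have L_disc: "L x \<in> disc_seqs" for x
    unfolding disc_seqs_def L_def using closest_point_in_set[of "cball 0 (1::real) :: complex set"] by simp
  have X_disc: "X k x \<in> disc_seqs" for k x using X1 by (simp add: disc_seqs_def)
  have limL: "AE x in unit_measure. (\<lambda>k. X k x) \<longlonglongrightarrow> L x"
    using conv
  proof eventually_elim
    case (elim x)
    show ?case
    proof (rule tendsto_coordinatewise_fun)
      fix j
      have l: "(\<lambda>k. X k x j) \<longlonglongrightarrow> lim (\<lambda>k. X k x j)" using elim by (simp add: convergent_LIMSEQ_iff)
      have "lim (\<lambda>k. X k x j) \<in> cball 0 1"
        by (rule closed_sequentially[OF closed_cball _ l]) (use X1 in simp)
      then show "(\<lambda>k. X k x j) \<longlonglongrightarrow> L x j" using l by (simp add: L_def closest_point_self)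
    qed
  qed
  have Lm: "L \<in> measurable unit_measure borel_disc_seqs"
    unfolding borel_disc_seqs_def
  proof (rule measurable_restrict_space2)
    show "L \<in> space unit_measure \<rightarrow> disc_seqs" using L_disc by auto
    show "L \<in> borel_measurable unit_measure"
    proof (rule measurable_coordinatewise_then_product)
      fix j
      have "(\<lambda>x. lim (\<lambda>k. X k x j)) \<in> borel_measurable unit_measure"
        by (rule borel_measurable_lim_metric, rule Xm)
      moreover have "closest_point (cball 0 1 :: complex set) \<in> borel_measurable borel"
        by (intro borel_measurable_continuous_onI continuous_on_closest_point) auto
      ultimately show "(\<lambda>x. L x j) \<in> borel_measurable unit_measure"
        unfolding L_def by (rule measurable_compose)
    qed
  qed
  define \<nu> where "\<nu> = distr unit_measure borel_disc_seqs L"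
  have "prob_space \<nu>" unfolding \<nu>_def by (rule prob_space_distr[OF Lm])
  moreover have "sets \<nu> = sets borel_disc_seqs" by (simp add: \<nu>_def)
  moreover have "weak_star_lim (empirical f) \<nu>"
    unfolding weak_star_lim_def
  proof (intro allI impI)
    fix F :: "(int \<Rightarrow> complex) \<Rightarrow> real"
    assume F: "continuous_on disc_seqs F"
    have Fm: "F \<in> borel_measurable borel_disc_seqs"
      unfolding borel_disc_seqs_def by (rule borel_measurable_continuous_on_restrict[OF F])
    have "bounded (F ` disc_seqs)"
      by (intro compact_imp_bounded compact_continuous_image F compact_disc_seqs)
    then obtain B where B: "B > 0" "\<And>x. x \<in> disc_seqs \<Longrightarrow> \<bar>F x\<bar> \<le> B"
      unfolding bounded_pos by auto
    define I where "I = integral\<^sup>L \<nu> F"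
    have I: "I = (\<integral>x. F (L x) \<partial>unit_measure)" unfolding I_def \<nu>_def by (rule integral_distr[OF Lm Fm])
    \<comment> \<open>F along the orbit of the k-th approximant. Its mean a k over one period is
      both the integral of F against the law of \<open>X k\<close> and the limit of the averages
      along the orbit.\<close>
    define \<Phi> where "\<Phi> k n = F (\<lambda>j. G k (int n + j))" for k n
    define a where "a k = (\<Sum>i<Q k. \<Phi> k i) / real (Q k)" for k
    have aX: "(\<integral>x. F (X k x) \<partial>unit_measure) = a k" for k
    proof -
      have "X k x = (\<lambda>j. G k (int (profinite_residue Q k x) + j))" for x
        by (rule ext) (simp add: X_def \<omega>_def)
      then show ?thesis
        using integral_profinite_residue[of Q "\<Phi> k" k, OF Q0 Qd] by (simp add: a_def \<Phi>_def)
    qed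
    have "(\<lambda>k. \<integral>x. F (X k x) \<partial>unit_measure) \<longlonglongrightarrow> (\<integral>x. F (L x) \<partial>unit_measure)"
    proof (rule integral_dominated_convergence[where w = "\<lambda>_. B"])
      show "(\<lambda>x. F (L x)) \<in> borel_measurable unit_measure" by (rule measurable_compose[OF Lm Fm])
      show "(\<lambda>x. F (X k x)) \<in> borel_measurable unit_measure" for k by (rule XmF)
      show "AE x in unit_measure. (\<lambda>k. F (X k x)) \<longlonglongrightarrow> F (L x)"
        using limL
      proof eventually_elim
        case (elim x)
        show ?case by (rule continuous_on_tendsto_compose[OF F elim L_disc]) (simp add: X_disc)
      qed
      show "AE x in unit_measure. norm (F (X k x)) \<le> B" for k using B(2)[OF X_disc] by simp
    qed simp
    then have aI: "a \<longlonglongrightarrow> I" by (simp add: aX I)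
    show "(\<lambda>N. integral\<^sup>L (empirical f N) F) \<longlonglongrightarrow> integral\<^sup>L \<nu> F"
      unfolding I_def[symmetric]
    proof (rule tendstoI)
      fix e :: real assume e: "e > 0"
      obtain J \<delta> where J: "finite J" "\<delta> > 0"
        "\<And>x y. x \<in> disc_seqs \<Longrightarrow> y \<in> disc_seqs \<Longrightarrow> (\<And>j. j \<in> J \<Longrightarrow> cmod (x j - y j) < \<delta>) \<Longrightarrow> \<bar>F x - F y\<bar> < e / 4"
        using disc_seqs_finite_modulus[OF F, of "e / 4"] e by auto
      \<comment> \<open>A Markov-type bound: where some coordinate in J is off by at least
        \<open>\<delta>\<close>, the trivial bound 2 B is at most C times the sum of the coordinate
        errors.\<close>
      define C where "C = 2 * B / \<delta>"
      have C0: "C > 0" using B(1) J(2) by (simp add: C_def)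
      have "(\<lambda>k. C * real (card J) * (2 * (1 / 2) ^ k)) \<longlonglongrightarrow> C * real (card J) * (2 * 0)"
        by (intro tendsto_intros LIMSEQ_realpow_zero) auto
      then have "eventually (\<lambda>k. C * real (card J) * (2 * (1 / 2) ^ k) < e / 4) sequentially"
        by (rule order_tendstoD(2)) (use e in simp)
      moreover have "eventually (\<lambda>k. dist (a k) I < e / 4) sequentially" by (rule tendstoD[OF aI]) (use e in simp)
      ultimately have "eventually (\<lambda>k. C * real (card J) * (2 * (1 / 2) ^ k) < e / 4 \<and> dist (a k) I < e / 4) sequentially"
        by (rule eventually_conj)
      then obtain k where k: "C * real (card J) * (2 * (1 / 2) ^ k) < e / 4" "dist (a k) I < e / 4"
        by (auto dest: eventually_happens)
      define \<psi> where "\<psi> i = cmod (two_sided f i - G k i)" for i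
      have ts1: "cmod (two_sided f i) \<le> 1" for i using fb by (simp add: two_sided_def)
      have \<psi>0: "\<psi> i \<ge> 0" "\<psi> i \<le> 2" for i
        using norm_triangle_ineq4[of "two_sided f i" "G k i"] ts1[of i] G1[of k i] by (auto simp: \<psi>_def)
      have shift: "eventually (\<lambda>N. (\<Sum>n=1..N. \<psi> (int n + j)) \<le> 2 * (1 / 2) ^ k * real N) sequentially" for j
      proof -
        have lim: "filterlim (\<lambda>N. N + nat \<bar>j\<bar> + 1) at_top sequentially"
          by (intro filterlim_at_top_mono[OF filterlim_ident]) (auto intro: always_eventually)
        have "eventually (\<lambda>N. 2 * real (nat \<bar>j\<bar>) + (1 / 2) ^ k * (real (nat \<bar>j\<bar>) + 1) \<le> (1 / 2) ^ k * real N) sequentially"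
          by real_asymp
        then show ?thesis using eventually_compose_filterlim[OF app[of k] lim]
        proof eventually_elim
          case (elim N)
          have "(\<Sum>n=1..N. \<psi> (int n + j)) \<le> 2 * real (nat \<bar>j\<bar>) + (\<Sum>m\<in>{1..<N + nat \<bar>j\<bar> + 1}. \<psi> (int m))"
            by (rule shifted_sum_le[OF \<psi>0])
          also have "(\<Sum>m\<in>{1..<N + nat \<bar>j\<bar> + 1}. \<psi> (int m)) = (\<Sum>n\<in>{1..<N + nat \<bar>j\<bar> + 1}. cmod (f n - G k (int n)))"
            by (intro sum.cong) (auto simp: \<psi>_def two_sided_def)
          also have "\<dots> \<le> (1 / 2) ^ k * real (N + nat \<bar>j\<bar> + 1)" by (rule elim(2))
          finally show ?case using elim(1) by (simp add: algebra_simps)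
        qed
      qed
      have all: "eventually (\<lambda>N. \<forall>j\<in>J. (\<Sum>n=1..N. \<psi> (int n + j)) \<le> 2 * (1 / 2) ^ k * real N) sequentially"
        using shift by (intro eventually_ball_finite J(1)) auto
      have "\<Phi> k (n + Q k) = \<Phi> k n" for n
      proof -
        have "G k (int (n + Q k) + j) = G k (int n + j)" for j
          using Gper[of k "int n + j"] by (simp add: algebra_simps)
        then show ?thesis by (simp add: \<Phi>_def)
      qed
      then have "(\<lambda>N. (\<Sum>n=1..N. \<Phi> k n) / real N) \<longlonglongrightarrow> a k"
        unfolding a_def by (intro periodic_average_tendsto Q0)
      then have "eventually (\<lambda>N. dist ((\<Sum>n=1..N. \<Phi> k n) / real N) (a k) < e / 4) sequentially"
        by (rule tendstoD) (use e in simp)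
      with all show "eventually (\<lambda>N. dist (integral\<^sup>L (empirical f N) F) I < e) sequentially"
        using eventually_gt_at_top[of 0]
      proof eventually_elim
        case (elim N)
        define x where "x n = (left_shift ^^ n) (two_sided f)" for n
        define y where "y n = (\<lambda>j. G k (int n + j))" for n
        have xd: "x n \<in> disc_seqs" for n unfolding x_def by (rule shifts_in_disc_seqs[OF f])
        have yd: "y n \<in> disc_seqs" for n using G1 by (simp add: y_def disc_seqs_def)
        have xy: "cmod (x n j - y n j) = \<psi> (int n + j)" for n j
          by (simp add: x_def y_def \<psi>_def left_shift_funpow add.commute)
        have pt: "\<bar>F (x n) - F (y n)\<bar> \<le> e / 4 + C * (\<Sum>j\<in>J. \<psi> (int n + j))" for n
        proof (cases "\<forall>j\<in>J. \<psi> (int n + j) < \<delta>")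
          case True
          then have "\<bar>F (x n) - F (y n)\<bar> < e / 4" using xy by (intro J(3) xd yd) auto
          moreover have "C * (\<Sum>j\<in>J. \<psi> (int n + j)) \<ge> 0" using C0 \<psi>0 by (auto intro!: mult_nonneg_nonneg sum_nonneg)
          ultimately show ?thesis by linarith
        next
          case False
          then obtain j where j: "j \<in> J" "\<delta> \<le> \<psi> (int n + j)" by (auto simp: not_less)
          have "\<psi> (int n + j) \<le> (\<Sum>j\<in>J. \<psi> (int n + j))"
            using j(1) J(1) \<psi>0 by (intro member_le_sum) auto
          then have "C * \<delta> \<le> C * (\<Sum>j\<in>J. \<psi> (int n + j))" using C0 j(2) by (intro mult_left_mono) auto
          moreover have "C * \<delta> = 2 * B" using J(2) by (simp add: C_def)
          moreover have "\<bar>F (x n) - F (y n)\<bar> \<le> 2 * B" using B(2)[OF xd[of n]] B(2)[OF yd[of n]] by linarith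
          ultimately show ?thesis using e by linarith
        qed
        have "\<bar>(\<Sum>n=1..N. F (x n)) - (\<Sum>n=1..N. F (y n))\<bar> \<le> (\<Sum>n=1..N. \<bar>F (x n) - F (y n)\<bar>)"
          unfolding sum_subtractf[symmetric] by (rule sum_abs)
        also have "\<dots> \<le> (\<Sum>n=1..N. e / 4 + C * (\<Sum>j\<in>J. \<psi> (int n + j)))" by (intro sum_mono pt)
        also have "\<dots> = real N * (e / 4) + C * (\<Sum>j\<in>J. \<Sum>n=1..N. \<psi> (int n + j))"
          by (subst sum.swap) (simp add: sum.distrib sum_distrib_left)
        also have "\<dots> \<le> real N * (e / 4) + C * (\<Sum>j\<in>J. 2 * (1 / 2) ^ k * real N)"
          using elim(1) C0 by (intro add_left_mono mult_left_mono sum_mono) auto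
        also have "\<dots> = real N * (e / 4) + (C * real (card J) * (2 * (1 / 2) ^ k)) * real N" by simp
        also have "\<dots> \<le> real N * (e / 4) + (e / 4) * real N" using k(1) by (intro add_left_mono mult_right_mono) auto
        finally have "\<bar>(\<Sum>n=1..N. F (x n)) - (\<Sum>n=1..N. F (y n))\<bar> \<le> real N * (e / 2)" by (simp add: algebra_simps)
        then have "\<bar>(\<Sum>n=1..N. F (x n)) / real N - (\<Sum>n=1..N. F (y n)) / real N\<bar> \<le> e / 2"
          using elim(3) by (simp add: diff_divide_distrib[symmetric] abs_divide field_simps)
        moreover have "integral\<^sup>L (empirical f N) F = (\<Sum>n=1..N. F (x n)) / real N"
          unfolding x_def by (rule integral_empirical[OF f F elim(3)])
        moreover have "\<bar>(\<Sum>n=1..N. F (y n)) / real N - a k\<bar> < e / 4"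
          using elim(2) by (simp add: dist_real_def \<Phi>_def y_def)
        moreover have "\<bar>a k - I\<bar> < e / 4" using k(2) by (simp add: dist_real_def)
        ultimately show ?case unfolding dist_real_def by linarith
      qed
    qed
  qed
  ultimately show ?thesis unfolding unique_furstenberg_def by blast
qed

section \<open>Examples and the chain of inclusions\<close>

lemma powr_imaginary_eq_cis:
  assumes "n > 0"
  shows "of_nat n powr (\<i> * of_real t) = cis (t * ln (real n))"
  using assms by (simp add: powr_def cis_conv_exp Ln_of_nat mult_ac)

lemma pretentious_imp_pretentious_to:
  assumes f: "f \<in> pretentious_class" and f1: "f 1 = 1"
  obtains q chi t where "pretentious_to f chi q t"
proof -
  have fm: "f \<in> mult_class" and "pretentious f" using f by (auto simp: pretentious_class_def)
  then obtain q chi t where chi: "dirichlet_char q chi"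
    and s: "(\<lambda>p::nat. 1 / real p * (1 - Re (f p * cnj (chi p * of_nat p powr (\<i> * of_real t))))) summable_on {p. prime p}"
    unfolding pretentious_def by blast
  have "(\<lambda>p. if prime p then (1 - Re (f p * cnj (chi p * cis (t * ln (real p))))) / real p else 0) summable_on UNIV"
    by (rule summable_on_cong_neutral[THEN iffD1, OF _ _ _ s])
      (auto simp: powr_imaginary_eq_cis prime_gt_0_nat simp del: times_complex.sel)
  then have "pretentious_to f chi q t"
    using fm f1 chi summable_on_imp_summable by unfold_locales auto
  then show ?thesis by (rule that)
qed

lemma mult_class_at_1:
  assumes f: "f \<in> mult_class"
  shows "f 1 = 1 \<or> f = (\<lambda>_. 0)"
proof (cases "f 1 = 1")
  case False
  have "f (1 * 1) = f 1 * f 1" using f by (intro mult_class_mult) auto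
  then have 0: "f 1 = 0" using False by simp
  have "f n = 0" for n
  proof (cases "n = 0")
    case True
    then show ?thesis using f by (simp add: mult_class_def)
  next
    case False
    then have "f (1 * n) = f 1 * f n" using f by (intro mult_class_mult) auto
    then show ?thesis using 0 by simp
  qed
  then show ?thesis by auto
qed simp

lemma periodic_imp_rap:
  assumes "periodic_seq f"
  shows "rap f"
  unfolding rap_def
proof (intro allI impI exI[of _ f] conjI assms)
  fix \<epsilon> :: real assume "\<epsilon> > 0"
  then show "limsup (\<lambda>N. ereal (1 / real N * (\<Sum>n\<in>{1..<N}. cmod (f n - f n)))) < ereal \<epsilon>"
    by (simp add: Limsup_const zero_ereal_def[symmetric])
qed

lemma periodic_seq_zero: "periodic_seq (\<lambda>_. 0)"
  unfolding periodic_seq_def by (intro exI[of _ 1]) simp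

lemma toeplitz_zero: "toeplitz (\<lambda>_. 0)"
  unfolding toeplitz_def by (intro allI impI exI[of _ 1]) simp

text \<open>A kernel sequence depends only on 2^k and j modulo q, so there are at most q^2 of
  them.\<close>

lemma periodic_imp_automatic:
  assumes "periodic_seq f"
  shows "automatic f"
  unfolding automatic_def automatic_base_def
proof (intro exI[of _ 2] conjI)
  obtain q where q: "q \<ge> 1" "\<And>n. n \<ge> 1 \<Longrightarrow> f (n + q) = f n" using assms unfolding periodic_seq_def by blast
  have l: "f (n + k * q) = f n" if "n \<ge> 1" for n k
  proof (induction k)
    case (Suc k)
    have "f (n + Suc k * q) = f ((n + k * q) + q)" by (simp add: algebra_simps)
    then show ?case using Suc q(2)[of "n + k * q"] that by simp
  qed auto
  have red: "f n = f (n mod q + q)" if "n \<ge> 1" for n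
  proof -
    have "f n = f (n + q)" using q(2)[OF that] by simp
    also have "n + q = (n mod q + q) + (n div q) * q" by simp
    also have "f \<dots> = f (n mod q + q)" using q(1) by (intro l) auto
    finally show ?thesis .
  qed
  define H where "H = (\<lambda>(a, b). restrict (\<lambda>n. f ((a * n + b) mod q + q)) {1..})"
  have "{restrict (\<lambda>n. f (2 ^ k * n + j)) {1..} |k j. k \<ge> 1 \<and> j < 2 ^ k} \<subseteq> H ` ({..<q} \<times> {..<q})"
  proof
    fix \<phi> assume "\<phi> \<in> {restrict (\<lambda>n. f (2 ^ k * n + j)) {1..} |k j. k \<ge> 1 \<and> j < 2 ^ k}"
    then obtain k j :: nat where \<phi>: "\<phi> = restrict (\<lambda>n. f (2 ^ k * n + j)) {1..}" by blast
    have "\<phi> = H (2 ^ k mod q, j mod q)"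
      unfolding \<phi> H_def prod.case
    proof (rule restrict_ext)
      fix n :: nat assume "n \<in> {1..}"
      then have "2 ^ k * n + j \<ge> 1" by (simp add: Suc_le_eq)
      moreover have "[2 ^ k mod q * n + j mod q = 2 ^ k * n + j] (mod q)"
        by (intro cong_add cong_mult cong_refl) (simp_all add: cong_def)
      ultimately show "f (2 ^ k * n + j) = f ((2 ^ k mod q * n + j mod q) mod q + q)"
        using red[of "2 ^ k * n + j"] by (simp add: cong_def)
    qed
    then show "\<phi> \<in> H ` ({..<q} \<times> {..<q})" using q(1) by (intro image_eqI[of _ _ "(2 ^ k mod q, j mod q)"]) auto
  qed
  then show "finite {restrict (\<lambda>n. f (2 ^ k * n + j)) {1..} |k j. k \<ge> 1 \<and> j < 2 ^ k}"
    by (rule finite_subset) simp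
qed simp

section \<open>Examples separating the classes\<close>

lemma dirichlet_char_trivial: "dirichlet_char 1 (\<lambda>_. 1)"
  by (simp add: dirichlet_char_def)

lemma pretentious_if_trivial_character:
  assumes "(\<lambda>p::nat. 1 / real p * (1 - Re (f p * cnj (1 * of_nat p powr (\<i> * of_real t))))) summable_on {p. prime p}"
  shows "pretentious f"
  unfolding pretentious_def
  by (rule exI[of _ 1], rule exI[of _ "\<lambda>_. 1"], rule exI[of _ t]) (rule conjI[OF dirichlet_char_trivial assms])

text \<open>z = -1 separates periodic from automatic, z = 1/2 automatic from Toeplitz.\<close>

definition valuation_power :: "complex \<Rightarrow> nat \<Rightarrow> complex" where
  "valuation_power z n = (if n = 0 then 0 else z ^ multiplicity 2 n)"

lemma valuation_power_mult_class:
  assumes "cmod z \<le> 1"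
  shows "valuation_power z \<in> mult_class"
proof -
  have "prime_elem (2::nat)" by simp
  then have "multiplicity 2 (m * n) = multiplicity 2 m + multiplicity 2 n" if "m \<ge> 1" "n \<ge> 1" for m n :: nat
    using that by (intro prime_elem_multiplicity_mult_distrib) auto
  then show ?thesis using assms
    by (auto simp: mult_class_def valuation_power_def power_add norm_power power_le_one)
qed

lemma valuation_power_pretentious:
  assumes "cmod z \<le> 1"
  shows "valuation_power z \<in> pretentious_class"
proof -
  have "valuation_power z p = 1" if "prime p" "p \<noteq> 2" for p
  proof -
    have "\<not> 2 dvd p" using that primes_dvd_imp_eq[of 2 p] two_is_prime_nat by auto
    then show ?thesis using that by (simp add: valuation_power_def not_dvd_imp_multiplicity_0 prime_gt_0_nat)
  qed
  then have "(\<lambda>p::nat. 1 / real p * (1 - Re (valuation_power z p * cnj (1 * of_nat p powr (\<i> * of_real 0))))) summable_on {p. prime p}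
    \<longleftrightarrow> (\<lambda>p::nat. 1 / real p * (1 - Re (valuation_power z p * cnj (1 * of_nat p powr (\<i> * of_real 0))))) summable_on {2}"
    by (intro summable_on_cong_neutral) auto
  then have "pretentious (valuation_power z)" by (intro pretentious_if_trivial_character[of _ 0]) simp
  then show ?thesis using valuation_power_mult_class[OF assms] by (simp add: pretentious_class_def)
qed

lemma multiplicity_2_cong:
  assumes "n > 0" "[n' = n] (mod (2 ^ Suc (multiplicity 2 n)))"
  shows "multiplicity 2 n' = multiplicity 2 (n::nat)"
proof (rule multiplicity_eqI)
  have "[n' = n] (mod (2 ^ multiplicity 2 n))" using assms(2) by (rule cong_dvd_modulus_nat) simp
  then show "2 ^ multiplicity 2 n dvd n'" using multiplicity_dvd cong_dvd_iff by blast
  have "\<not> 2 ^ Suc (multiplicity 2 n) dvd n" using assms(1) by (subst power_dvd_iff_le_multiplicity) auto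
  then show "\<not> 2 ^ Suc (multiplicity 2 n) dvd n'"
    using assms(2) unfolding cong_def dvd_eq_mod_eq_0 by simp
qed

lemma valuation_power_toeplitz: "toeplitz (valuation_power z)"
  unfolding toeplitz_def
proof (intro allI impI)
  fix n :: nat assume "n \<ge> 1"
  show "\<exists>m\<ge>1. \<forall>n'\<ge>1. [n' = n] (mod m) \<longrightarrow> valuation_power z n' = valuation_power z n"
  proof (intro exI[of _ "2 ^ Suc (multiplicity 2 n)"] conjI allI impI)
    fix n' :: nat assume n': "n' \<ge> 1" "[n' = n] (mod 2 ^ Suc (multiplicity 2 n))"
    have "multiplicity 2 n' = multiplicity 2 n" using \<open>n \<ge> 1\<close> by (intro multiplicity_2_cong n'(2)) simp
    then show "valuation_power z n' = valuation_power z n" using n'(1) \<open>n \<ge> 1\<close> by (simp add: valuation_power_def)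
  qed simp
qed

text \<open>For 0 < j < 2^k the valuation of 2^k n + j is that of j, so the kernel consists of
  constants 1 and -1; j = 0 gives plus or minus the function itself.\<close>

lemma valuation_power_minus_one_automatic: "automatic (valuation_power (-1))"
  unfolding automatic_def automatic_base_def
proof (intro exI[of _ 2] conjI)
  define H where "H = (\<lambda>s. restrict (\<lambda>n. s * valuation_power (-1) n) {1..}) ` {1, -1} \<union> (\<lambda>s. restrict (\<lambda>n. s) {1..}) ` {1, -1}"
  have pm: "(-1::complex) ^ i \<in> {1, -1}" for i by (induction i) auto
  have "{restrict (\<lambda>n. valuation_power (-1) (2 ^ k * n + j)) {1..} |k j. k \<ge> 1 \<and> j < 2 ^ k} \<subseteq> H"
  proof
    fix \<phi> assume "\<phi> \<in> {restrict (\<lambda>n. valuation_power (-1) (2 ^ k * n + j)) {1..} |k j. k \<ge> 1 \<and> j < 2 ^ k}"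
    then obtain k j :: nat where \<phi>: "\<phi> = restrict (\<lambda>n. valuation_power (-1) (2 ^ k * n + j)) {1..}" and j: "j < 2 ^ k" by blast
    show "\<phi> \<in> H"
    proof (cases "j = 0")
      case True
      have "\<phi> = restrict (\<lambda>n. (-1) ^ k * valuation_power (-1) n) {1..}"
        unfolding \<phi> True
      proof (rule restrict_ext)
        fix n :: nat assume "n \<in> {1..}"
        then have "multiplicity 2 (2 ^ k * n) = multiplicity 2 (2 ^ k :: nat) + multiplicity 2 n"
          by (intro prime_elem_multiplicity_mult_distrib) auto
        then show "valuation_power (-1) (2 ^ k * n + 0) = (-1) ^ k * valuation_power (-1) n"
          using \<open>n \<in> {1..}\<close> by (simp add: valuation_power_def power_add)
      qed
      then show ?thesis using pm[of k] unfolding H_def by blast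
    next
      case False
      have "\<phi> = restrict (\<lambda>n. (-1) ^ multiplicity 2 j) {1..}"
        unfolding \<phi>
      proof (rule restrict_ext)
        fix n :: nat assume "n \<in> {1..}"
        have "Suc (multiplicity 2 j) \<le> k"
        proof (rule ccontr)
          assume "\<not> Suc (multiplicity 2 j) \<le> k"
          then have "2 ^ k dvd j" by (intro multiplicity_dvd') simp
          then show False using j False by (meson dvd_imp_le gr0I not_less)
        qed
        then have "2 ^ Suc (multiplicity 2 j) dvd 2 ^ k * n" by (intro dvd_mult2 le_imp_power_dvd)
        then have "[2 ^ k * n + j = 0 + j] (mod (2 ^ Suc (multiplicity 2 j)))"
          by (intro cong_add cong_refl) (simp add: cong_0_iff)
        then have "multiplicity 2 (2 ^ k * n + j) = multiplicity 2 j"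
          using False by (intro multiplicity_2_cong) auto
        then show "valuation_power (-1) (2 ^ k * n + j) = (-1) ^ multiplicity 2 j"
          using False by (simp add: valuation_power_def)
      qed
      then show ?thesis using pm[of "multiplicity 2 j"] unfolding H_def by blast
    qed
  qed
  then show "finite {restrict (\<lambda>n. valuation_power (-1) (2 ^ k * n + j)) {1..} |k j. k \<ge> 1 \<and> j < 2 ^ k}"
    by (rule finite_subset) (simp add: H_def)
qed simp

text \<open>Adding a period q to the argument q doubles it, which flips the sign of a nonzero
  value.\<close>

lemma valuation_power_minus_one_not_periodic: "\<not> periodic_seq (valuation_power (-1))"
proof
  assume "periodic_seq (valuation_power (-1))"
  then obtain q where q: "q \<ge> 1" "\<And>n. n \<ge> 1 \<Longrightarrow> valuation_power (-1) (n + q) = valuation_power (-1) n"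
    unfolding periodic_seq_def by blast
  have "multiplicity 2 (2 * q) = Suc (multiplicity 2 q)"
    using q(1) by (subst prime_elem_multiplicity_mult_distrib) auto
  then have "valuation_power (-1) (q + q) = - valuation_power (-1) q"
    using q(1) by (simp add: valuation_power_def mult_2[symmetric])
  then have "valuation_power (-1) q = 0" using q(2)[OF q(1)] by simp
  then show False using q(1) by (simp add: valuation_power_def)
qed

text \<open>The powers of 2 produce infinitely many values, which the finiteness of values beyond r
  forbids.\<close>

lemma valuation_power_half_not_automatic: "\<not> automatic (valuation_power (1 / 2))"
proof
  assume "automatic (valuation_power (1 / 2))"
  then obtain r where r: "r \<ge> 2" "automatic_base r (valuation_power (1 / 2))" unfolding automatic_def by blast
  obtain V where V: "finite V" "\<And>x. x \<ge> r \<Longrightarrow> valuation_power (1 / 2) x \<in> V"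
    using automatic_base_finite_values[OF r(2,1)] by blast
  have "(\<lambda>i. (1 / 2 :: complex) ^ i) ` {r..} \<subseteq> V"
  proof
    fix z assume "z \<in> (\<lambda>i. (1 / 2 :: complex) ^ i) ` {r..}"
    then obtain i where i: "i \<ge> r" "z = (1 / 2) ^ i" by auto
    have "i < 2 ^ i" by (rule less_exp)
    then have "valuation_power (1 / 2) (2 ^ i) \<in> V" using i(1) by (intro V(2)) linarith
    then show "z \<in> V" using i(2) by (simp add: valuation_power_def)
  qed
  then have "finite ((\<lambda>i. (1 / 2 :: complex) ^ i) ` {r..})" using V(1) finite_subset by blast
  moreover have "inj_on (\<lambda>i. (1 / 2 :: complex) ^ i) {r..}"
  proof (rule inj_onI)
    fix i j assume "(1 / 2 :: complex) ^ i = (1 / 2) ^ j"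
    then have "cmod ((1 / 2) ^ i) = cmod ((1 / 2) ^ j)" by simp
    then have "(1 / 2 :: real) ^ i = (1 / 2) ^ j" by (simp only: norm_power norm_divide norm_one norm_numeral)
    then show "i = j" by (simp add: power_divide)
  qed
  ultimately show False using finite_imageD infinite_Ici by blast
qed

text \<open>Separates Toeplitz from rationally almost periodic. It is 1 at every prime, so all
  deviations h p vanish and the convergence criterion is trivial.\<close>

definition squarefree_indicator :: "nat \<Rightarrow> complex" where
  "squarefree_indicator n = of_bool (squarefree n)"

lemma squarefree_indicator_mult_class: "squarefree_indicator \<in> mult_class"
  by (auto simp: mult_class_def squarefree_indicator_def of_bool_def intro: squarefree_mult_coprime dest: squarefree_multD)

lemma squarefree_indicator_pretentious_to: "pretentious_to squarefree_indicator (\<lambda>_. 1) 1 0"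
proof
  have z: "(\<lambda>p. if prime p then (1 - Re (squarefree_indicator p * cnj (1 * cis (0 * ln (real p))))) / real p else 0) = (\<lambda>_. 0)"
    by (auto simp: squarefree_indicator_def squarefree_prime)
  show "summable (\<lambda>p. if prime p then (1 - Re (squarefree_indicator p * cnj (1 * cis (0 * ln (real p))))) / real p else 0)"
    unfolding z by simp
qed (auto simp: squarefree_indicator_mult_class dirichlet_char_def squarefree_indicator_def)

lemma squarefree_indicator_pretentious: "squarefree_indicator \<in> pretentious_class"
proof -
  have "(\<lambda>p::nat. 1 / real p * (1 - Re (squarefree_indicator p * cnj (1 * of_nat p powr (\<i> * of_real 0))))) summable_on {p. prime p}
    \<longleftrightarrow> (\<lambda>p::nat. 0 :: real) summable_on {p::nat. prime p}"
    by (intro summable_on_cong) (auto simp: squarefree_indicator_def squarefree_prime)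
  then have "pretentious squarefree_indicator" by (intro pretentious_if_trivial_character[of _ 0]) simp
  then show ?thesis using squarefree_indicator_mult_class by (simp add: pretentious_class_def)
qed

lemma squarefree_indicator_rap: "rap squarefree_indicator"
proof -
  interpret pretentious_to squarefree_indicator "\<lambda>_. 1" 1 0 by (rule squarefree_indicator_pretentious_to)
  have "h p = 0" for p by (simp add: h_def tw_def squarefree_indicator_def squarefree_prime)
  then have "A N = 0" for N by (simp add: A_def)
  then show ?thesis by (intro rap_if_convergent) (simp_all add: convergent_const)
qed

text \<open>A progression 1 modulo m cannot consist of squarefree numbers: for a prime p not
  dividing m it meets the multiples of p^2.\<close>

lemma squarefree_indicator_not_toeplitz: "\<not> toeplitz squarefree_indicator"
proof
  assume "toeplitz squarefree_indicator"
  then obtain m where m: "m \<ge> 1" "\<And>n'. n' \<ge> 1 \<Longrightarrow> [n' = 1] (mod m) \<Longrightarrow> squarefree_indicator n' = squarefree_indicator 1"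
    unfolding toeplitz_def by (metis order_refl)
  obtain p where p: "prime p" "p > m" using bigger_prime by blast
  have "\<not> p dvd m" using p m(1) by (auto dest: dvd_imp_le)
  then have "coprime p m" using p(1) prime_imp_coprime by blast
  then have "coprime m (p\<^sup>2)" by (simp add: coprime_commute)
  then obtain x where x: "[x = 1] (mod m)" "[x = 0] (mod p\<^sup>2)" using binary_chinese_remainder_nat by blast
  define n where "n = x + m * p\<^sup>2"
  have "[n = 1 + 0] (mod m)" unfolding n_def by (intro cong_add x) (simp add: cong_0_iff)
  moreover have n1: "n \<ge> 1" using m(1) prime_gt_0_nat[OF p(1)] by (simp add: n_def Suc_le_eq)
  ultimately have "squarefree_indicator n = 1" using m(2) by (simp add: squarefree_indicator_def)
  then have sf: "squarefree n" by (auto simp: squarefree_indicator_def split: if_splits)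
  have "p\<^sup>2 dvd n" using x(2) by (simp add: n_def cong_0_iff)
  then have "is_unit p" using sf unfolding squarefree_def by blast
  then show False using p(1) by simp
qed

text \<open>The function n^i is pretentious with t = 1, whereas a unique Furstenberg system forces t
  = 0.\<close>

definition archimedean_character :: "nat \<Rightarrow> complex" where
  "archimedean_character n = (if n = 0 then 0 else cis (ln (real n)))"

lemma archimedean_character_mult_class: "archimedean_character \<in> mult_class"
  by (auto simp: mult_class_def archimedean_character_def ln_mult cis_mult)

lemma archimedean_character_pretentious_to: "pretentious_to archimedean_character (\<lambda>_. 1) 1 1"
proof
  have z: "(\<lambda>p. if prime p then (1 - Re (archimedean_character p * cnj (1 * cis (1 * ln (real p))))) / real p else 0) = (\<lambda>_. 0)"
    by (auto simp: archimedean_character_def prime_gt_0_nat cis_cnj cis_mult simp del: times_complex.sel)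
  show "summable (\<lambda>p. if prime p then (1 - Re (archimedean_character p * cnj (1 * cis (1 * ln (real p))))) / real p else 0)"
    unfolding z by simp
qed (auto simp: archimedean_character_mult_class dirichlet_char_def archimedean_character_def)

lemma archimedean_character_pretentious: "archimedean_character \<in> pretentious_class"
proof -
  have "1 / real p * (1 - Re (archimedean_character p * cnj (1 * of_nat p powr (\<i> * of_real 1)))) = 0" if "prime p" for p
  proof -
    have "p > 0" using that by (rule prime_gt_0_nat)
    then show ?thesis unfolding powr_imaginary_eq_cis[OF \<open>p > 0\<close>]
      by (simp add: archimedean_character_def cis_cnj cis_mult del: times_complex.sel)
  qed
  then have "(\<lambda>p::nat. 1 / real p * (1 - Re (archimedean_character p * cnj (1 * of_nat p powr (\<i> * of_real 1))))) summable_on {p. prime p}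
    \<longleftrightarrow> (\<lambda>p::nat. 0 :: real) summable_on {p::nat. prime p}"
    by (intro summable_on_cong) auto
  then have "pretentious archimedean_character" by (intro pretentious_if_trivial_character[of _ 1]) simp
  then show ?thesis using archimedean_character_mult_class by (simp add: pretentious_class_def)
qed

lemma archimedean_character_not_unique_furstenberg: "\<not> unique_furstenberg archimedean_character"
  using pretentious_to.unique_furstenberg_imp_rap(1)[OF archimedean_character_pretentious_to] by auto

lemma pretentious_automatic_imp_toeplitz:
  assumes f: "f \<in> pretentious_class" and "automatic f"
  shows "toeplitz f"
proof (cases "f 1 = 1")
  case True
  then obtain q chi t where "pretentious_to f chi q t" using pretentious_imp_pretentious_to[OF f] by blast
  then show ?thesis using assms(2) by (rule pretentious_to.automatic_imp_toeplitz)
next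
  case False
  then show ?thesis using f mult_class_at_1[of f] toeplitz_zero by (auto simp: pretentious_class_def)
qed

lemma pretentious_toeplitz_imp_rap:
  assumes f: "f \<in> pretentious_class" and "toeplitz f"
  shows "rap f"
proof (cases "f 1 = 1")
  case True
  then obtain q chi t where "pretentious_to f chi q t" using pretentious_imp_pretentious_to[OF f] by blast
  then show ?thesis using assms(2) by (rule pretentious_to.toeplitz_imp_rap)
next
  case False
  then show ?thesis using f mult_class_at_1[of f] periodic_imp_rap[OF periodic_seq_zero] by (auto simp: pretentious_class_def)
qed

lemma pretentious_unique_furstenberg_imp_rap:
  assumes f: "f \<in> pretentious_class" and "unique_furstenberg f"
  shows "rap f"
proof (cases "f 1 = 1")
  case True
  then obtain q chi t where "pretentious_to f chi q t" using pretentious_imp_pretentious_to[OF f] by blast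
  then show ?thesis using assms(2) by (rule pretentious_to.unique_furstenberg_imp_rap(2))
next
  case False
  then show ?thesis using f mult_class_at_1[of f] periodic_imp_rap[OF periodic_seq_zero] by (auto simp: pretentious_class_def)
qed

theorem mainTheorem7:
  shows "{f \<in> pretentious_class. periodic_seq f} \<subset> {f \<in> pretentious_class. automatic f} \<and>
    {f \<in> pretentious_class. automatic f} \<subset> {f \<in> pretentious_class. toeplitz f} \<and>
    {f \<in> pretentious_class. toeplitz f} \<subset> {f \<in> pretentious_class. rap f} \<and>
    {f \<in> pretentious_class. rap f} = {f \<in> pretentious_class. unique_furstenberg f} \<and>
    {f \<in> pretentious_class. unique_furstenberg f} \<subset> pretentious_class"
proof (intro conjI)
  have minus_one: "valuation_power (-1) \<in> pretentious_class" and half: "valuation_power (1 / 2) \<in> pretentious_class"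
    by (auto intro!: valuation_power_pretentious simp: norm_divide)
  show "{f \<in> pretentious_class. periodic_seq f} \<subset> {f \<in> pretentious_class. automatic f}"
    using minus_one valuation_power_minus_one_automatic valuation_power_minus_one_not_periodic periodic_imp_automatic by blast
  show "{f \<in> pretentious_class. automatic f} \<subset> {f \<in> pretentious_class. toeplitz f}"
    using half valuation_power_toeplitz valuation_power_half_not_automatic pretentious_automatic_imp_toeplitz by blast
  show "{f \<in> pretentious_class. toeplitz f} \<subset> {f \<in> pretentious_class. rap f}"
    using squarefree_indicator_pretentious squarefree_indicator_rap squarefree_indicator_not_toeplitz pretentious_toeplitz_imp_rap by blast
  show "{f \<in> pretentious_class. rap f} = {f \<in> pretentious_class. unique_furstenberg f}"
    using pretentious_unique_furstenberg_imp_rap rap_imp_unique_furstenberg by (auto simp: pretentious_class_def)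
  show "{f \<in> pretentious_class. unique_furstenberg f} \<subset> pretentious_class"
    using archimedean_character_pretentious archimedean_character_not_unique_furstenberg by blast
qed

end
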